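(* Let $k\colon\mathbb{R}^n\times\mathbb{R}^n\to\mathbb{R}$ be the neural tangent kernel (NTK) of an infinite-width fully connected, convolutional or residual network whose activation $\phi\colon\mathbb{R}\to\mathbb{R}$ satisfies: (i) $\phi$ is smooth everywhere except on a finite set $D\subset\mathbb{R}$; (ii) for all $j\in\mathbb{N}$ there exist scalars $\lambda_1^{(j)},\lambda_2^{(j)}$ such that $|\phi^{(j)}(x)|\le\lambda_1^{(j)}|x|+\lambda_2^{(j)}$ for all $x\in\mathbb{R}\setminus D$. Then, for any $y\in\mathbb{R}^n$: \begin{itemize} \item if $D=\emptyset$ (i.e. $\phi$ is smooth), then $k(\cdot,y)$ is smooth everywhere over $\mathbb{R}^n$; \item if the linear layers have non-null bias terms ($\beta>0$) and, for all $x,x'\in\mathbb{R}_+$ with $x\neq x'$, $\mathbb{E}_{\varepsilon\sim\mathcal{N}(0,1)}[\phi(x\varepsilon)^2]\neq\mathbb{E}_{\varepsilon\sim\mathcal{N}(0,1)}[\phi(x'\varepsilon)^2]$, then $k(\cdot,y)$ is smooth almost everywhere over $\mathbb{R}^n$, in particular over an open set whose complement has null Lebesgue measure. \end{itemize}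
   Context: "Smooth" means infinitely differentiable. $\phi^{(j)}$ is the $j$-th derivative; values of $\phi'$ on $D$ are arbitrary. $\beta\ge0$ is the scale of bias terms. For a positive semi-definite kernel $A$ and $\psi\colon\mathbb{R}\to\mathbb{R}$, $\mathcal{K}_\psi(A)(x,y)=\mathbb{E}[\psi(u)\psi(v)]$ with $(u,v)$ centered Gaussian with covariance $\begin{pmatrix} A(x,x) & A(x,y) \\ A(x,y) & A(y,y) \end{pmatrix}$. The NTK of a network $f_\vartheta$ (in NTK parameterization, Gaussian initialization) is the infinite-width limit of $\partial_\vartheta f_\vartheta(x)^\top\partial_\vartheta f_\vartheta(y)$. It is given by the following standard recursions. Fully connected, $L$ hidden layers: $\Sigma_0(x,y)=\frac1n x^\top y+\beta^2$, $\Theta_0=\Sigma_0$, and for $1\le\ell\le L$, $\Sigma_\ell=\mathcal{K}_\phi(\Sigma_{\ell-1})+\beta^2$, $\Theta_\ell=\Sigma_\ell+\mathcal{K}_{\phi'}(\Sigma_{\ell-1})\cdot\Theta_{\ell-1}$; $k=\Theta_L$. Residual, $L$ blocks with scale $s>0$: $\Sigma_0(x,y)=\frac1n x^\top y+\beta^2$, $\Theta_0=\Sigma_0$, and for $1\le\ell\le L$, with $S_\ell=\Sigma_{\ell-1}+\beta^2$, $\Sigma_\ell=\Sigma_{\ell-1}+s^2(\mathcal{K}_\phi(S_\ell)+\beta^2)$, $\Theta_\ell=\Theta_{\ell-1}+s^2\big(\mathcal{K}_\phi(S_\ell)+\beta^2+\mathcal{K}_{\phi'}(S_\ell)\cdot(\Theta_{\ell-1}+S_\ell)\big)$;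 $k=\Theta_L+\Sigma_L+\beta^2$ (final linear layer). Convolutional: inputs are signals $x=(x_p)_{p\in P}$, $x_p\in\mathbb{R}^{C_0}$, with $P\subset\mathbb{Z}^m$ finite, $n=C_0|P|$, zero-padded outside $P$; $N\subset\mathbb{Z}^m$ is the finite filter support. Kernels are indexed by $p,q\in P$: $\Sigma_0^{p,q}(x,y)=\frac1{C_0|N|}\sum_{r\in N}x_{p+r}^\top y_{q+r}+\beta^2$, $\Theta_0=\Sigma_0$; $\mathcal{K}_\psi(\Sigma)^{p,q}(x,y)=\mathbb{E}[\psi(u)\psi(v)]$ with $(u,v)$ centered Gaussian with covariance $\begin{pmatrix} \Sigma^{p,p}(x,x) & \Sigma^{p,q}(x,y) \\ \Sigma^{p,q}(x,y) & \Sigma^{q,q}(y,y) \end{pmatrix}$; $\Sigma_\ell^{p,q}=\frac1{|N|}\sum_{r\in N}\mathcal{K}_\phi(\Sigma_{\ell-1})^{p+r,q+r}+\beta^2$, $\Theta_\ell^{p,q}=\Sigma_\ell^{p,q}+\frac1{|N|}\sum_{r\in N}\big(\mathcal{K}_{\phi'}(\Sigma_{\ell-1})\cdot\Theta_{\ell-1}\big)^{p+r,q+r}$ (terms with an index outside $P$ are $0$); and, with $\Gamma^{p,q}=\mathcal{K}_\phi(\Sigma_{L-1})^{p,q}+(\mathcal{K}_{\phi'}(\Sigma_{L-1})\cdot\Theta_{L-1})^{p,q}$, $k=\frac1{|P|}\sum_p\Gamma^{p,p}+\beta^2$ (flattening) or $k=\frac1{|P|^2}\sum_{p,q}\Gamma^{p,q}+\beta^2$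 (global average pooling). *)

theory Defs
  imports "HOL-Probability.Probability"
begin

section \<open>Smooth functions\<close>

primrec times_differentiable_on ::
    "'a::real_normed_vector set \<Rightarrow> ('a \<Rightarrow> 'b::real_normed_vector) \<Rightarrow> nat \<Rightarrow> bool" where
  "times_differentiable_on S f 0 \<longleftrightarrow> continuous_on S f"
| "times_differentiable_on S f (Suc j) \<longleftrightarrow>
     (\<forall>x\<in>S. f differentiable (at x)) \<and>
     (\<forall>v. times_differentiable_on S (\<lambda>x. frechet_derivative f (at x) v) j)"

text \<open>Only meant for open \<open>S\<close> (and finite-dimensional domains), since the derivatives are two-sided.\<close>

definition smooth_on ::
    "'a::real_normed_vector set \<Rightarrow> ('a \<Rightarrow> 'b::real_normed_vector) \<Rightarrow> bool" where
  "smooth_on S f \<longleftrightarrow> (\<forall>j. times_differentiable_on S f j)"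


section \<open>Centered Gaussian vectors\<close>

definition std_gaussian :: "real measure" where
  "std_gaussian = density lborel (\<lambda>x. ennreal (std_normal_density x))"

text \<open>The law of a centered Gaussian pair \<open>(u, v)\<close> with Var \<open>u = a\<close>, Cov \<open>(u, v) = c\<close>,
  Var \<open>v = b\<close>, for a positive semi-definite (possibly singular) covariance matrix.
  It is the image of two independent standard normal variables under the lower triangular
  Cholesky factor of the matrix. If \<open>a = 0\<close>, then also \<open>c = 0\<close>, and the
  convention \<open>x / 0 = 0\<close> gives the correct law of \<open>(0, sqrt b * e2)\<close>.\<close>

definition gaussian_pair :: "real \<Rightarrow> real \<Rightarrow> real \<Rightarrow> (real \<times> real) measure" where
  "gaussian_pair a c b = distr (std_gaussian \<Otimes>\<^sub>M std_gaussian) borel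
     (\<lambda>(e1, e2). (sqrt a * e1, c / sqrt a * e1 + sqrt (b - c\<^sup>2 / a) * e2))"

lemma prob_space_std_gaussian: "prob_space std_gaussian"
  unfolding std_gaussian_def by (rule prob_space_normal_density) simp

lemma sets_std_gaussian [measurable_cong]: "sets std_gaussian = sets borel"
  by (simp add: std_gaussian_def)

lemma std_gaussian_moments:
  shows "integrable std_gaussian (\<lambda>x. x)" "(\<integral>x. x \<partial>std_gaussian) = 0"
    and "integrable std_gaussian (\<lambda>x. x\<^sup>2)" "(\<integral>x. x\<^sup>2 \<partial>std_gaussian) = 1"
proof -
  show "integrable std_gaussian (\<lambda>x. x)"
    using integrable_std_normal_moment[of 1]
    by (simp add: std_gaussian_def integrable_density)
  show "(\<integral>x. x \<partial>std_gaussian) = 0"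
    using integral_std_normal_moment_odd[of 0]
    by (simp add: std_gaussian_def integral_density)
  show "integrable std_gaussian (\<lambda>x. x\<^sup>2)"
    using integrable_std_normal_moment[of 2]
    by (simp add: std_gaussian_def integrable_density)
  show "(\<integral>x. x\<^sup>2 \<partial>std_gaussian) = 1"
    using integral_std_normal_moment_even[of 1]
    by (simp add: std_gaussian_def integral_density)
qed

lemma std_gaussian_pair_moments:
  fixes k l :: nat
  assumes "k \<le> 2" "l \<le> 2"
  shows "integrable (std_gaussian \<Otimes>\<^sub>M std_gaussian) (\<lambda>e. fst e ^ k * snd e ^ l)"
    and "(\<integral>e. fst e ^ k * snd e ^ l \<partial>(std_gaussian \<Otimes>\<^sub>M std_gaussian)) =
         (\<integral>x. x ^ k \<partial>std_gaussian) * (\<integral>x. x ^ l \<partial>std_gaussian)"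
proof -
  interpret G: prob_space std_gaussian by (rule prob_space_std_gaussian)
  interpret P: pair_sigma_finite std_gaussian std_gaussian ..
  have int: "integrable std_gaussian (\<lambda>x. x ^ j)" if "j \<le> 2" for j :: nat
  proof -
    have "j = 0 \<or> j = 1 \<or> j = 2" using that by arith
    then show ?thesis using std_gaussian_moments by auto
  qed
  show i: "integrable (std_gaussian \<Otimes>\<^sub>M std_gaussian) (\<lambda>e. fst e ^ k * snd e ^ l)"
  proof (rule P.Fubini_integrable)
    show "integrable std_gaussian
        (\<lambda>x. \<integral>y. norm (fst (x, y) ^ k * snd (x, y) ^ l) \<partial>std_gaussian)"
      using integrable_norm[OF int[OF assms(1)]] by (simp add: abs_mult)
    show "AE x in std_gaussian. integrable std_gaussian (\<lambda>y. fst (x, y) ^ k * snd (x, y) ^ l)"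
      using int[OF assms(2)] by simp
  qed measurable
  show "(\<integral>e. fst e ^ k * snd e ^ l \<partial>(std_gaussian \<Otimes>\<^sub>M std_gaussian)) =
         (\<integral>x. x ^ k \<partial>std_gaussian) * (\<integral>x. x ^ l \<partial>std_gaussian)"
    by (subst P.integral_fst'[symmetric, OF i]) simp
qed

lemma gaussian_pair_moments:
  assumes "a \<ge> 0" "b \<ge> 0" "c\<^sup>2 \<le> a * b"
  shows "(\<integral>p. fst p \<partial>gaussian_pair a c b) = 0"
    and "(\<integral>p. snd p \<partial>gaussian_pair a c b) = 0"
    and "(\<integral>p. (fst p)\<^sup>2 \<partial>gaussian_pair a c b) = a"
    and "(\<integral>p. fst p * snd p \<partial>gaussian_pair a c b) = c"
    and "(\<integral>p. (snd p)\<^sup>2 \<partial>gaussian_pair a c b) = b"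
proof -
  let ?G = "std_gaussian \<Otimes>\<^sub>M std_gaussian"
  define t d where "t = c / sqrt a" and "d = sqrt (b - c\<^sup>2 / a)"
  have c0: "c = 0" if "a = 0"
    using assms that by simp
  have st: "sqrt a * t = c"
    using c0 assms(1) by (cases "a = 0") (auto simp: t_def)
  have "c\<^sup>2 / a \<le> b"
    using assms by (cases "a = 0") (auto simp: field_simps)
  then have td: "t\<^sup>2 + d\<^sup>2 = b"
    using assms(1) by (simp add: t_def d_def power_divide)
  have int: "integral\<^sup>L (gaussian_pair a c b) f =
      (\<integral>e. f (sqrt a * fst e, t * fst e + d * snd e) \<partial>?G)"
    if [measurable]: "f \<in> borel_measurable borel" for f :: "real \<times> real \<Rightarrow> real"
  proof -
    have [measurable]: "(\<lambda>e. (sqrt a * fst e, t * fst e + d * snd e)) \<in> ?G \<rightarrow>\<^sub>M borel"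
      unfolding borel_prod[symmetric] by measurable
    show ?thesis
      by (simp add: gaussian_pair_def t_def[symmetric] d_def[symmetric] case_prod_unfold integral_distr)
  qed
  have I: "integrable ?G (\<lambda>e. fst e)" "integrable ?G (\<lambda>e. snd e)"
    "integrable ?G (\<lambda>e. (fst e)\<^sup>2)" "integrable ?G (\<lambda>e. (snd e)\<^sup>2)"
    "integrable ?G (\<lambda>e. fst e * snd e)"
    using std_gaussian_pair_moments(1)[of 1 0] std_gaussian_pair_moments(1)[of 0 1]
      std_gaussian_pair_moments(1)[of 2 0] std_gaussian_pair_moments(1)[of 0 2]
      std_gaussian_pair_moments(1)[of 1 1] by simp_all
  have V: "(\<integral>e. fst e \<partial>?G) = 0" "(\<integral>e. snd e \<partial>?G) = 0"
    "(\<integral>e. (fst e)\<^sup>2 \<partial>?G) = 1" "(\<integral>e. (snd e)\<^sup>2 \<partial>?G) = 1"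
    "(\<integral>e. fst e * snd e \<partial>?G) = 0"
    using std_gaussian_pair_moments(2)[of 1 0] std_gaussian_pair_moments(2)[of 0 1]
      std_gaussian_pair_moments(2)[of 2 0] std_gaussian_pair_moments(2)[of 0 2]
      std_gaussian_pair_moments(2)[of 1 1] std_gaussian_moments
      prob_space.prob_space[OF prob_space_std_gaussian] by simp_all
  have [measurable]: "fst \<in> borel_measurable (borel :: (real \<times> real) measure)"
    "snd \<in> borel_measurable (borel :: (real \<times> real) measure)"
    unfolding borel_prod[symmetric] by measurable
  show "(\<integral>p. fst p \<partial>gaussian_pair a c b) = 0"
    by (subst int) (simp_all add: V)
  show "(\<integral>p. snd p \<partial>gaussian_pair a c b) = 0"
    by (subst int) (simp_all add: V I)
  show "(\<integral>p. (fst p)\<^sup>2 \<partial>gaussian_pair a c b) = a"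
    by (subst int) (simp_all add: V power_mult_distrib assms(1))
  have "(\<integral>p. fst p * snd p \<partial>gaussian_pair a c b) =
      (\<integral>e. (sqrt a * t) * (fst e)\<^sup>2 + (sqrt a * d) * (fst e * snd e) \<partial>?G)"
    by (subst int) (simp_all add: algebra_simps power2_eq_square)
  also have "\<dots> = c"
    by (simp add: I V st)
  finally show "(\<integral>p. fst p * snd p \<partial>gaussian_pair a c b) = c" .
  have "(\<integral>p. (snd p)\<^sup>2 \<partial>gaussian_pair a c b) =
      (\<integral>e. t\<^sup>2 * (fst e)\<^sup>2 + (d\<^sup>2 * (snd e)\<^sup>2 + (2 * t * d) * (fst e * snd e)) \<partial>?G)"
    by (subst int) (simp_all add: algebra_simps power2_eq_square)
  also have "\<dots> = b"
    by (simp add: I V td)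
  finally show "(\<integral>p. (snd p)\<^sup>2 \<partial>gaussian_pair a c b) = b" .
qed


section \<open>Neural tangent kernels\<close>

definition dual_kernel :: "(real \<Rightarrow> real) \<Rightarrow> ('a \<Rightarrow> 'a \<Rightarrow> real) \<Rightarrow> 'a \<Rightarrow> 'a \<Rightarrow> real" where
  "dual_kernel \<psi> A x y =
     (\<integral>p. \<psi> (fst p) * \<psi> (snd p) \<partial>gaussian_pair (A x x) (A x y) (A y y))"

text \<open>Throughout, \<open>d\<phi>\<close> is the function used for the derivative of the activation \<open>\<phi>\<close>; it is a separate
  parameter because its values at the singularities of \<open>\<phi>\<close> are arbitrary.\<close>

definition input_kernel :: "real \<Rightarrow> real ^ 'n \<Rightarrow> real ^ 'n \<Rightarrow> real" where
  "input_kernel \<beta> x y = (x \<bullet> y) / real CARD('n) + \<beta>\<^sup>2"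

subsection \<open>Fully connected networks\<close>

primrec fc_cov ::
    "(real \<Rightarrow> real) \<Rightarrow> real \<Rightarrow> nat \<Rightarrow> real ^ 'n \<Rightarrow> real ^ 'n \<Rightarrow> real" where
  "fc_cov \<phi> \<beta> 0 = input_kernel \<beta>"
| "fc_cov \<phi> \<beta> (Suc l) = (\<lambda>x y. dual_kernel \<phi> (fc_cov \<phi> \<beta> l) x y + \<beta>\<^sup>2)"

primrec fc_ntk ::
    "(real \<Rightarrow> real) \<Rightarrow> (real \<Rightarrow> real) \<Rightarrow> real \<Rightarrow> nat \<Rightarrow> real ^ 'n \<Rightarrow> real ^ 'n \<Rightarrow> real" where
  "fc_ntk \<phi> d\<phi> \<beta> 0 = input_kernel \<beta>"
| "fc_ntk \<phi> d\<phi> \<beta> (Suc l) = (\<lambda>x y. fc_cov \<phi> \<beta> (Suc l) x y +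
     dual_kernel d\<phi> (fc_cov \<phi> \<beta> l) x y * fc_ntk \<phi> d\<phi> \<beta> l x y)"

subsection \<open>Residual networks\<close>

primrec res_cov ::
    "(real \<Rightarrow> real) \<Rightarrow> real \<Rightarrow> real \<Rightarrow> nat \<Rightarrow> real ^ 'n \<Rightarrow> real ^ 'n \<Rightarrow> real" where
  "res_cov \<phi> \<beta> s 0 = input_kernel \<beta>"
| "res_cov \<phi> \<beta> s (Suc l) = (\<lambda>x y. res_cov \<phi> \<beta> s l x y +
     s\<^sup>2 * (dual_kernel \<phi> (\<lambda>x y. res_cov \<phi> \<beta> s l x y + \<beta>\<^sup>2) x y + \<beta>\<^sup>2))"

text \<open>\<open>res_tan\<close> is the tangent kernel of the blocks, without the final linear layer.\<close>

primrec res_tan ::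
    "(real \<Rightarrow> real) \<Rightarrow> (real \<Rightarrow> real) \<Rightarrow> real \<Rightarrow> real \<Rightarrow> nat \<Rightarrow> real ^ 'n \<Rightarrow> real ^ 'n \<Rightarrow> real" where
  "res_tan \<phi> d\<phi> \<beta> s 0 = input_kernel \<beta>"
| "res_tan \<phi> d\<phi> \<beta> s (Suc l) = (\<lambda>x y.
     let S = (\<lambda>x y. res_cov \<phi> \<beta> s l x y + \<beta>\<^sup>2)
     in res_tan \<phi> d\<phi> \<beta> s l x y +
        s\<^sup>2 * (dual_kernel \<phi> S x y + \<beta>\<^sup>2 +
              dual_kernel d\<phi> S x y * (res_tan \<phi> d\<phi> \<beta> s l x y + S x y)))"

definition res_ntk ::
    "(real \<Rightarrow> real) \<Rightarrow> (real \<Rightarrow> real) \<Rightarrow> real \<Rightarrow> real \<Rightarrow> nat \<Rightarrow> real ^ 'n \<Rightarrow> real ^ 'n \<Rightarrow> real" where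
  "res_ntk \<phi> d\<phi> \<beta> s L x y = res_tan \<phi> d\<phi> \<beta> s L x y + res_cov \<phi> \<beta> s L x y + \<beta>\<^sup>2"

subsection \<open>Convolutional networks\<close>

text \<open>Positions are vectors in \<open>int ^ 'm\<close> and channels are elements of the finite type \<open>'c\<close>. A signal on
  the position set \<open>P\<close> is stored as a vector in \<open>real ^ 'n\<close> by means of a bijection \<open>ix\<close> from
  \<open>P \<times> UNIV\<close> onto the coordinates, which forces \<open>CARD('n) = CARD('c) * card P\<close>.\<close>

definition conv_shape ::
    "(int ^ 'm) set \<Rightarrow> (int ^ 'm) set \<Rightarrow> ((int ^ 'm) \<times> 'c::finite \<Rightarrow> 'n::finite) \<Rightarrow> bool" where
  "conv_shape P N ix \<longleftrightarrow>
     finite P \<and> finite N \<and> N \<noteq> {} \<and> bij_betw ix (P \<times> UNIV) UNIV"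

text \<open>The zero-padded signal.\<close>

definition pixel ::
    "(int ^ 'm) set \<Rightarrow> ((int ^ 'm) \<times> 'c::finite \<Rightarrow> 'n::finite) \<Rightarrow> real ^ 'n \<Rightarrow> int ^ 'm \<Rightarrow> real ^ 'c" where
  "pixel P ix x p = (if p \<in> P then (\<chi> i. x $ ix (p, i)) else 0)"

text \<open>A kernel with positions \<open>p, q\<close> as upper indices is encoded as a kernel on pairs \<open>(p, x)\<close>, \<open>(q, y)\<close>;
  then \<open>dual_kernel\<close> is the dual operator on such kernels. Only the values at positions in \<open>P\<close> matter.
  \<open>patch_mean\<close> averages over the filter support, terms with an index outside \<open>P\<close> being \<open>0\<close>.\<close>

definition patch_mean ::
    "(int ^ 'm) set \<Rightarrow> (int ^ 'm) set \<Rightarrow>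
     ((int ^ 'm) \<times> 'a \<Rightarrow> (int ^ 'm) \<times> 'a \<Rightarrow> real) \<Rightarrow> (int ^ 'm) \<times> 'a \<Rightarrow> (int ^ 'm) \<times> 'a \<Rightarrow> real" where
  "patch_mean P N A = (\<lambda>(p, x) (q, y).
     (\<Sum>r\<in>N. if p + r \<in> P \<and> q + r \<in> P then A (p + r, x) (q + r, y) else 0) / real (card N))"

definition conv_input_kernel ::
    "real \<Rightarrow> (int ^ 'm) set \<Rightarrow> (int ^ 'm) set \<Rightarrow> ((int ^ 'm) \<times> 'c::finite \<Rightarrow> 'n::finite) \<Rightarrow>
     (int ^ 'm) \<times> (real ^ 'n) \<Rightarrow> (int ^ 'm) \<times> (real ^ 'n) \<Rightarrow> real" where
  "conv_input_kernel \<beta> P N ix = (\<lambda>(p, x) (q, y).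
     (\<Sum>r\<in>N. pixel P ix x (p + r) \<bullet> pixel P ix y (q + r)) / (real CARD('c) * real (card N)) + \<beta>\<^sup>2)"

primrec conv_cov ::
    "(real \<Rightarrow> real) \<Rightarrow> real \<Rightarrow> (int ^ 'm) set \<Rightarrow> (int ^ 'm) set \<Rightarrow> ((int ^ 'm) \<times> 'c::finite \<Rightarrow> 'n::finite) \<Rightarrow> nat \<Rightarrow>
     (int ^ 'm) \<times> (real ^ 'n) \<Rightarrow> (int ^ 'm) \<times> (real ^ 'n) \<Rightarrow> real" where
  "conv_cov \<phi> \<beta> P N ix 0 = conv_input_kernel \<beta> P N ix"
| "conv_cov \<phi> \<beta> P N ix (Suc l) = (\<lambda>a b.
     patch_mean P N (dual_kernel \<phi> (conv_cov \<phi> \<beta> P N ix l)) a b + \<beta>\<^sup>2)"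

primrec conv_tan ::
    "(real \<Rightarrow> real) \<Rightarrow> (real \<Rightarrow> real) \<Rightarrow> real \<Rightarrow> (int ^ 'm) set \<Rightarrow> (int ^ 'm) set \<Rightarrow>
     ((int ^ 'm) \<times> 'c::finite \<Rightarrow> 'n::finite) \<Rightarrow> nat \<Rightarrow>
     (int ^ 'm) \<times> (real ^ 'n) \<Rightarrow> (int ^ 'm) \<times> (real ^ 'n) \<Rightarrow> real" where
  "conv_tan \<phi> d\<phi> \<beta> P N ix 0 = conv_input_kernel \<beta> P N ix"
| "conv_tan \<phi> d\<phi> \<beta> P N ix (Suc l) = (\<lambda>a b. conv_cov \<phi> \<beta> P N ix (Suc l) a b +
     patch_mean P N
       (\<lambda>a b. dual_kernel d\<phi> (conv_cov \<phi> \<beta> P N ix l) a b * conv_tan \<phi> d\<phi> \<beta> P N ix l a b) a b)"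

text \<open>The kernel \<open>\<Gamma>\<close> before the read-out, and the tangent kernels of networks with \<open>L \<ge> 1\<close> hidden
  layers, for a read-out by flattening and by global average pooling.\<close>

definition conv_last ::
    "(real \<Rightarrow> real) \<Rightarrow> (real \<Rightarrow> real) \<Rightarrow> real \<Rightarrow> (int ^ 'm) set \<Rightarrow> (int ^ 'm) set \<Rightarrow>
     ((int ^ 'm) \<times> 'c::finite \<Rightarrow> 'n::finite) \<Rightarrow> nat \<Rightarrow>
     (int ^ 'm) \<times> (real ^ 'n) \<Rightarrow> (int ^ 'm) \<times> (real ^ 'n) \<Rightarrow> real" where
  "conv_last \<phi> d\<phi> \<beta> P N ix L a b =
     dual_kernel \<phi> (conv_cov \<phi> \<beta> P N ix (L - 1)) a b +
     dual_kernel d\<phi> (conv_cov \<phi> \<beta> P N ix (L - 1)) a b * conv_tan \<phi> d\<phi> \<beta> P N ix (L - 1) a b"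

definition conv_flat_ntk ::
    "(real \<Rightarrow> real) \<Rightarrow> (real \<Rightarrow> real) \<Rightarrow> real \<Rightarrow> (int ^ 'm) set \<Rightarrow> (int ^ 'm) set \<Rightarrow>
     ((int ^ 'm) \<times> 'c::finite \<Rightarrow> 'n::finite) \<Rightarrow> nat \<Rightarrow> real ^ 'n \<Rightarrow> real ^ 'n \<Rightarrow> real" where
  "conv_flat_ntk \<phi> d\<phi> \<beta> P N ix L x y =
     (\<Sum>p\<in>P. conv_last \<phi> d\<phi> \<beta> P N ix L (p, x) (p, y)) / real (card P) + \<beta>\<^sup>2"

definition conv_gap_ntk ::
    "(real \<Rightarrow> real) \<Rightarrow> (real \<Rightarrow> real) \<Rightarrow> real \<Rightarrow> (int ^ 'm) set \<Rightarrow> (int ^ 'm) set \<Rightarrow>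
     ((int ^ 'm) \<times> 'c::finite \<Rightarrow> 'n::finite) \<Rightarrow> nat \<Rightarrow> real ^ 'n \<Rightarrow> real ^ 'n \<Rightarrow> real" where
  "conv_gap_ntk \<phi> d\<phi> \<beta> P N ix L x y =
     (\<Sum>p\<in>P. \<Sum>q\<in>P. conv_last \<phi> d\<phi> \<beta> P N ix L (p, x) (q, y)) / (real (card P))\<^sup>2 + \<beta>\<^sup>2"

end

(*
  Conditioning on the second variable writes the dual kernel E[psi(u) psi(v)] with covariance
  ((a, c), (c, b)) as Phi(m, t) = E[theta(e) psi(m e + sqrt t e')], where e, e' are independent standard
  normal, theta(e) = psi(sqrt b e), m = c / sqrt b and t = a - c^2 / b. If psi is smooth with polynomially
  bounded derivatives, then Stein's identity turns the derivative in t into (1/2) E[theta psi''], which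
  remains valid at the boundary t = 0, so Phi is smooth up to the boundary and singular covariances are
  harmless. If psi is only measurable, then near a point with t > 0 a small part of the variance can be
  moved into psi, which becomes smooth by Gaussian convolution.

  For an activation with singularities it remains to see that the covariances are non-singular off a
  closed null set. With a bias, singularity at (x, y) after a layer forces the same random variable at x
  and y almost surely; the activation is not almost everywhere constant by the hypothesis on its second
  moments, so this can only be inherited from the input. If no coordinate of x is 0 or a coordinate
  of y, then the patches of x and y at any two positions differ, except for patches of x that
  consist of padding only, where the covariance does not depend on x at all.
*)
theory Submission
  imports Defs
begin

subsection \<open>Calculus of smooth functions\<close>

text \<open>The induction over the layers alternates between two notions of non-degeneracy. A dual
  kernel of a non-smooth activation needs the determinant condition
  \<open>c\<^sup>2 < a * b\<close>, but this fails for proportional inputs before the bias is added,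
  and for a position paired with a zero of the padding. What survives there is the weaker gap
  \<open>2 * c < a + b\<close>, a positive mean-square distance. A sum has a gap as soon as one
  summand has it, so the gap goes through skip connections and patch averages, and the next bias
  turns it back into the determinant condition. Keeping the fixed variance \<open>b\<close> inside
  theta has the effect that only the other factor is ever differentiated. Each derivative in m
  multiplies theta by e and differentiates psi, so the induction on the order of differentiability
  runs over all pairs of a theta of polynomial growth and a smooth psi. At t = 0 the derivative in t
  is one-sided, which is enough because variances never become negative.\<close>

lemma times_differentiable_on_cong:
  assumes "open S" "times_differentiable_on S f j" "\<And>x. x \<in> S \<Longrightarrow> f x = g x"
  shows "times_differentiable_on S g j"
  using assms(2,3)
proof (induction j arbitrary: f g)
  case 0
  then show ?case using continuous_on_cong[of S S f g] by simp
next
  case (Suc j)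
  have D: "(g has_derivative frechet_derivative f (at x)) (at x)" if "x \<in> S" for x
  proof (rule has_derivative_transform_within_open[OF _ assms(1) that])
    show "(f has_derivative frechet_derivative f (at x)) (at x)"
      using Suc.prems(1) that by (simp add: frechet_derivative_works)
  qed (use Suc.prems(2) in auto)
  have "times_differentiable_on S (\<lambda>x. frechet_derivative g (at x) v) j" for v
  proof (rule Suc.IH)
    show "times_differentiable_on S (\<lambda>x. frechet_derivative f (at x) v) j"
      using Suc.prems(1) by simp
  qed (use frechet_derivative_at[OF D] in auto)
  with D show ?case by (auto simp: differentiable_def)
qed

lemma times_differentiable_on_SucI:
  assumes "open S" "\<And>x. x \<in> S \<Longrightarrow> (f has_derivative f' x) (at x)"
    and "\<And>v. times_differentiable_on S (\<lambda>x. f' x v) j"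
  shows "times_differentiable_on S f (Suc j)"
proof -
  have "times_differentiable_on S (\<lambda>x. frechet_derivative f (at x) v) j" for v
    by (rule times_differentiable_on_cong[OF assms(1) assms(3)[of v]])
       (use frechet_derivative_at[OF assms(2)] in auto)
  then show ?thesis using assms(2) by (auto simp: differentiable_def)
qed

lemma times_differentiable_on_lower:
  "times_differentiable_on S f (Suc j) \<Longrightarrow> times_differentiable_on S f j"
proof (induction j arbitrary: f)
  case 0
  then show ?case
    by (simp add: continuous_at_imp_continuous_on differentiable_imp_continuous_within)
next
  case (Suc j)
  from Suc.prems show ?case by (auto intro!: Suc.IH simp del: times_differentiable_on.simps(1))
qed

lemma times_differentiable_on_mono:
  "times_differentiable_on S f j \<Longrightarrow> T \<subseteq> S \<Longrightarrow> times_differentiable_on T f j"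
  by (induction j arbitrary: f) (auto intro: continuous_on_subset)

lemma times_differentiable_on_local:
  assumes "\<And>x. x \<in> S \<Longrightarrow> \<exists>T. open T \<and> x \<in> T \<and> times_differentiable_on T f j"
  shows "times_differentiable_on S f j"
  using assms
proof (induction j arbitrary: f)
  case 0
  then show ?case
    by (auto intro!: continuous_at_imp_continuous_on simp: continuous_on_eq_continuous_at)
       (metis continuous_on_eq_continuous_at)
next
  case (Suc j)
  have "f differentiable (at x)" if "x \<in> S" for x
    using Suc.prems[OF that] by auto
  moreover have "times_differentiable_on S (\<lambda>x. frechet_derivative f (at x) v) j" for v
    by (rule Suc.IH) (use Suc.prems in fastforce)
  ultimately show ?case by simp
qed

lemma times_differentiable_on_const:
  assumes "open S" shows "times_differentiable_on S (\<lambda>x. k) j"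
proof (induction j arbitrary: k)
  case (Suc j)
  show ?case by (rule times_differentiable_on_SucI[OF assms]) (auto intro!: derivative_eq_intros Suc)
qed simp

lemma times_differentiable_on_add:
  assumes "open S" "times_differentiable_on S f j" "times_differentiable_on S g j"
  shows "times_differentiable_on S (\<lambda>x. f x + g x) j"
  using assms(2,3)
proof (induction j arbitrary: f g)
  case (Suc j)
  show ?case
  proof (rule times_differentiable_on_SucI[OF assms(1)])
    show "((\<lambda>x. f x + g x) has_derivative
        (\<lambda>v. frechet_derivative f (at x) v + frechet_derivative g (at x) v)) (at x)" if "x \<in> S" for x
      using Suc.prems that by (intro has_derivative_add) (auto simp flip: frechet_derivative_works)
  qed (use Suc in simp)
qed (auto intro: continuous_on_add)

lemma times_differentiable_on_mult:
  fixes f g :: "'a::real_normed_vector \<Rightarrow> real"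
  assumes "open S" "times_differentiable_on S f j" "times_differentiable_on S g j"
  shows "times_differentiable_on S (\<lambda>x. f x * g x) j"
  using assms(2,3)
proof (induction j arbitrary: f g)
  case (Suc j)
  show ?case
  proof (rule times_differentiable_on_SucI[OF assms(1)])
    show "((\<lambda>x. f x * g x) has_derivative
        (\<lambda>v. f x * frechet_derivative g (at x) v + frechet_derivative f (at x) v * g x)) (at x)"
      if "x \<in> S" for x
      using Suc.prems that by (intro has_derivative_mult) (auto simp flip: frechet_derivative_works)
    show "times_differentiable_on S (\<lambda>x. f x * frechet_derivative g (at x) v + frechet_derivative f (at x) v * g x) j"
      for v
      using Suc.prems times_differentiable_on_lower[OF Suc.prems(1)]
        times_differentiable_on_lower[OF Suc.prems(2)]
      by (intro times_differentiable_on_add assms Suc.IH) auto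
  qed
qed (auto intro: continuous_on_mult)

lemma times_differentiable_on_sum:
  assumes "open S" "\<And>m. m \<in> M \<Longrightarrow> times_differentiable_on S (f m) j"
  shows "times_differentiable_on S (\<lambda>x. \<Sum>m\<in>M. f m x) j"
  using assms(2)
  by (induction M rule: infinite_finite_induct)
     (auto intro!: times_differentiable_on_const times_differentiable_on_add assms(1))

lemma smooth_on_cong:
  "open S \<Longrightarrow> smooth_on S f \<Longrightarrow> (\<And>x. x \<in> S \<Longrightarrow> f x = g x) \<Longrightarrow> smooth_on S g"
  unfolding smooth_on_def by (blast intro: times_differentiable_on_cong)

lemma smooth_on_subset: "smooth_on S f \<Longrightarrow> T \<subseteq> S \<Longrightarrow> smooth_on T f"
  unfolding smooth_on_def by (blast intro: times_differentiable_on_mono)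

lemma smooth_on_local:
  assumes "\<And>x. x \<in> S \<Longrightarrow> \<exists>T. open T \<and> x \<in> T \<and> smooth_on T f"
  shows "smooth_on S f"
  using assms unfolding smooth_on_def by (meson times_differentiable_on_local)

lemma smooth_on_const [intro]: "open S \<Longrightarrow> smooth_on S (\<lambda>x. k)"
  by (simp add: smooth_on_def times_differentiable_on_const)

lemma smooth_on_add [intro]:
  "open S \<Longrightarrow> smooth_on S f \<Longrightarrow> smooth_on S g \<Longrightarrow> smooth_on S (\<lambda>x. f x + g x)"
  by (simp add: smooth_on_def times_differentiable_on_add)

lemma smooth_on_mult [intro]:
  fixes f g :: "'a::real_normed_vector \<Rightarrow> real"
  shows "open S \<Longrightarrow> smooth_on S f \<Longrightarrow> smooth_on S g \<Longrightarrow> smooth_on S (\<lambda>x. f x * g x)"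
  by (simp add: smooth_on_def times_differentiable_on_mult)

lemma smooth_on_sum [intro]:
  "open S \<Longrightarrow> (\<And>m. m \<in> M \<Longrightarrow> smooth_on S (f m)) \<Longrightarrow> smooth_on S (\<lambda>x. \<Sum>m\<in>M. f m x)"
  by (simp add: smooth_on_def times_differentiable_on_sum)

lemma smooth_on_divide_const [intro]:
  fixes f :: "'a::real_normed_vector \<Rightarrow> real"
  shows "open S \<Longrightarrow> smooth_on S f \<Longrightarrow> smooth_on S (\<lambda>x. f x / k)"
  using smooth_on_mult[of S f "\<lambda>_. 1 / k"] by auto

lemma smooth_on_diff [intro]:
  fixes f g :: "'a::real_normed_vector \<Rightarrow> real"
  assumes "open S" "smooth_on S f" "smooth_on S g" shows "smooth_on S (\<lambda>x. f x - g x)"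
  using smooth_on_add[OF assms(1,2) smooth_on_mult[OF assms(1) smooth_on_const[OF assms(1), of "-1"] assms(3)]]
  by simp

lemma smooth_on_bounded_linear:
  assumes "open S" "bounded_linear f" shows "smooth_on S f"
proof -
  have "times_differentiable_on S f j" for j
  proof (cases j)
    case 0
    then show ?thesis using assms linear_continuous_on by auto
  next
    case (Suc i)
    show ?thesis unfolding Suc
      by (rule times_differentiable_on_SucI[OF assms(1)])
         (auto intro: assms times_differentiable_on_const bounded_linear_imp_has_derivative)
  qed
  then show ?thesis by (simp add: smooth_on_def)
qed

lemma smooth_on_has_derivative:
  assumes "smooth_on S f" "x \<in> S"
  shows "(f has_derivative frechet_derivative f (at x)) (at x)"
proof -
  have "times_differentiable_on S f (Suc 0)" using assms(1) unfolding smooth_on_def by blast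
  then show ?thesis using assms(2) by (simp add: frechet_derivative_works)
qed

lemma smooth_on_frechet_derivative:
  assumes "smooth_on S f" shows "smooth_on S (\<lambda>x. frechet_derivative f (at x) v)"
  unfolding smooth_on_def
proof
  fix j
  have "times_differentiable_on S f (Suc j)" using assms unfolding smooth_on_def by blast
  then show "times_differentiable_on S (\<lambda>x. frechet_derivative f (at x) v) j" by simp
qed

lemma smooth_on_imp_continuous_on: "smooth_on S f \<Longrightarrow> continuous_on S f"
  unfolding smooth_on_def by (metis times_differentiable_on.simps(1))

text \<open>Differentiating one member of the family leads to other members, so no formula for
  higher derivatives is needed: the order of differentiability is raised for all members at once.
  The application is to Gaussian integrals indexed by the two functions in the integrand.\<close>

lemma smooth_on_family:
  fixes \<Phi> :: "'i \<Rightarrow> 'a::real_normed_vector \<Rightarrow> real"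
  assumes S: "open S" and "i \<in> I"
    and D: "\<And>i x. i \<in> I \<Longrightarrow> x \<in> S \<Longrightarrow>
      (\<Phi> i has_derivative (\<lambda>v. \<Sum>m\<in>M. \<Phi> (d i m) x * w i m x v)) (at x)"
    and d: "\<And>i m. i \<in> I \<Longrightarrow> m \<in> M \<Longrightarrow> d i m \<in> I"
    and w: "\<And>i m v. i \<in> I \<Longrightarrow> m \<in> M \<Longrightarrow> smooth_on S (\<lambda>x. w i m x v)"
  shows "smooth_on S (\<Phi> i)"
proof -
  have "\<forall>i\<in>I. times_differentiable_on S (\<Phi> i) j" for j
  proof (induction j)
    case 0
    then show ?case
      using D by (auto intro!: continuous_at_imp_continuous_on has_derivative_continuous)
  next
    case (Suc j)
    show ?case
    proof
      fix i assume i: "i \<in> I"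
      show "times_differentiable_on S (\<Phi> i) (Suc j)"
      proof (rule times_differentiable_on_SucI[OF S D[OF i]])
        fix v
        show "times_differentiable_on S (\<lambda>x. \<Sum>m\<in>M. \<Phi> (d i m) x * w i m x v) j"
          using Suc d[OF i] w[OF i] unfolding smooth_on_def
          by (intro times_differentiable_on_sum times_differentiable_on_mult S) auto
      qed
    qed
  qed
  with assms(2) show ?thesis by (simp add: smooth_on_def)
qed


subsection \<open>Differentiation under the integral sign\<close>

text \<open>Dominated convergence for the error quotient of the derivative, taken along sequences.
  The parameter is a vector because Gaussian integrals are differentiated jointly in slope and
  standard deviation.\<close>

lemma has_derivative_integral:
  fixes f :: "'a \<Rightarrow> 'p::euclidean_space \<Rightarrow> real"
  assumes X: "convex X" "p0 \<in> X"
    and int: "\<And>p. p \<in> X \<Longrightarrow> integrable M (\<lambda>x. f x p)"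
    and D: "\<And>x p. p \<in> X \<Longrightarrow> (f x has_derivative f' x p) (at p within X)"
    and meas: "\<And>v. (\<lambda>x. f' x p0 v) \<in> borel_measurable M"
    and bound: "\<And>x p v. p \<in> X \<Longrightarrow> \<bar>f' x p v\<bar> \<le> w x * norm v"
    and w: "integrable M w"
  shows "((\<lambda>p. \<integral>x. f x p \<partial>M) has_derivative (\<lambda>v. \<integral>x. f' x p0 v \<partial>M)) (at p0 within X)"
proof -
  have lin: "bounded_linear (f' x p0)" for x
    using D[OF X(2)] by (rule has_derivative_bounded_linear)
  have int': "integrable M (\<lambda>x. f' x p0 v)" for v
    by (rule Bochner_Integration.integrable_bound[OF integrable_mult_left[OF w, of "norm v"] meas])
       (use order_trans[OF bound[OF X(2)] abs_ge_self] in auto)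
  have bl: "bounded_linear (\<lambda>v. \<integral>x. f' x p0 v \<partial>M)"
  proof (rule bounded_linear_intro[where K = "\<integral>x. w x \<partial>M"])
    fix u v r
    show "(\<integral>x. f' x p0 (u + v) \<partial>M) = (\<integral>x. f' x p0 u \<partial>M) + (\<integral>x. f' x p0 v \<partial>M)"
      by (simp add: linear_add[OF bounded_linear.linear[OF lin]] int')
    show "(\<integral>x. f' x p0 (r *\<^sub>R v) \<partial>M) = r *\<^sub>R (\<integral>x. f' x p0 v \<partial>M)"
      by (simp add: linear_scale[OF bounded_linear.linear[OF lin]])
    have "norm (\<integral>x. f' x p0 v \<partial>M) \<le> (\<integral>x. norm (f' x p0 v) \<partial>M)" by simp
    also have "\<dots> \<le> (\<integral>x. w x * norm v \<partial>M)"
      by (intro integral_mono int' integrable_norm integrable_mult_left w) (use bound[OF X(2)] in simp)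
    finally show "norm (\<integral>x. f' x p0 v \<partial>M) \<le> norm v * (\<integral>x. w x \<partial>M)"
      by (simp add: mult.commute)
  qed
  have lip: "\<bar>f x p - f x p0\<bar> \<le> w x * norm (p - p0)" if "p \<in> X" for x p
  proof -
    have "norm (f x p - f x p0) \<le> w x * norm (p - p0)"
    proof (rule differentiable_bound[OF X(1) D[of _ x] _ that X(2)])
      show "onorm (f' x q) \<le> w x" if "q \<in> X" for q
        by (rule onorm_le) (use bound[OF that] in simp)
    qed
    then show ?thesis by simp
  qed
  let ?q = "\<lambda>p x. (f x p - f x p0 - f' x p0 (p - p0)) / norm (p - p0)"
  have "((\<lambda>p. \<integral>x. ?q p x \<partial>M) \<longlongrightarrow> (\<integral>x. 0 \<partial>M)) (at p0 within X)"
  proof (subst tendsto_at_iff_sequentially, intro allI impI)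
    fix P :: "nat \<Rightarrow> 'p" assume P: "\<forall>i. P i \<in> X - {p0}" "P \<longlonglongrightarrow> p0"
    then have PX: "P i \<in> X" "P i \<noteq> p0" for i by auto
    have "(\<lambda>i. \<integral>x. ?q (P i) x \<partial>M) \<longlonglongrightarrow> (\<integral>x. 0 \<partial>M)"
    \<comment> \<open>One \<open>w\<close> bounds the difference quotient, by the mean value
      inequality on the convex set \<open>X\<close>; the other one bounds the linear term
      \<open>f' x p0\<close>.\<close>
    proof (rule integral_dominated_convergence[where w = "\<lambda>x. 2 * w x"])
      show "integrable M (\<lambda>x. 2 * w x)" using w by simp
      show "(\<lambda>x. ?q (P i) x) \<in> borel_measurable M" for i
        using int[OF PX(1)] int[OF X(2)] meas by (intro borel_measurable_divide borel_measurable_diff) auto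
      have "(\<lambda>i. ?q (P i) x) \<longlonglongrightarrow> 0" for x
      proof -
        have "((\<lambda>p. ?q p x) \<longlongrightarrow> 0) (at p0 within X)"
          using D[OF X(2), of x] unfolding has_derivative_at_within by (simp add: divide_inverse mult.commute)
        then show ?thesis using P unfolding tendsto_at_iff_sequentially comp_def by blast
      qed
      then show "AE x in M. (\<lambda>i. ?q (P i) x) \<longlonglongrightarrow> 0" by simp
      have "norm (?q (P i) x) \<le> 2 * w x" for i x
      proof -
        have "\<bar>f x (P i) - f x p0 - f' x p0 (P i - p0)\<bar> \<le> 2 * w x * norm (P i - p0)"
          using lip[OF PX(1), of x i] bound[OF X(2), of x "P i - p0"] by linarith
        then show ?thesis using PX(2)[of i] by (simp add: divide_le_eq)
      qed
      then show "AE x in M. norm (?q (P i) x) \<le> 2 * w x" for i by simp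
    qed simp
    then show "((\<lambda>p. \<integral>x. ?q p x \<partial>M) \<circ> P) \<longlonglongrightarrow> (\<integral>x. 0 \<partial>M)" by (simp add: comp_def)
  qed
  moreover have "eventually (\<lambda>p. (\<integral>x. ?q p x \<partial>M) =
      ((\<integral>x. f x p \<partial>M) - (\<integral>x. f x p0 \<partial>M) - (\<integral>x. f' x p0 (p - p0) \<partial>M)) / norm (p - p0))
      (at p0 within X)"
    unfolding eventually_at_filter using int int[OF X(2)] int' by (auto intro!: always_eventually)
  ultimately have "((\<lambda>p. ((\<integral>x. f x p \<partial>M) - (\<integral>x. f x p0 \<partial>M) - (\<integral>x. f' x p0 (p - p0) \<partial>M)) / norm (p - p0))
      \<longlongrightarrow> (\<integral>x. 0 \<partial>M)) (at p0 within X)"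
    by (rule Lim_transform_eventually)
  then show ?thesis
    unfolding has_derivative_at_within using bl by (simp add: divide_inverse mult.commute)
qed

subsection \<open>Functions of polynomial growth\<close>

definition poly_growth :: "(real \<Rightarrow> real) \<Rightarrow> bool" where
  "poly_growth f \<longleftrightarrow> f \<in> borel_measurable borel \<and> (\<exists>C k. \<forall>x. \<bar>f x\<bar> \<le> C * (1 + \<bar>x\<bar>) ^ k)"

lemma poly_growth_measurable [measurable_dest]: "poly_growth f \<Longrightarrow> f \<in> borel_measurable borel"
  by (simp add: poly_growth_def)

lemma poly_growthE:
  assumes "poly_growth f"
  obtains C k where "C \<ge> 0" "\<And>x. \<bar>f x\<bar> \<le> C * (1 + \<bar>x\<bar>) ^ k"
proof -
  obtain C k where *: "\<And>x. \<bar>f x\<bar> \<le> C * (1 + \<bar>x\<bar>) ^ k" using assms by (auto simp: poly_growth_def)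
  have "C \<ge> 0" using order_trans[OF abs_ge_zero *[of 0]] by simp
  show thesis by (rule that[of C k]) (use \<open>C \<ge> 0\<close> * in auto)
qed

lemma poly_growthI:
  "f \<in> borel_measurable borel \<Longrightarrow> (\<And>x. \<bar>f x\<bar> \<le> C * (1 + \<bar>x\<bar>) ^ k) \<Longrightarrow> poly_growth f"
  by (auto simp: poly_growth_def)

lemma poly_growth_const: "poly_growth (\<lambda>x. c)"
  by (rule poly_growthI[of _ "\<bar>c\<bar>" 0]) auto

lemma poly_growth_id: "poly_growth (\<lambda>x. x)"
  by (rule poly_growthI[of _ 1 1]) auto

lemma poly_growth_add:
  assumes "poly_growth f" "poly_growth g"
  shows "poly_growth (\<lambda>x. f x + g x)"
proof -
  obtain C k where C: "C \<ge> 0" "\<And>x. \<bar>f x\<bar> \<le> C * (1 + \<bar>x\<bar>) ^ k"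
    by (rule poly_growthE[OF assms(1)]) blast
  obtain C' k' where C': "C' \<ge> 0" "\<And>x. \<bar>g x\<bar> \<le> C' * (1 + \<bar>x\<bar>) ^ k'"
    by (rule poly_growthE[OF assms(2)]) blast
  have "\<bar>f x + g x\<bar> \<le> (C + C') * (1 + \<bar>x\<bar>) ^ (k + k')" for x
  proof -
    have "C * (1 + \<bar>x\<bar>) ^ k \<le> C * (1 + \<bar>x\<bar>) ^ (k + k')"
      "C' * (1 + \<bar>x\<bar>) ^ k' \<le> C' * (1 + \<bar>x\<bar>) ^ (k + k')"
      using C(1) C'(1) by (auto intro!: mult_left_mono power_increasing)
    then show ?thesis using C(2)[of x] C'(2)[of x] abs_triangle_ineq[of "f x" "g x"]
      unfolding distrib_right by linarith
  qed
  then show ?thesis using assms by (intro poly_growthI) auto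
qed

lemma poly_growth_mult:
  assumes "poly_growth f" "poly_growth g"
  shows "poly_growth (\<lambda>x. f x * g x)"
proof -
  obtain C k where C: "C \<ge> 0" "\<And>x. \<bar>f x\<bar> \<le> C * (1 + \<bar>x\<bar>) ^ k"
    by (rule poly_growthE[OF assms(1)]) blast
  obtain C' k' where C': "C' \<ge> 0" "\<And>x. \<bar>g x\<bar> \<le> C' * (1 + \<bar>x\<bar>) ^ k'"
    by (rule poly_growthE[OF assms(2)]) blast
  have "\<bar>f x * g x\<bar> \<le> (C * C') * (1 + \<bar>x\<bar>) ^ (k + k')" for x
    using mult_mono[OF C(2)[of x] C'(2)[of x]] C(1)
    by (simp add: abs_mult power_add mult_ac)
  then show ?thesis using assms by (intro poly_growthI) auto
qed

lemma poly_growth_poly: "poly_growth (poly p)"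
  by (induction p) (auto intro!: poly_growth_const poly_growth_id poly_growth_add poly_growth_mult)

lemma poly_growth_abs: "poly_growth f \<Longrightarrow> poly_growth (\<lambda>x. \<bar>f x\<bar>)"
  unfolding poly_growth_def by auto

text \<open>The bound is a product of a function of \<open>e\<close> and a function of
  \<open>e'\<close>, so one-dimensional moments suffice for integrability. It sees \<open>a\<close>
  and \<open>b\<close> only through \<open>R\<close>, which makes it a dominating function for all
  nearby parameters.\<close>

lemma growth_linear_comb:
  fixes C :: real
  assumes "\<And>x. \<bar>f x\<bar> \<le> C * (1 + \<bar>x\<bar>) ^ k" "C \<ge> 0" "\<bar>a\<bar> + \<bar>b\<bar> \<le> R"
  shows "\<bar>f (a * e + b * e')\<bar> \<le> C * (1 + R) ^ k * ((1 + \<bar>e\<bar>) ^ k * (1 + \<bar>e'\<bar>) ^ k)"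
proof -
  have "\<bar>a * e + b * e'\<bar> \<le> \<bar>a\<bar> * \<bar>e\<bar> + \<bar>b\<bar> * \<bar>e'\<bar>"
    by (metis abs_mult abs_triangle_ineq)
  also have "\<dots> \<le> (\<bar>a\<bar> + \<bar>b\<bar>) * (\<bar>e\<bar> + \<bar>e'\<bar>)"
    by (simp add: algebra_simps)
  also have "\<dots> \<le> R * (\<bar>e\<bar> + \<bar>e'\<bar>)"
    by (rule mult_right_mono) (use assms in auto)
  finally have "1 + \<bar>a * e + b * e'\<bar> \<le> 1 + R * (\<bar>e\<bar> + \<bar>e'\<bar>)" by simp
  also have "\<dots> \<le> (1 + R) * ((1 + \<bar>e\<bar>) * (1 + \<bar>e'\<bar>))"
    using assms(3) by (simp add: algebra_simps)
  finally have "(1 + \<bar>a * e + b * e'\<bar>) ^ k \<le> ((1 + R) * ((1 + \<bar>e\<bar>) * (1 + \<bar>e'\<bar>))) ^ k"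
    by (intro power_mono) auto
  then have "C * (1 + \<bar>a * e + b * e'\<bar>) ^ k \<le> C * ((1 + R) * ((1 + \<bar>e\<bar>) * (1 + \<bar>e'\<bar>))) ^ k"
    by (rule mult_left_mono) fact
  then show ?thesis using order_trans[OF assms(1)[of "a * e + b * e'"]]
    by (simp add: power_mult_distrib mult_ac)
qed

lemma poly_growth_affine:
  assumes "poly_growth f" shows "poly_growth (\<lambda>x. f (a + b * x))"
proof -
  obtain C k where C: "C \<ge> 0" "\<And>x. \<bar>f x\<bar> \<le> C * (1 + \<bar>x\<bar>) ^ k"
    by (rule poly_growthE[OF assms]) blast
  have [measurable]: "f \<in> borel_measurable borel" using assms by auto
  show ?thesis
  proof (rule poly_growthI)
    show "\<bar>f (a + b * x)\<bar> \<le> C * (1 + (\<bar>a\<bar> + \<bar>b\<bar>)) ^ k * 2 ^ k * (1 + \<bar>x\<bar>) ^ k" for x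
      using growth_linear_comb[OF C(2,1) order_refl, of a 1 b x] by simp
  qed measurable
qed

section \<open>Smooth functions with derivatives of polynomial growth\<close>

primrec times_diff_growth :: "nat \<Rightarrow> (real \<Rightarrow> real) \<Rightarrow> bool" where
  "times_diff_growth 0 f \<longleftrightarrow> poly_growth f"
| "times_diff_growth (Suc n) f \<longleftrightarrow> poly_growth f \<and>
     (\<exists>f'. (\<forall>x. (f has_real_derivative f' x) (at x)) \<and> times_diff_growth n f')"

definition smooth_growth :: "(real \<Rightarrow> real) \<Rightarrow> bool" where
  "smooth_growth f \<longleftrightarrow> (\<forall>n. times_diff_growth n f)"

lemma times_diff_growth_lower: "times_diff_growth (Suc n) f \<Longrightarrow> times_diff_growth n f"
  by (induction n arbitrary: f) (auto simp del: times_diff_growth.simps(1), auto)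

lemma times_diff_growth_add:
  "times_diff_growth n f \<Longrightarrow> times_diff_growth n g \<Longrightarrow> times_diff_growth n (\<lambda>x. f x + g x)"
proof (induction n arbitrary: f g)
  case (Suc n)
  then obtain f' g' where *: "\<And>x. (f has_real_derivative f' x) (at x)" "times_diff_growth n f'"
    "\<And>x. (g has_real_derivative g' x) (at x)" "times_diff_growth n g'" by auto
  then have "((\<lambda>x. f x + g x) has_real_derivative f' x + g' x) (at x)" for x
    by (auto intro!: derivative_eq_intros)
  with Suc * show ?case by (auto intro!: poly_growth_add exI[of _ "\<lambda>x. f' x + g' x"])
qed (simp add: poly_growth_add)

lemma times_diff_growth_mult:
  "times_diff_growth n f \<Longrightarrow> times_diff_growth n g \<Longrightarrow> times_diff_growth n (\<lambda>x. f x * g x)"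
proof (induction n arbitrary: f g)
  case (Suc n)
  then obtain f' g' where *: "\<And>x. (f has_real_derivative f' x) (at x)" "times_diff_growth n f'"
    "\<And>x. (g has_real_derivative g' x) (at x)" "times_diff_growth n g'" by auto
  have "((\<lambda>x. f x * g x) has_real_derivative f' x * g x + g' x * f x) (at x)" for x
    by (rule DERIV_mult) (use * in auto)
  moreover have "times_diff_growth n (\<lambda>x. f' x * g x + g' x * f x)"
    using * times_diff_growth_lower[OF Suc.prems(1)] times_diff_growth_lower[OF Suc.prems(2)]
    by (intro times_diff_growth_add Suc.IH)
  ultimately show ?case using Suc.prems
    by (auto intro!: poly_growth_mult exI[of _ "\<lambda>x. f' x * g x + g' x * f x"])
qed (simp add: poly_growth_mult)

lemma smooth_growth_mult:
  "smooth_growth f \<Longrightarrow> smooth_growth g \<Longrightarrow> smooth_growth (\<lambda>x. f x * g x)"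
  by (simp add: smooth_growth_def times_diff_growth_mult)

lemma smooth_growth_imp_poly_growth: "smooth_growth f \<Longrightarrow> poly_growth f"
  unfolding smooth_growth_def by (metis times_diff_growth.simps(1))

text \<open>Each order \<open>n\<close> comes with its own existentially quantified derivative;
  uniqueness of derivatives identifies all of them with \<open>deriv f\<close>.\<close>

lemma smooth_growth_deriv:
  assumes "smooth_growth f"
  shows "(f has_real_derivative deriv f x) (at x)" "smooth_growth (deriv f)"
proof -
  have D: "\<exists>f'. (\<forall>x. (f has_real_derivative f' x) (at x)) \<and> times_diff_growth n f'" for n
    using assms unfolding smooth_growth_def by (metis times_diff_growth.simps(2))
  have eq: "deriv f = f'" if "\<forall>x. (f has_real_derivative f' x) (at x)" for f'
    using that DERIV_imp_deriv by blast
  show "(f has_real_derivative deriv f x) (at x)" using D[of 0] eq by metis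
  show "smooth_growth (deriv f)" unfolding smooth_growth_def using D eq by metis
qed


subsection \<open>Gaussian integrals\<close>

lemma space_std_gaussian [simp]: "space std_gaussian = UNIV"
  by (simp add: std_gaussian_def)

interpretation std_gaussian: prob_space std_gaussian
  by (rule prob_space_std_gaussian)

interpretation std_gaussian2: pair_prob_space std_gaussian std_gaussian ..

abbreviation std_gaussian2 :: "(real \<times> real) measure" where
  "std_gaussian2 \<equiv> std_gaussian \<Otimes>\<^sub>M std_gaussian"

text \<open>Completing the square turns \<open>std_normal_density x * exp (d * x)\<close> into a
  multiple of the normal density with mean \<open>d\<close>. Exponential weights occur because the
  Cameron-Martin factor has to be dominated for all small shifts at once.\<close>

lemma integrable_exp_abs_gaussian: "integrable std_gaussian (\<lambda>x. exp (c * \<bar>x\<bar>))"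
proof -
  have sh: "integrable lborel (\<lambda>x. std_normal_density x * exp (d * x))" for d
  proof -
    have "integrable lborel (\<lambda>x. exp (d\<^sup>2 / 2) * normal_density d 1 x)"
      by (intro integrable_mult_right integrable_normal_density) simp
    also have "(\<lambda>x. exp (d\<^sup>2 / 2) * normal_density d 1 x) = (\<lambda>x. std_normal_density x * exp (d * x))"
      by (rule ext) (simp add: normal_density_def field_simps power2_eq_square flip: exp_add)
    finally show ?thesis .
  qed
  have "integrable std_gaussian (\<lambda>x. exp (d * x))" for d
    using sh[of d] by (simp add: std_gaussian_def integrable_density)
  then have "integrable std_gaussian (\<lambda>x. exp (c * x) + exp (- c * x))"
    by (intro Bochner_Integration.integrable_add)
  then show ?thesis
  proof (rule Bochner_Integration.integrable_bound)
    have "exp (c * \<bar>x\<bar>) \<le> exp (c * x) + exp (- c * x)" for x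
      by (simp add: abs_if)
    then show "AE x in std_gaussian. norm (exp (c * \<bar>x\<bar>)) \<le> norm (exp (c * x) + exp (- c * x))"
      by (intro always_eventually allI) (auto intro: order_trans[OF _ abs_ge_self])
  qed measurable
qed

text \<open>A single term of the exponential series is at most the sum.\<close>

lemma power_le_fact_exp:
  fixes x :: real assumes "x \<ge> 0" shows "x ^ k \<le> fact k * exp x"
proof -
  have "x ^ k / fact k \<le> exp x"
    using assms sum_le_suminf[of "\<lambda>n. x ^ n /\<^sub>R fact n" "{k}"] summable_exp_generic[of x]
    by (simp add: exp_def field_simps)
  then show ?thesis by (simp add: field_simps)
qed

lemma integrable_poly_exp_gaussian:
  "integrable std_gaussian (\<lambda>x. (1 + \<bar>x\<bar>) ^ k * exp (c * \<bar>x\<bar>))"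
proof (rule Bochner_Integration.integrable_bound)
  show "integrable std_gaussian (\<lambda>x. (fact k * exp 1) * exp ((1 + c) * \<bar>x\<bar>))"
    by (intro integrable_mult_right integrable_exp_abs_gaussian)
  have "(1 + \<bar>x\<bar>) ^ k * exp (c * \<bar>x\<bar>) \<le> (fact k * exp 1) * exp ((1 + c) * \<bar>x\<bar>)" for x
  proof -
    have "(1 + \<bar>x\<bar>) ^ k * exp (c * \<bar>x\<bar>) \<le> (fact k * exp (1 + \<bar>x\<bar>)) * exp (c * \<bar>x\<bar>)"
      by (intro mult_right_mono power_le_fact_exp) auto
    also have "\<dots> = (fact k * exp 1) * exp ((1 + c) * \<bar>x\<bar>)"
      by (simp add: algebra_simps flip: exp_add)
    finally show ?thesis .
  qed
  then show "AE x in std_gaussian. norm ((1 + \<bar>x\<bar>) ^ k * exp (c * \<bar>x\<bar>)) \<le>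
      norm ((fact k * exp 1) * exp ((1 + c) * \<bar>x\<bar>))"
    by (intro always_eventually allI) (simp add: abs_mult)
qed measurable

lemma integrable_poly_growth_exp:
  assumes "poly_growth f" shows "integrable std_gaussian (\<lambda>x. f x * exp (c * \<bar>x\<bar>))"
proof -
  obtain C k where C: "C \<ge> 0" "\<And>x. \<bar>f x\<bar> \<le> C * (1 + \<bar>x\<bar>) ^ k"
    by (rule poly_growthE[OF assms]) blast
  have [measurable]: "f \<in> borel_measurable borel" using assms by auto
  show ?thesis
  proof (rule Bochner_Integration.integrable_bound)
    show "integrable std_gaussian (\<lambda>x. C * ((1 + \<bar>x\<bar>) ^ k * exp (c * \<bar>x\<bar>)))"
      by (intro integrable_mult_right integrable_poly_exp_gaussian)
    show "AE x in std_gaussian. norm (f x * exp (c * \<bar>x\<bar>)) \<le> norm (C * ((1 + \<bar>x\<bar>) ^ k * exp (c * \<bar>x\<bar>)))"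
      using C by (auto simp: abs_mult mult.assoc[symmetric] intro!: mult_right_mono)
  qed measurable
qed

lemma integrable_poly_growth:
  assumes "poly_growth f" shows "integrable std_gaussian f"
  using integrable_poly_growth_exp[OF assms, of 0] by simp

lemma integrable_gaussian2_mult:
  fixes f g :: "real \<Rightarrow> real"
  assumes f: "integrable std_gaussian f" and g: "integrable std_gaussian g"
  shows "integrable std_gaussian2 (\<lambda>z. f (fst z) * g (snd z))"
proof (rule std_gaussian2.Fubini_integrable)
  note [measurable] = borel_measurable_integrable[OF f] borel_measurable_integrable[OF g]
  show "(\<lambda>z. f (fst z) * g (snd z)) \<in> borel_measurable std_gaussian2" by measurable
  show "integrable std_gaussian (\<lambda>x. \<integral>y. norm (f (fst (x, y)) * g (snd (x, y))) \<partial>std_gaussian)"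
    using f by (simp add: abs_mult)
  show "AE x in std_gaussian. integrable std_gaussian (\<lambda>y. f (fst (x, y)) * g (snd (x, y)))"
    using g by simp
qed

lemma integrable_gaussian2_linear_comb:
  assumes "poly_growth f" "poly_growth g"
  shows "integrable std_gaussian2 (\<lambda>z. f (a * fst z + b * snd z) * g (c * fst z + d * snd z))"
proof -
  obtain C k where C: "C \<ge> 0" "\<And>x. \<bar>f x\<bar> \<le> C * (1 + \<bar>x\<bar>) ^ k"
    by (rule poly_growthE[OF assms(1)]) blast
  obtain C' l where C': "C' \<ge> 0" "\<And>x. \<bar>g x\<bar> \<le> C' * (1 + \<bar>x\<bar>) ^ l"
    by (rule poly_growthE[OF assms(2)]) blast
  have [measurable]: "f \<in> borel_measurable borel" "g \<in> borel_measurable borel" using assms by auto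
  define R where "R = \<bar>a\<bar> + \<bar>b\<bar> + \<bar>c\<bar> + \<bar>d\<bar>"
  let ?K = "C * (1 + R) ^ k * (C' * (1 + R) ^ l)"
  show ?thesis
  proof (rule Bochner_Integration.integrable_bound)
    show "integrable std_gaussian2 (\<lambda>z. ?K * ((1 + \<bar>fst z\<bar>) ^ (k + l) * (1 + \<bar>snd z\<bar>) ^ (k + l)))"
      using integrable_poly_exp_gaussian[of "k + l" 0]
      by (intro integrable_mult_right integrable_gaussian2_mult) auto
    have "\<bar>f (a * e + b * e') * g (c * e + d * e')\<bar> \<le>
        ?K * ((1 + \<bar>e\<bar>) ^ (k + l) * (1 + \<bar>e'\<bar>) ^ (k + l))" for e e'
    proof -
      have "\<bar>f (a * e + b * e')\<bar> * \<bar>g (c * e + d * e')\<bar> \<le>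
          (C * (1 + R) ^ k * ((1 + \<bar>e\<bar>) ^ k * (1 + \<bar>e'\<bar>) ^ k)) *
          (C' * (1 + R) ^ l * ((1 + \<bar>e\<bar>) ^ l * (1 + \<bar>e'\<bar>) ^ l))"
        by (intro mult_mono growth_linear_comb C C')
           (auto simp: R_def intro!: mult_nonneg_nonneg C)
      then show ?thesis by (simp add: abs_mult power_add mult_ac)
    qed
    then show "AE z in std_gaussian2. norm (f (a * fst z + b * snd z) * g (c * fst z + d * snd z)) \<le>
       norm (?K * ((1 + \<bar>fst z\<bar>) ^ (k + l) * (1 + \<bar>snd z\<bar>) ^ (k + l)))"
      by (intro always_eventually allI) (auto intro: order_trans[OF _ abs_ge_self])
  qed measurable
qed

lemma integral_gaussian2_fst:
  fixes f :: "real \<times> real \<Rightarrow> real"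
  assumes "integrable std_gaussian2 f"
  shows "(\<integral>z. f z \<partial>std_gaussian2) = (\<integral>e. \<integral>e'. f (e, e') \<partial>std_gaussian \<partial>std_gaussian)"
  using std_gaussian2.integral_fst'[OF assms] by simp

section \<open>Cameron-Martin shifts, Gaussian smoothing and Stein's identity\<close>

lemma cameron_martin_std_gaussian:
  fixes g :: "real \<Rightarrow> real"
  assumes [measurable]: "g \<in> borel_measurable borel"
  shows "(\<integral>e. g (e + \<delta>) \<partial>std_gaussian) = (\<integral>e. g e * exp (\<delta> * e - \<delta>\<^sup>2 / 2) \<partial>std_gaussian)"
proof -
  \<comment> \<open>The exponential is the quotient of the normal densities with means
    \<open>\<delta>\<close> and 0, here evaluated at the shifted point.\<close>
  have *: "std_normal_density (\<delta> + e) * exp (\<delta> * (\<delta> + e) - \<delta>\<^sup>2 / 2) = std_normal_density e" for e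
    by (simp add: std_normal_density_def field_simps power2_eq_square flip: exp_add)
  have "(\<integral>e. g e * exp (\<delta> * e - \<delta>\<^sup>2 / 2) \<partial>std_gaussian) =
      (\<integral>e. std_normal_density e * (g e * exp (\<delta> * e - \<delta>\<^sup>2 / 2)) \<partial>lborel)"
    by (simp add: std_gaussian_def integral_density)
  also have "\<dots> = (\<integral>e. std_normal_density (\<delta> + e) *
      (g (\<delta> + e) * exp (\<delta> * (\<delta> + e) - \<delta>\<^sup>2 / 2)) \<partial>lborel)"
    by (subst lborel_integral_real_affine[of 1 _ \<delta>]) simp_all
  also have "\<dots> = (\<integral>e. std_normal_density e * g (e + \<delta>) \<partial>lborel)"
    by (intro Bochner_Integration.integral_cong refl) (subst *[symmetric], simp add: ac_simps)
  also have "\<dots> = (\<integral>e. g (e + \<delta>) \<partial>std_gaussian)"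
    by (simp add: std_gaussian_def integral_density)
  finally show ?thesis by simp
qed

lemma poly_growth_power: "poly_growth (\<lambda>x. (1 + \<bar>x\<bar>) ^ k)"
  by (rule poly_growthI[of _ 1 k]) auto

text \<open>The polynomial weight makes the family closed under differentiation: derivatives of a
  Gaussian kernel are Hermite polynomials times the kernel.\<close>

definition gauss_conv :: "(real \<Rightarrow> real) \<Rightarrow> real \<Rightarrow> real poly \<Rightarrow> real \<Rightarrow> real" where
  "gauss_conv \<psi> \<sigma> p x = (\<integral>e. \<psi> (x + \<sigma> * e) * poly p e \<partial>std_gaussian)"

text \<open>By the Cameron--Martin formula the shift of the argument acts on the smooth Gaussian weight
  instead of on \<open>\<psi>\<close>, which need not be continuous.\<close>

lemma DERIV_gauss_conv:
  assumes \<psi>: "poly_growth \<psi>" and "\<sigma> \<noteq> 0"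
  shows "(gauss_conv \<psi> \<sigma> p has_real_derivative
    gauss_conv \<psi> \<sigma> (smult (1 / \<sigma>) (pCons 0 p - pderiv p)) x0) (at x0)"
proof -
  \<comment> \<open>The integrand of \<open>gauss_conv\<close> at
    \<open>x0 + \<sigma> * \<delta>\<close> after the substitution \<open>w = e + \<delta>\<close>,
    which removes \<open>\<delta>\<close> from the argument of \<open>\<psi>\<close>.\<close>
  define f where "f r w \<delta> = \<psi> (x0 + \<sigma> * w) * (poly r (w - \<delta>) * exp (\<delta> * w - \<delta>\<^sup>2 / 2))"
    for r :: "real poly" and w \<delta> :: real
  \<comment> \<open>The derivative in \<open>\<delta>\<close> of the weight: the exponential
    contributes the factor \<open>w - \<delta>\<close>, which is multiplication by the variable
    (\<open>pCons 0\<close>), and \<open>poly p (w - \<delta>)\<close> contributes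
    \<open>- pderiv p\<close>.\<close>
  define q where "q = pCons 0 p - pderiv p"
  have [measurable]: "\<psi> \<in> borel_measurable borel" using \<psi> by auto
  have [measurable]: "poly r \<in> borel_measurable borel" for r :: "real poly"
    using poly_growth_poly by auto
  have f_meas [measurable]: "(\<lambda>w. f r w \<delta>) \<in> borel_measurable borel" for r \<delta>
    unfolding f_def by measurable
  have "\<exists>W. integrable std_gaussian W \<and> (\<forall>w. \<forall>\<delta>\<in>{-1..1}. \<bar>f r w \<delta>\<bar> \<le> W w)" for r
  proof -
    obtain C k where C: "C \<ge> 0" "\<And>x. \<bar>poly r x\<bar> \<le> C * (1 + \<bar>x\<bar>) ^ k"
      by (rule poly_growthE[OF poly_growth_poly[of r]]) blast
    let ?W = "\<lambda>w. \<bar>\<psi> (x0 + \<sigma> * w)\<bar> * (C * 2 ^ k * (1 + \<bar>w\<bar>) ^ k) * exp (1 * \<bar>w\<bar>)"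
    have "integrable std_gaussian ?W"
      by (intro integrable_poly_growth_exp poly_growth_mult poly_growth_const poly_growth_power
          poly_growth_abs poly_growth_affine \<psi>)
    moreover have "\<bar>f r w \<delta>\<bar> \<le> ?W w" if "\<delta> \<in> {-1..1}" for w \<delta>
    proof -
      have "\<bar>poly r (w - \<delta>)\<bar> \<le> C * (1 + \<bar>w - \<delta>\<bar>) ^ k" by (rule C)
      also have "\<dots> \<le> C * (2 * (1 + \<bar>w\<bar>)) ^ k"
        using that C(1) by (intro mult_left_mono power_mono) auto
      finally have 1: "\<bar>poly r (w - \<delta>)\<bar> \<le> C * 2 ^ k * (1 + \<bar>w\<bar>) ^ k"
        unfolding power_mult_distrib by (simp only: mult_ac)
      have "\<delta> * w \<le> \<bar>\<delta>\<bar> * \<bar>w\<bar>" by (simp only: abs_ge_self flip: abs_mult)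
      also have "\<dots> \<le> 1 * \<bar>w\<bar>" using that by (intro mult_right_mono) auto
      finally have 2: "exp (\<delta> * w - \<delta>\<^sup>2 / 2) \<le> exp (1 * \<bar>w\<bar>)"
        unfolding exp_le_cancel_iff using zero_le_power2[of \<delta>] by linarith
      have "\<bar>poly r (w - \<delta>)\<bar> * exp (\<delta> * w - \<delta>\<^sup>2 / 2) \<le> (C * 2 ^ k * (1 + \<bar>w\<bar>) ^ k) * exp (1 * \<bar>w\<bar>)"
        using C(1) by (intro mult_mono 1 2) auto
      then show ?thesis unfolding f_def
        by (simp add: abs_mult mult.assoc mult_left_mono)
    qed
    ultimately show ?thesis by blast
  qed
  then obtain W where W: "\<And>r. integrable std_gaussian (W r)"
      "\<And>r w \<delta>. \<delta> \<in> {-1..1} \<Longrightarrow> \<bar>f r w \<delta>\<bar> \<le> W r w"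
    by metis
  have int: "integrable std_gaussian (\<lambda>w. f r w \<delta>)" if "\<delta> \<in> {-1..1}" for r \<delta>
    by (rule Bochner_Integration.integrable_bound[OF W(1)[of r]])
       (use order_trans[OF W(2)[OF that] abs_ge_self] in auto)
  have "((\<lambda>\<delta>. \<integral>w. f p w \<delta> \<partial>std_gaussian) has_derivative (\<lambda>v. \<integral>w. f q w 0 * v \<partial>std_gaussian))
      (at 0 within {-1..1})"
  proof (rule has_derivative_integral[where f' = "\<lambda>w \<delta> v. f q w \<delta> * v" and w = "W q"])
    fix w \<delta> :: real
    have "((\<lambda>\<delta>. f p w \<delta>) has_real_derivative f q w \<delta>) (at \<delta> within {-1..1})"
      unfolding f_def q_def
      by (auto intro!: derivative_eq_intros simp: algebra_simps)
    then show "(f p w has_derivative (\<lambda>v. f q w \<delta> * v)) (at \<delta> within {-1..1})"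
      by (simp only: has_field_derivative_def)
  next
    show "\<bar>f q w \<delta> * v\<bar> \<le> W q w * norm v" if "\<delta> \<in> {-1..1}" for w \<delta> v
      using W(2)[OF that] by (simp add: abs_mult mult_right_mono)
  qed (auto intro: int W)
  moreover have "at 0 within {-1..1} = at (0::real)"
    by (rule at_within_interior) (simp add: interior_atLeastAtMost_real)
  moreover have "(\<integral>w. f q w 0 * v \<partial>std_gaussian) = (\<integral>w. f q w 0 \<partial>std_gaussian) * v" for v
    by simp
  ultimately have "((\<lambda>\<delta>. \<integral>w. f p w \<delta> \<partial>std_gaussian) has_real_derivative
      (\<integral>w. f q w 0 \<partial>std_gaussian)) (at 0)"
    by (simp add: has_field_derivative_def mult_commute_abs)
  moreover have "(\<integral>w. f p w \<delta> \<partial>std_gaussian) = gauss_conv \<psi> \<sigma> p (x0 + \<sigma> * \<delta>)" for \<delta>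
    using cameron_martin_std_gaussian[of "\<lambda>w. \<psi> (x0 + \<sigma> * w) * poly p (w - \<delta>)" \<delta>]
    by (simp add: f_def gauss_conv_def algebra_simps)
  \<comment> \<open>The point 0 is written as \<open>(x0 - x0) / \<sigma>\<close>, the value at
    \<open>x0\<close> of the inner function in the chain rule that follows.\<close>
  ultimately have "((\<lambda>\<delta>. gauss_conv \<psi> \<sigma> p (x0 + \<sigma> * \<delta>)) has_real_derivative
      (\<integral>w. f q w 0 \<partial>std_gaussian)) (at ((x0 - x0) / \<sigma>))"
    by simp
  then have "((\<lambda>x. gauss_conv \<psi> \<sigma> p (x0 + \<sigma> * ((x - x0) / \<sigma>))) has_real_derivative
      (\<integral>w. f q w 0 \<partial>std_gaussian) * (1 / \<sigma>)) (at x0)"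
    by (rule DERIV_chain2) (use assms(2) in \<open>auto intro!: derivative_eq_intros\<close>)
  moreover have "(\<integral>w. f q w 0 \<partial>std_gaussian) * (1 / \<sigma>) = gauss_conv \<psi> \<sigma> (smult (1 / \<sigma>) q) x0"
    by (simp add: gauss_conv_def f_def)
  ultimately show ?thesis using assms(2) by (simp add: q_def)
qed

text \<open>The inequality \<open>1 + \<bar>x + \<sigma> * e\<bar> \<le> (1 + \<bar>\<sigma>\<bar>)
  * (1 + \<bar>e\<bar>) * (1 + \<bar>x\<bar>)\<close> separates \<open>x\<close> from the
  integration variable. Continuity supplies the measurability of the integral.\<close>

lemma poly_growth_integral:
  assumes "poly_growth \<psi>" "poly_growth \<theta>"
    and cont: "continuous_on UNIV (\<lambda>x. \<integral>e. \<psi> (x + \<sigma> * e) * \<theta> e \<partial>std_gaussian)"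
  shows "poly_growth (\<lambda>x. \<integral>e. \<psi> (x + \<sigma> * e) * \<theta> e \<partial>std_gaussian)"
proof -
  obtain C k where C: "C \<ge> 0" "\<And>x. \<bar>\<psi> x\<bar> \<le> C * (1 + \<bar>x\<bar>) ^ k"
    by (rule poly_growthE[OF assms(1)]) blast
  have [measurable]: "\<psi> \<in> borel_measurable borel" "\<theta> \<in> borel_measurable borel" using assms by auto
  have i: "integrable std_gaussian (\<lambda>e. \<psi> (x + \<sigma> * e) * \<theta> e)" for x
    by (intro integrable_poly_growth poly_growth_mult poly_growth_affine assms)
  let ?V = "\<lambda>e. C * (1 + \<bar>\<sigma>\<bar>) ^ k * (1 + \<bar>e\<bar>) ^ k * \<bar>\<theta> e\<bar>"
  have V: "integrable std_gaussian ?V"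
    by (intro integrable_poly_growth poly_growth_mult poly_growth_const poly_growth_power
        poly_growth_abs assms)
  show ?thesis
  proof (rule poly_growthI)
    show "(\<lambda>x. \<integral>e. \<psi> (x + \<sigma> * e) * \<theta> e \<partial>std_gaussian) \<in> borel_measurable borel"
      by (rule borel_measurable_continuous_onI[OF cont])
    fix x
    have pt: "\<bar>\<psi> (x + \<sigma> * e) * \<theta> e\<bar> \<le> ?V e * (1 + \<bar>x\<bar>) ^ k" for e
    proof -
      have "1 + \<bar>x + \<sigma> * e\<bar> \<le> 1 + \<bar>x\<bar> + \<bar>\<sigma>\<bar> * \<bar>e\<bar>"
        using abs_triangle_ineq[of x "\<sigma> * e"] by (simp add: abs_mult)
      also have "\<dots> \<le> (1 + \<bar>\<sigma>\<bar>) * (1 + \<bar>e\<bar>) * (1 + \<bar>x\<bar>)" by (simp add: algebra_simps)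
      finally have "(1 + \<bar>x + \<sigma> * e\<bar>) ^ k \<le> ((1 + \<bar>\<sigma>\<bar>) * (1 + \<bar>e\<bar>) * (1 + \<bar>x\<bar>)) ^ k"
        by (intro power_mono) auto
      then have "\<bar>\<psi> (x + \<sigma> * e)\<bar> \<le> C * ((1 + \<bar>\<sigma>\<bar>) * (1 + \<bar>e\<bar>) * (1 + \<bar>x\<bar>)) ^ k"
        using C(1) by (intro order_trans[OF C(2)] mult_left_mono) auto
      then have "\<bar>\<psi> (x + \<sigma> * e)\<bar> * \<bar>\<theta> e\<bar> \<le> C * ((1 + \<bar>\<sigma>\<bar>) * (1 + \<bar>e\<bar>) * (1 + \<bar>x\<bar>)) ^ k * \<bar>\<theta> e\<bar>"
        by (rule mult_right_mono) simp
      then show ?thesis by (simp add: abs_mult power_mult_distrib mult_ac)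
    qed
    have "\<bar>\<integral>e. \<psi> (x + \<sigma> * e) * \<theta> e \<partial>std_gaussian\<bar> \<le> (\<integral>e. \<bar>\<psi> (x + \<sigma> * e) * \<theta> e\<bar> \<partial>std_gaussian)"
      by simp
    also have "\<dots> \<le> (\<integral>e. ?V e * (1 + \<bar>x\<bar>) ^ k \<partial>std_gaussian)"
      by (intro integral_mono integrable_abs i integrable_mult_left V pt)
    also have "\<dots> = (\<integral>e. ?V e \<partial>std_gaussian) * (1 + \<bar>x\<bar>) ^ k" by simp
    finally show "\<bar>\<integral>e. \<psi> (x + \<sigma> * e) * \<theta> e \<partial>std_gaussian\<bar> \<le>
      (\<integral>e. ?V e \<partial>std_gaussian) * (1 + \<bar>x\<bar>) ^ k" .
  qed
qed

text \<open>Induction on the order with the polynomial arbitrary, as each derivative is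
  \<open>gauss_conv\<close> with another polynomial.\<close>

lemma smooth_growth_gauss_conv:
  assumes "poly_growth \<psi>" "\<sigma> \<noteq> 0"
  shows "smooth_growth (gauss_conv \<psi> \<sigma> p)"
proof -
  have pg: "poly_growth (gauss_conv \<psi> \<sigma> p)" for p
    unfolding gauss_conv_def
  proof (rule poly_growth_integral[OF assms(1) poly_growth_poly])
    show "continuous_on UNIV (\<lambda>x. \<integral>e. \<psi> (x + \<sigma> * e) * poly p e \<partial>std_gaussian)"
      using DERIV_gauss_conv[OF assms, of p] unfolding gauss_conv_def
      by (auto intro!: DERIV_isCont continuous_at_imp_continuous_on)
  qed
  have "times_diff_growth n (gauss_conv \<psi> \<sigma> p)" for n
  proof (induction n arbitrary: p)
    case (Suc n)
    show ?case using DERIV_gauss_conv[OF assms, of p] pg Suc by auto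
  qed (simp add: pg)
  then show ?thesis by (simp add: smooth_growth_def)
qed

lemma DERIV_gauss_integral:
  assumes D: "\<And>x. (\<psi> has_real_derivative \<psi>' x) (at x)"
    and pg: "poly_growth \<psi>" "poly_growth \<psi>'"
  shows "((\<lambda>x. \<integral>e. \<psi> (x + \<sigma> * e) \<partial>std_gaussian) has_real_derivative
    (\<integral>e. \<psi>' (\<mu> + \<sigma> * e) \<partial>std_gaussian)) (at \<mu>)"
proof -
  have [measurable]: "\<psi>' \<in> borel_measurable borel" using pg by auto
  obtain C k where C: "C \<ge> 0" "\<And>x. \<bar>\<psi>' x\<bar> \<le> C * (1 + \<bar>x\<bar>) ^ k"
    by (rule poly_growthE[OF pg(2)]) blast
  define X where "X = {\<mu> - 1..\<mu> + 1}"
  let ?W = "\<lambda>e. C * (1 + (\<bar>\<mu>\<bar> + 1 + \<bar>\<sigma>\<bar>)) ^ k * ((1 + \<bar>1\<bar>) ^ k * (1 + \<bar>e\<bar>) ^ k)"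
  have "((\<lambda>x. \<integral>e. \<psi> (x + \<sigma> * e) \<partial>std_gaussian) has_derivative
      (\<lambda>v. \<integral>e. \<psi>' (\<mu> + \<sigma> * e) * v \<partial>std_gaussian)) (at \<mu> within X)"
  proof (rule has_derivative_integral[where f' = "\<lambda>e x v. \<psi>' (x + \<sigma> * e) * v" and w = ?W])
    show "convex X" "\<mu> \<in> X" by (auto simp: X_def)
    show "integrable std_gaussian (\<lambda>e. \<psi> (x + \<sigma> * e))" for x
      by (intro integrable_poly_growth poly_growth_affine pg)
    show "((\<lambda>x. \<psi> (x + \<sigma> * e)) has_derivative (\<lambda>v. \<psi>' (x + \<sigma> * e) * v)) (at x within X)" for e x
    proof -
      have "((\<lambda>x. \<psi> (x + \<sigma> * e)) has_real_derivative \<psi>' (x + \<sigma> * e)) (at x)"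
        using D[of "x + \<sigma> * e"] by (simp add: DERIV_shift)
      then show ?thesis unfolding has_field_derivative_def by (rule has_derivative_at_withinI)
    qed
    show "\<bar>\<psi>' (x + \<sigma> * e) * v\<bar> \<le> ?W e * norm v" if "x \<in> X" for e x v
    proof -
      have "\<bar>\<psi>' (x * 1 + \<sigma> * e)\<bar> \<le> ?W e"
        by (rule growth_linear_comb[OF C(2,1)]) (use that in \<open>auto simp: X_def\<close>)
      then show ?thesis by (simp add: abs_mult mult_right_mono)
    qed
    show "integrable std_gaussian ?W"
      by (intro integrable_poly_growth poly_growth_mult poly_growth_const poly_growth_power)
  qed auto
  moreover have "at \<mu> within X = at \<mu>"
    by (rule at_within_interior) (simp add: X_def interior_atLeastAtMost_real)
  ultimately show ?thesis by (simp add: has_field_derivative_def mult_commute_abs)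
qed

text \<open>Stein's identity: both sides are the derivative of the Gaussian smoothing of \<open>\<psi>\<close>.\<close>

lemma stein_identity:
  assumes "\<And>x. (\<psi> has_real_derivative \<psi>' x) (at x)" "poly_growth \<psi>" "poly_growth \<psi>'"
  shows "(\<integral>e. e * \<psi> (\<mu> + \<sigma> * e) \<partial>std_gaussian) = \<sigma> * (\<integral>e. \<psi>' (\<mu> + \<sigma> * e) \<partial>std_gaussian)"
proof (cases "\<sigma> = 0")
  case True
  then show ?thesis by (simp add: std_gaussian_moments)
next
  case False
  have "(gauss_conv \<psi> \<sigma> 1 has_real_derivative (\<integral>e. \<psi>' (\<mu> + \<sigma> * e) \<partial>std_gaussian)) (at \<mu>)"
    using DERIV_gauss_integral[OF assms, of \<sigma> \<mu>] by (simp add: gauss_conv_def[abs_def])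
  from DERIV_unique[OF this DERIV_gauss_conv[OF assms(2) False]]
  have "(\<integral>e. \<psi>' (\<mu> + \<sigma> * e) \<partial>std_gaussian) = (\<integral>e. \<psi> (\<mu> + \<sigma> * e) * (e / \<sigma>) \<partial>std_gaussian)"
    by (simp add: gauss_conv_def pderiv_1)
  also have "\<dots> = (\<integral>e. e * \<psi> (\<mu> + \<sigma> * e) \<partial>std_gaussian) / \<sigma>"
    by (simp add: mult.commute)
  finally show ?thesis using False by simp
qed

subsection \<open>Integrals against a pair of Gaussians\<close>

text \<open>This is Phi(m, t) with \<open>\<sigma>\<close> the square root of t. The two functions
  are independent arguments because differentiation changes them in different ways.\<close>

definition gauss2 :: "(real \<Rightarrow> real) \<Rightarrow> (real \<Rightarrow> real) \<Rightarrow> real \<Rightarrow> real \<Rightarrow> real" where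
  "gauss2 \<theta> \<psi> m \<sigma> = (\<integral>z. \<theta> (fst z) * \<psi> (m * fst z + \<sigma> * snd z) \<partial>std_gaussian2)"

lemma gauss2_iterated:
  assumes "poly_growth \<theta>" "poly_growth \<psi>"
  shows "gauss2 \<theta> \<psi> m \<sigma> = (\<integral>e. \<theta> e * (\<integral>e'. \<psi> (m * e + \<sigma> * e') \<partial>std_gaussian) \<partial>std_gaussian)"
proof -
  have "integrable std_gaussian2 (\<lambda>z. \<theta> (fst z) * \<psi> (m * fst z + \<sigma> * snd z))"
    using integrable_gaussian2_linear_comb[OF assms, of 1 0 m \<sigma>] by simp
  then show ?thesis unfolding gauss2_def by (subst integral_gaussian2_fst) simp_all
qed

lemma has_derivative_gauss2_aux:
  assumes D: "\<And>x. (\<psi> has_real_derivative \<psi>' x) (at x)"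
    and pg: "poly_growth \<theta>" "poly_growth \<psi>" "poly_growth \<psi>'"
  shows "((\<lambda>p. gauss2 \<theta> \<psi> (fst p) (snd p)) has_derivative
    (\<lambda>v. fst v * gauss2 (\<lambda>e. e * \<theta> e) \<psi>' m \<sigma> +
         snd v * (\<integral>z. \<theta> (fst z) * (snd z * \<psi>' (m * fst z + \<sigma> * snd z)) \<partial>std_gaussian2))) (at (m, \<sigma>))"
    and "integrable std_gaussian2 (\<lambda>z. \<theta> (fst z) * (snd z * \<psi>' (m * fst z + \<sigma> * snd z)))"
proof -
  have [measurable]: "\<theta> \<in> borel_measurable borel" "\<psi>' \<in> borel_measurable borel"
    using pg by auto
  obtain C k where C: "C \<ge> 0" "\<And>x. \<bar>\<psi>' x\<bar> \<le> C * (1 + \<bar>x\<bar>) ^ k"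
    by (rule poly_growthE[OF pg(3)]) blast
  define X where "X = ball (m, \<sigma>) (1::real)"
  \<comment> \<open>On the unit ball around \<open>(m, \<sigma>)\<close> each coordinate moves by
    less than 1, hence the 2. The exponent \<open>Suc k\<close> below leaves room for the factor
    \<open>\<bar>e\<bar> + \<bar>e'\<bar>\<close> that comes from differentiating the argument of
    \<open>\<psi>\<close>.\<close>
  define R where "R = \<bar>m\<bar> + \<bar>\<sigma>\<bar> + 2"
  define F where "F e = \<bar>\<theta> e\<bar> * (C * (1 + R) ^ k * (1 + \<bar>e\<bar>) ^ Suc k)" for e
  define H where "H e = (1 + \<bar>e\<bar>) ^ Suc k" for e :: real
  define W where "W z = F (fst z) * H (snd z)" for z
  have W: "integrable std_gaussian2 W"
    unfolding W_def F_def H_def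
    by (intro integrable_gaussian2_mult integrable_poly_growth poly_growth_mult poly_growth_const
        poly_growth_power poly_growth_abs pg)
  have key: "\<bar>\<theta> e\<bar> * (\<bar>\<psi>' (fst p * e + snd p * e')\<bar> * (\<bar>e\<bar> + \<bar>e'\<bar>)) \<le> W (e, e')"
    if "p \<in> X" for p e e'
  proof -
    have "\<bar>fst p - m\<bar> < 1" "\<bar>snd p - \<sigma>\<bar> < 1"
      using that dist_fst_le[of p "(m, \<sigma>)"] dist_snd_le[of p "(m, \<sigma>)"]
      by (auto simp: X_def dist_commute dist_real_def)
    then have "\<bar>\<psi>' (fst p * e + snd p * e')\<bar> \<le> C * (1 + R) ^ k * ((1 + \<bar>e\<bar>) ^ k * (1 + \<bar>e'\<bar>) ^ k)"
      by (intro growth_linear_comb C) (simp add: R_def)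
    moreover have "a + b \<le> (1 + a) * (1 + b)" if "a \<ge> 0" "b \<ge> 0" for a b :: real
      using mult_nonneg_nonneg[OF that] by (simp add: algebra_simps)
    then have "\<bar>e\<bar> + \<bar>e'\<bar> \<le> (1 + \<bar>e\<bar>) * (1 + \<bar>e'\<bar>)"
      by simp
    ultimately have "\<bar>\<psi>' (fst p * e + snd p * e')\<bar> * (\<bar>e\<bar> + \<bar>e'\<bar>) \<le>
        (C * (1 + R) ^ k * ((1 + \<bar>e\<bar>) ^ k * (1 + \<bar>e'\<bar>) ^ k)) * ((1 + \<bar>e\<bar>) * (1 + \<bar>e'\<bar>))"
      using C(1) by (intro mult_mono) (auto simp: R_def)
    then have "\<bar>\<theta> e\<bar> * (\<bar>\<psi>' (fst p * e + snd p * e')\<bar> * (\<bar>e\<bar> + \<bar>e'\<bar>)) \<le> \<bar>\<theta> e\<bar> *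
        ((C * (1 + R) ^ k * ((1 + \<bar>e\<bar>) ^ k * (1 + \<bar>e'\<bar>) ^ k)) * ((1 + \<bar>e\<bar>) * (1 + \<bar>e'\<bar>)))"
      by (rule mult_left_mono) simp
    also have "\<dots> = W (e, e')" by (simp add: W_def F_def H_def mult_ac)
    finally show ?thesis .
  qed
  let ?f' = "\<lambda>z p v. \<theta> (fst z) * (\<psi>' (fst p * fst z + snd p * snd z) * (fst v * fst z + snd v * snd z))"
  have bound: "\<bar>?f' z p v\<bar> \<le> W z * norm v" if "p \<in> X" for z p and v :: "real \<times> real"
  proof -
    have "\<bar>fst v * fst z + snd v * snd z\<bar> \<le> \<bar>fst v\<bar> * \<bar>fst z\<bar> + \<bar>snd v\<bar> * \<bar>snd z\<bar>"
      by (metis abs_mult abs_triangle_ineq)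
    also have "\<dots> \<le> norm v * \<bar>fst z\<bar> + norm v * \<bar>snd z\<bar>"
      using norm_fst_le[of "fst v" "snd v"] norm_snd_le[of "snd v" "fst v"]
      by (intro add_mono mult_right_mono) auto
    finally have "\<bar>fst v * fst z + snd v * snd z\<bar> \<le> (\<bar>fst z\<bar> + \<bar>snd z\<bar>) * norm v"
      by (simp add: algebra_simps)
    then have "\<bar>?f' z p v\<bar> \<le> \<bar>\<theta> (fst z)\<bar> *
        (\<bar>\<psi>' (fst p * fst z + snd p * snd z)\<bar> * ((\<bar>fst z\<bar> + \<bar>snd z\<bar>) * norm v))"
      by (simp only: abs_mult) (intro mult_left_mono, auto)
    also have "\<dots> = \<bar>\<theta> (fst z)\<bar> *
        (\<bar>\<psi>' (fst p * fst z + snd p * snd z)\<bar> * (\<bar>fst z\<bar> + \<bar>snd z\<bar>)) * norm v"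
      by (simp only: mult.assoc)
    also have "\<dots> \<le> W z * norm v"
      using key[OF that, of "fst z" "snd z"] by (intro mult_right_mono) auto
    finally show ?thesis .
  qed
  have m0: "(m, \<sigma>) \<in> X" by (simp add: X_def)
  have meas: "(\<lambda>z. ?f' z (m, \<sigma>) v) \<in> borel_measurable std_gaussian2" for v by measurable
  have int: "integrable std_gaussian2 (\<lambda>z. ?f' z (m, \<sigma>) v)" for v
    by (rule Bochner_Integration.integrable_bound[OF integrable_mult_left[OF W, of "norm v"] meas])
       (use order_trans[OF bound[OF m0] abs_ge_self] in auto)
  show i2: "integrable std_gaussian2 (\<lambda>z. \<theta> (fst z) * (snd z * \<psi>' (m * fst z + \<sigma> * snd z)))"
    using int[of "(0, 1)"] by (simp add: mult_ac)
  have i1: "integrable std_gaussian2 (\<lambda>z. fst z * \<theta> (fst z) * \<psi>' (m * fst z + \<sigma> * snd z))"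
    using int[of "(1, 0)"] by (simp add: mult_ac)
  have "((\<lambda>p. \<integral>z. \<theta> (fst z) * \<psi> (fst p * fst z + snd p * snd z) \<partial>std_gaussian2) has_derivative
      (\<lambda>v. \<integral>z. ?f' z (m, \<sigma>) v \<partial>std_gaussian2)) (at (m, \<sigma>) within X)"
  proof (rule has_derivative_integral[where f' = ?f' and w = W])
    show "(m, \<sigma>) \<in> X" "integrable std_gaussian2 W" by fact+
    show "(\<lambda>z. ?f' z (m, \<sigma>) v) \<in> borel_measurable std_gaussian2" for v by (rule meas)
    show "\<bar>?f' z p v\<bar> \<le> W z * norm v" if "p \<in> X" for z p v by (rule bound[OF that])
    show "convex X" by (simp add: X_def)
    show "integrable std_gaussian2 (\<lambda>z. \<theta> (fst z) * \<psi> (fst p * fst z + snd p * snd z))" for p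
      using integrable_gaussian2_linear_comb[OF pg(1,2), of 1 0 "fst p" "snd p"] by simp
    fix z p :: "real \<times> real"
    have "((\<lambda>p. \<psi> (fst p * fst z + snd p * snd z)) has_derivative
        (\<lambda>v. (fst v * fst z + snd v * snd z) * \<psi>' (fst p * fst z + snd p * snd z))) (at p within X)"
      by (rule DERIV_compose_FDERIV[OF D]) (auto intro!: derivative_eq_intros)
    from has_derivative_mult_right[OF this]
    show "((\<lambda>p. \<theta> (fst z) * \<psi> (fst p * fst z + snd p * snd z)) has_derivative ?f' z p) (at p within X)"
      by (simp add: mult_ac)
  qed
  moreover have "at (m, \<sigma>) within X = at (m, \<sigma>)"
    by (rule at_within_open) (simp_all add: X_def)
  moreover have "(\<integral>z. ?f' z (m, \<sigma>) v \<partial>std_gaussian2) = fst v * gauss2 (\<lambda>e. e * \<theta> e) \<psi>' m \<sigma> +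
         snd v * (\<integral>z. \<theta> (fst z) * (snd z * \<psi>' (m * fst z + \<sigma> * snd z)) \<partial>std_gaussian2)" for v
  proof -
    have "(\<integral>z. ?f' z (m, \<sigma>) v \<partial>std_gaussian2) =
        (\<integral>z. fst v * (fst z * \<theta> (fst z) * \<psi>' (m * fst z + \<sigma> * snd z)) +
          snd v * (\<theta> (fst z) * (snd z * \<psi>' (m * fst z + \<sigma> * snd z))) \<partial>std_gaussian2)"
      by (intro Bochner_Integration.integral_cong refl) (simp add: algebra_simps)
    then show ?thesis unfolding gauss2_def using i1 i2 by simp
  qed
  ultimately show "((\<lambda>p. gauss2 \<theta> \<psi> (fst p) (snd p)) has_derivative
    (\<lambda>v. fst v * gauss2 (\<lambda>e. e * \<theta> e) \<psi>' m \<sigma> +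
         snd v * (\<integral>z. \<theta> (fst z) * (snd z * \<psi>' (m * fst z + \<sigma> * snd z)) \<partial>std_gaussian2))) (at (m, \<sigma>))"
    unfolding gauss2_def[of \<theta> \<psi>] by simp
qed

text \<open>Stein's identity in the second variable trades the factor \<open>snd z\<close> for
  \<open>\<sigma>\<close> and one more derivative of \<open>\<psi>\<close>. The factor
  \<open>\<sigma>\<close> is what later cancels the singular derivative of the square root.\<close>

lemma has_derivative_gauss2_pair:
  assumes "poly_growth \<theta>" "smooth_growth \<psi>"
  shows "((\<lambda>p. gauss2 \<theta> \<psi> (fst p) (snd p)) has_derivative
    (\<lambda>v. fst v * gauss2 (\<lambda>e. e * \<theta> e) (deriv \<psi>) m \<sigma> +
         snd v * (\<sigma> * gauss2 \<theta> (deriv (deriv \<psi>)) m \<sigma>))) (at (m, \<sigma>))"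
proof -
  note sg = smooth_growth_deriv[OF assms(2)] smooth_growth_deriv[OF smooth_growth_deriv(2)[OF assms(2)]]
  note pg = assms(1) smooth_growth_imp_poly_growth[OF assms(2)]
    smooth_growth_imp_poly_growth[OF sg(2)] smooth_growth_imp_poly_growth[OF sg(4)]
  note aux = has_derivative_gauss2_aux[OF sg(1) pg(1-3)]
  have "(\<integral>z. \<theta> (fst z) * (snd z * deriv \<psi> (m * fst z + \<sigma> * snd z)) \<partial>std_gaussian2) =
      \<sigma> * gauss2 \<theta> (deriv (deriv \<psi>)) m \<sigma>"
    by (subst integral_gaussian2_fst[OF aux(2)])
       (simp add: gauss2_iterated[OF pg(1,4)] mult.left_commute[of _ \<sigma>] stein_identity[OF sg(3) pg(3,4)])
  with aux(1)[of m \<sigma>] show ?thesis by simp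
qed

text \<open>For \<open>\<tau> > 0\<close> the chain rule cancels \<open>sqrt \<tau>\<close> against
  the derivative of the root. At 0 the root is not differentiable, and l'Hopital's rule for
  \<open>(f \<sigma> - f 0) / \<sigma>\<^sup>2\<close> gives the one-sided derivative.\<close>

lemma DERIV_comp_sqrt:
  fixes f g :: "real \<Rightarrow> real"
  assumes D: "\<And>\<sigma>. (f has_real_derivative \<sigma> * g \<sigma>) (at \<sigma>)"
    and g: "isCont g 0" and "\<tau> \<ge> 0"
  shows "((\<lambda>\<tau>. f (sqrt \<tau>)) has_real_derivative g (sqrt \<tau>) / 2) (at \<tau> within {0..})"
proof (cases "\<tau> = 0")
  case False
  with assms(3) have "\<tau> > 0" by simp
  have "((\<lambda>\<tau>. f (sqrt \<tau>)) has_real_derivative (sqrt \<tau> * g (sqrt \<tau>)) * (inverse (sqrt \<tau>) / 2)) (at \<tau>)"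
    by (rule DERIV_chain2[OF D DERIV_real_sqrt[OF \<open>\<tau> > 0\<close>]])
  then have "((\<lambda>\<tau>. f (sqrt \<tau>)) has_real_derivative g (sqrt \<tau>) / 2) (at \<tau>)"
    using \<open>\<tau> > 0\<close> by (simp add: field_simps)
  then show ?thesis by (rule has_field_derivative_at_within)
next
  case True
  have "isCont f 0" using D[of 0] by (rule DERIV_isCont)
  have "((\<lambda>\<sigma>. (f \<sigma> - f 0) / \<sigma>\<^sup>2) \<longlongrightarrow> g 0 / 2) (at_right 0)"
  proof (rule lhopital_right[where f' = "\<lambda>\<sigma>. \<sigma> * g \<sigma>" and g' = "\<lambda>\<sigma>. 2 * \<sigma>"])
    show "((\<lambda>\<sigma>. f \<sigma> - f 0) \<longlongrightarrow> 0) (at_right 0)"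
      using \<open>isCont f 0\<close> unfolding isCont_def by (auto intro: tendsto_eq_intros LIM_zero simp: filterlim_at_split)
    show "((\<lambda>\<sigma>::real. \<sigma>\<^sup>2) \<longlongrightarrow> 0) (at_right 0)" by (auto intro!: tendsto_eq_intros)
    show "\<forall>\<^sub>F \<sigma> in at_right 0. \<sigma>\<^sup>2 \<noteq> (0::real)" "\<forall>\<^sub>F \<sigma> in at_right 0. 2 * \<sigma> \<noteq> (0::real)"
      by (auto simp: eventually_at_filter)
    show "\<forall>\<^sub>F \<sigma> in at_right 0. ((\<lambda>\<sigma>. f \<sigma> - f 0) has_real_derivative \<sigma> * g \<sigma>) (at \<sigma>)"
      using D by (auto intro!: always_eventually derivative_eq_intros)
    show "\<forall>\<^sub>F \<sigma> in at_right 0. ((\<lambda>\<sigma>::real. \<sigma>\<^sup>2) has_real_derivative 2 * \<sigma>) (at \<sigma>)"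
      by (auto intro!: always_eventually derivative_eq_intros)
    have "((\<lambda>\<sigma>. g \<sigma> / 2) \<longlongrightarrow> g 0 / 2) (at_right 0)"
      using g unfolding isCont_def filterlim_at_split by (auto intro!: tendsto_divide)
    then show "((\<lambda>\<sigma>. \<sigma> * g \<sigma> / (2 * \<sigma>)) \<longlongrightarrow> g 0 / 2) (at_right 0)"
      by (rule Lim_transform_eventually) (auto simp: eventually_at_filter)
  qed
  moreover have "filterlim sqrt (at_right 0) (at_right 0)"
    unfolding filterlim_at
    by (auto simp: eventually_at_filter intro!: tendsto_eq_intros)
  ultimately have "((\<lambda>\<tau>. (f (sqrt \<tau>) - f 0) / (sqrt \<tau>)\<^sup>2) \<longlongrightarrow> g 0 / 2) (at_right 0)"
    by (rule filterlim_compose)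
  then have "((\<lambda>\<tau>. (f (sqrt \<tau>) - f (sqrt 0)) / (\<tau> - 0)) \<longlongrightarrow> g 0 / 2) (at_right 0)"
    by (rule Lim_transform_eventually) (auto simp: eventually_at_filter)
  then show ?thesis unfolding has_field_derivative_iff using True
    by (simp add: at_within_Ici_at_right)
qed

text \<open>The second derivative with the factor 1/2 is the heat equation in the variance. The
  total derivative on the closed half plane is assembled from the two partial ones, the one in
  \<open>\<tau>\<close> being jointly continuous as a bounded linear map.\<close>

lemma has_derivative_gauss2:
  assumes "poly_growth \<theta>" "smooth_growth \<psi>" "\<tau> \<ge> 0"
  shows "((\<lambda>(m, \<tau>). gauss2 \<theta> \<psi> m (sqrt \<tau>)) has_derivative
    (\<lambda>(v, w). gauss2 (\<lambda>e. e * \<theta> e) (deriv \<psi>) m (sqrt \<tau>) * v +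
         gauss2 \<theta> (deriv (deriv \<psi>)) m (sqrt \<tau>) / 2 * w)) (at (m, \<tau>) within UNIV \<times> {0..})"
proof -
  let ?\<psi>2 = "deriv (deriv \<psi>)"
  have sg: "smooth_growth ?\<psi>2" by (intro smooth_growth_deriv(2) assms(2))
  have c2: "isCont (\<lambda>p. gauss2 \<theta> ?\<psi>2 (fst p) (snd p)) (m, \<sigma>)" for m \<sigma>
    by (rule has_derivative_continuous[OF has_derivative_gauss2_pair[OF assms(1) sg]])
  have "((\<lambda>(m, \<tau>). gauss2 \<theta> \<psi> m (sqrt \<tau>)) has_derivative
     (\<lambda>(v, w). v * gauss2 (\<lambda>e. e * \<theta> e) (deriv \<psi>) m (sqrt \<tau>) +
       blinfun_apply (blinfun_mult_right (gauss2 \<theta> ?\<psi>2 m (sqrt \<tau>) / 2)) w)) (at (m, \<tau>) within UNIV \<times> {0..})"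
  proof (rule has_derivative_partialsI)
    have "((\<lambda>m. (m, sqrt \<tau>)) has_derivative (\<lambda>v. (v, 0))) (at m)"
      by (auto intro!: derivative_eq_intros)
    from has_derivative_compose[OF this has_derivative_gauss2_pair[OF assms(1,2), of m "sqrt \<tau>"]]
    show "((\<lambda>m. gauss2 \<theta> \<psi> m (sqrt \<tau>)) has_derivative
      (\<lambda>v. v * gauss2 (\<lambda>e. e * \<theta> e) (deriv \<psi>) m (sqrt \<tau>))) (at m)" by simp
  next
    fix m \<tau> :: real assume "\<tau> \<in> {0..}"
    have "((\<lambda>\<tau>. gauss2 \<theta> \<psi> m (sqrt \<tau>)) has_real_derivative gauss2 \<theta> ?\<psi>2 m (sqrt \<tau>) / 2) (at \<tau> within {0..})"
    proof (rule DERIV_comp_sqrt)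
      fix \<sigma> :: real
      have "((\<lambda>\<sigma>. (m, \<sigma>)) has_derivative (\<lambda>v. (0, v))) (at \<sigma>)"
        by (auto intro!: derivative_eq_intros)
      from has_derivative_compose[OF this has_derivative_gauss2_pair[OF assms(1,2), of m \<sigma>]]
      show "(gauss2 \<theta> \<psi> m has_real_derivative \<sigma> * gauss2 \<theta> ?\<psi>2 m \<sigma>) (at \<sigma>)"
        by (simp add: has_field_derivative_def mult_commute_abs)
    next
      have "isCont (\<lambda>\<sigma>. (m, \<sigma>)) (0::real)" by (intro continuous_intros)
      from isCont_o2[OF this c2[of m 0]] show "isCont (gauss2 \<theta> ?\<psi>2 m) 0" by simp
    qed (use \<open>\<tau> \<in> {0..}\<close> in auto)
    then show "((\<lambda>\<tau>. gauss2 \<theta> \<psi> m (sqrt \<tau>)) has_derivative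
        blinfun_apply (blinfun_mult_right (gauss2 \<theta> ?\<psi>2 m (sqrt \<tau>) / 2))) (at \<tau> within {0..})"
      by (simp add: has_field_derivative_def blinfun_mult_right.rep_eq)
  next
    have "isCont (\<lambda>p. (fst p, sqrt (snd p))) (m, \<tau>)" by (intro continuous_intros)
    from isCont_o2[OF this] c2
    have "isCont (\<lambda>p. gauss2 \<theta> ?\<psi>2 (fst p) (sqrt (snd p))) (m, \<tau>)"
      by fastforce
    then have "isCont (\<lambda>p. gauss2 \<theta> ?\<psi>2 (fst p) (sqrt (snd p)) / 2) (m, \<tau>)"
      by (rule continuous_divide) (auto intro: continuous_intros)
    then have "isCont (\<lambda>p. blinfun_mult_right (gauss2 \<theta> ?\<psi>2 (fst p) (sqrt (snd p)) / 2)) (m, \<tau>)"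
      by (rule bounded_linear.continuous[OF bounded_linear_blinfun_mult_right])
    then show "continuous (at (m, \<tau>) within UNIV \<times> {0..})
        (\<lambda>(m, \<tau>). blinfun_mult_right (gauss2 \<theta> ?\<psi>2 m (sqrt \<tau>) / 2))"
      unfolding case_prod_unfold by (rule continuous_at_imp_continuous_at_within)
  qed (use assms in auto)
  then show ?thesis by (simp add: blinfun_mult_right.rep_eq mult.commute)
qed

text \<open>Points with \<open>\<tau> x = 0\<close> are included: \<open>\<tau>\<close> maps the
  open set \<open>S\<close> into the half line, so the chain rule needs the outer derivative only
  within the half plane, yet it yields a two-sided derivative in \<open>x\<close>.\<close>

lemma smooth_on_gauss2:
  fixes m \<tau> :: "'a::real_normed_vector \<Rightarrow> real"
  assumes S: "open S" and m: "smooth_on S m" and \<tau>: "smooth_on S \<tau>" "\<And>x. x \<in> S \<Longrightarrow> \<tau> x \<ge> 0"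
    and "poly_growth \<theta>" "smooth_growth \<psi>"
  shows "smooth_on S (\<lambda>x. gauss2 \<theta> \<psi> (m x) (sqrt (\<tau> x)))"
proof -
  define I where "I = {(\<theta>, \<psi>). poly_growth \<theta> \<and> smooth_growth \<psi>}"
  define \<Phi> where "\<Phi> i x = gauss2 (fst i) (snd i) (m x) (sqrt (\<tau> x))" for i x
  \<comment> \<open>\<open>True\<close> stands for the direction \<open>m\<close> and
    \<open>False\<close> for the direction \<open>\<tau>\<close>.\<close>
  define d where "d i b = (if b then (\<lambda>e. e * fst i e, deriv (snd i)) else (fst i, deriv (deriv (snd i))))"
    for i :: "(real \<Rightarrow> real) \<times> (real \<Rightarrow> real)" and b :: bool
  define w where "w i b x v = (if b then frechet_derivative m (at x) v else frechet_derivative \<tau> (at x) v / 2)"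
    for i :: "(real \<Rightarrow> real) \<times> (real \<Rightarrow> real)" and b :: bool and x v
  have "smooth_on S (\<Phi> (\<theta>, \<psi>))"
  proof (rule smooth_on_family[OF S, where I = I and M = UNIV and d = d and w = w])
    show "(\<theta>, \<psi>) \<in> I" using assms by (simp add: I_def)
    show "d i b \<in> I" if "i \<in> I" for i b
      using that by (auto simp: I_def d_def intro!: poly_growth_mult poly_growth_id smooth_growth_deriv)
    show "smooth_on S (\<lambda>x. w i b x v)" for i b v
      unfolding w_def by (cases b) (auto intro!: smooth_on_frechet_derivative m \<tau> S)
    fix i x assume "i \<in> I" "x \<in> S"
    then have i: "poly_growth (fst i)" "smooth_growth (snd i)" by (auto simp: I_def)
    have "((\<lambda>x. (m x, \<tau> x)) has_derivative
        (\<lambda>v. (frechet_derivative m (at x) v, frechet_derivative \<tau> (at x) v))) (at x within S)"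
      by (rule has_derivative_Pair[OF
            has_derivative_at_withinI[OF smooth_on_has_derivative[OF m \<open>x \<in> S\<close>]]
            has_derivative_at_withinI[OF smooth_on_has_derivative[OF \<tau>(1) \<open>x \<in> S\<close>]]])
    moreover have "((\<lambda>(m, \<tau>). gauss2 (fst i) (snd i) m (sqrt \<tau>)) has_derivative
      (\<lambda>(v, w). gauss2 (\<lambda>e. e * fst i e) (deriv (snd i)) (m x) (sqrt (\<tau> x)) * v +
         gauss2 (fst i) (deriv (deriv (snd i))) (m x) (sqrt (\<tau> x)) / 2 * w))
         (at (m x, \<tau> x) within (\<lambda>x. (m x, \<tau> x)) ` S)"
      by (rule has_derivative_subset[OF has_derivative_gauss2[OF i]]) (use \<tau>(2) \<open>x \<in> S\<close> in auto)
    ultimately have "((\<lambda>x. (\<lambda>(m, \<tau>). gauss2 (fst i) (snd i) m (sqrt \<tau>)) (m x, \<tau> x)) has_derivative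
       (\<lambda>v. (\<lambda>(v, w). gauss2 (\<lambda>e. e * fst i e) (deriv (snd i)) (m x) (sqrt (\<tau> x)) * v +
         gauss2 (fst i) (deriv (deriv (snd i))) (m x) (sqrt (\<tau> x)) / 2 * w)
         (frechet_derivative m (at x) v, frechet_derivative \<tau> (at x) v))) (at x within S)"
      by (rule has_derivative_in_compose)
    then show "(\<Phi> i has_derivative (\<lambda>v. \<Sum>b\<in>UNIV. \<Phi> (d i b) x * w i b x v)) (at x)"
      using at_within_open[OF \<open>x \<in> S\<close> S] by (simp add: \<Phi>_def[abs_def] d_def w_def UNIV_bool add.commute)
  qed
  then show ?thesis by (simp add: \<Phi>_def[abs_def])
qed

section \<open>Exchangeability of a correlated Gaussian pair\<close>

lemma nn_integral_gaussian2_shear: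
  fixes f :: "real \<times> real \<Rightarrow> ennreal"
  assumes [measurable]: "f \<in> borel_measurable (borel \<Otimes>\<^sub>M borel)" and "\<kappa> > 0"
  shows "(\<integral>\<^sup>+z. f (fst z, \<rho> * fst z + \<kappa> * snd z) \<partial>std_gaussian2) =
    (\<integral>\<^sup>+x. \<integral>\<^sup>+w. ennreal (std_normal_density x * std_normal_density ((w - \<rho> * x) / \<kappa>) / \<kappa>) * f (x, w)
      \<partial>lborel \<partial>lborel)"
proof -
  have "(\<integral>\<^sup>+z. f (fst z, \<rho> * fst z + \<kappa> * snd z) \<partial>std_gaussian2) =
      (\<integral>\<^sup>+x. \<integral>\<^sup>+y. f (x, \<rho> * x + \<kappa> * y) \<partial>std_gaussian \<partial>std_gaussian)"
    by (subst std_gaussian.nn_integral_fst[symmetric]) simp_all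
  also have "\<dots> = (\<integral>\<^sup>+x. ennreal (std_normal_density x) *
      (\<integral>\<^sup>+y. ennreal (std_normal_density y) * f (x, \<rho> * x + \<kappa> * y) \<partial>lborel) \<partial>lborel)"
    unfolding std_gaussian_def by (simp add: nn_integral_density)
  also have "\<dots> = (\<integral>\<^sup>+x. \<integral>\<^sup>+w. ennreal (std_normal_density x * std_normal_density ((w - \<rho> * x) / \<kappa>) / \<kappa>) * f (x, w)
      \<partial>lborel \<partial>lborel)"
  proof (intro nn_integral_cong)
    fix x :: real
    have "(\<integral>\<^sup>+w. ennreal (std_normal_density x * std_normal_density ((w - \<rho> * x) / \<kappa>) / \<kappa>) * f (x, w) \<partial>lborel) =
        ennreal \<kappa> * (\<integral>\<^sup>+y. ennreal (std_normal_density x * std_normal_density y / \<kappa>) * f (x, \<rho> * x + \<kappa> * y) \<partial>lborel)"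
      using assms(2) by (subst nn_integral_real_affine[of _ \<kappa> "\<rho> * x"]) simp_all
    also have "\<dots> = (\<integral>\<^sup>+y. ennreal \<kappa> * (ennreal (std_normal_density x * std_normal_density y / \<kappa>) * f (x, \<rho> * x + \<kappa> * y)) \<partial>lborel)"
      by (rule nn_integral_cmult[symmetric]) measurable
    also have "\<dots> = (\<integral>\<^sup>+y. ennreal (std_normal_density x) * (ennreal (std_normal_density y) * f (x, \<rho> * x + \<kappa> * y)) \<partial>lborel)"
      using assms(2)
      by (intro nn_integral_cong) (simp add: mult.assoc[symmetric] ennreal_mult[symmetric])
    also have "\<dots> = ennreal (std_normal_density x) *
      (\<integral>\<^sup>+y. ennreal (std_normal_density y) * f (x, \<rho> * x + \<kappa> * y) \<partial>lborel)"
      by (rule nn_integral_cmult) measurable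
    finally show "ennreal (std_normal_density x) *
      (\<integral>\<^sup>+y. ennreal (std_normal_density y) * f (x, \<rho> * x + \<kappa> * y) \<partial>lborel) =
      (\<integral>\<^sup>+w. ennreal (std_normal_density x * std_normal_density ((w - \<rho> * x) / \<kappa>) / \<kappa>) * f (x, w) \<partial>lborel)"
      by simp
  qed
  finally show ?thesis .
qed

text \<open>For \<open>\<kappa> > 0\<close> the pair \<open>(x, w)\<close> with
  \<open>w = \<rho> * x + \<kappa> * y\<close> has a density whose exponent is symmetric:
  \<open>\<kappa>\<^sup>2\<close> times the quadratic form equals
  \<open>x\<^sup>2 + w\<^sup>2 - 2 * \<rho> * x * w\<close>. For \<open>\<kappa> = 0\<close> there
  is no density, but then \<open>\<rho>\<close> is 1 or -1 and the symmetry of the normal law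
  suffices.\<close>

lemma nn_integral_gaussian2_swap:
  fixes f :: "real \<times> real \<Rightarrow> ennreal"
  assumes f [measurable]: "f \<in> borel_measurable (borel \<Otimes>\<^sub>M borel)" and "\<kappa> \<ge> 0" "\<rho>\<^sup>2 + \<kappa>\<^sup>2 = 1"
  shows "(\<integral>\<^sup>+z. f (fst z, \<rho> * fst z + \<kappa> * snd z) \<partial>std_gaussian2) =
    (\<integral>\<^sup>+z. f (\<rho> * fst z + \<kappa> * snd z, fst z) \<partial>std_gaussian2)"
proof (cases "\<kappa> = 0")
  case False
  with assms(2) have "\<kappa> > 0" by simp
  define k where "k x w = std_normal_density x * std_normal_density ((w - \<rho> * x) / \<kappa>) / \<kappa>" for x w
  have k_meas [measurable]: "(\<lambda>z. k (fst z) (snd z)) \<in> borel_measurable (borel \<Otimes>\<^sub>M borel)"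
    unfolding k_def by measurable
  have "x\<^sup>2 + ((w - \<rho> * x) / \<kappa>)\<^sup>2 = w\<^sup>2 + ((x - \<rho> * w) / \<kappa>)\<^sup>2" for x w
  proof -
    have "\<kappa>\<^sup>2 * (x\<^sup>2 + ((w - \<rho> * x) / \<kappa>)\<^sup>2) = \<kappa>\<^sup>2 * x\<^sup>2 + (w - \<rho> * x)\<^sup>2" for x w
      using \<open>\<kappa> > 0\<close> by (simp add: field_simps)
    also have "\<kappa>\<^sup>2 * x\<^sup>2 + (w - \<rho> * x)\<^sup>2 = (\<rho>\<^sup>2 + \<kappa>\<^sup>2) * x\<^sup>2 + w\<^sup>2 - 2 * \<rho> * x * w" for x w
      by (simp add: power2_eq_square algebra_simps)
    also have "(\<rho>\<^sup>2 + \<kappa>\<^sup>2) * x\<^sup>2 + w\<^sup>2 - 2 * \<rho> * x * w = x\<^sup>2 + w\<^sup>2 - 2 * \<rho> * x * w" for x w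
      by (simp add: assms(3))
    finally have "\<kappa>\<^sup>2 * (x\<^sup>2 + ((w - \<rho> * x) / \<kappa>)\<^sup>2) = x\<^sup>2 + w\<^sup>2 - 2 * \<rho> * x * w" for x w .
    from this[of x w] this[of w x]
    have "\<kappa>\<^sup>2 * (x\<^sup>2 + ((w - \<rho> * x) / \<kappa>)\<^sup>2) = \<kappa>\<^sup>2 * (w\<^sup>2 + ((x - \<rho> * w) / \<kappa>)\<^sup>2)"
      by (simp only: mult_ac add_ac)
    then show ?thesis using \<open>\<kappa> > 0\<close> by simp
  qed
  moreover have "k x w = exp (- (x\<^sup>2 + ((w - \<rho> * x) / \<kappa>)\<^sup>2) / 2) / (2 * pi * \<kappa>)" for x w
  proof -
    have "exp (- (x\<^sup>2 + ((w - \<rho> * x) / \<kappa>)\<^sup>2) / 2) = exp (- x\<^sup>2 / 2) * exp (- ((w - \<rho> * x) / \<kappa>)\<^sup>2 / 2)"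
      by (simp add: add_divide_distrib flip: exp_add)
    moreover have "sqrt (2 * pi) * sqrt (2 * pi) = 2 * pi" by simp
    ultimately show ?thesis by (simp add: k_def std_normal_density_def del: real_sqrt_mult_self)
  qed
  ultimately have k_sym: "k x w = k w x" for x w by metis
  have "(\<integral>\<^sup>+z. f (fst z, \<rho> * fst z + \<kappa> * snd z) \<partial>std_gaussian2) =
      (\<integral>\<^sup>+x. \<integral>\<^sup>+w. ennreal (k x w) * f (x, w) \<partial>lborel \<partial>lborel)"
    using nn_integral_gaussian2_shear[OF f \<open>\<kappa> > 0\<close>] by (simp add: k_def)
  also have "\<dots> = (\<integral>\<^sup>+w. \<integral>\<^sup>+x. ennreal (k x w) * f (x, w) \<partial>lborel \<partial>lborel)"
    using lborel_pair.Fubini'[of "\<lambda>x w. ennreal (k x w) * f (x, w)"] k_meas f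
    by (simp add: case_prod_unfold)
  also have "\<dots> = (\<integral>\<^sup>+x. \<integral>\<^sup>+w. ennreal (k x w) * f (w, x) \<partial>lborel \<partial>lborel)"
    using k_sym by simp
  also have "\<dots> = (\<integral>\<^sup>+z. f (\<rho> * fst z + \<kappa> * snd z, fst z) \<partial>std_gaussian2)"
    using nn_integral_gaussian2_shear[of "\<lambda>z. f (snd z, fst z)" \<kappa> \<rho>] \<open>\<kappa> > 0\<close> by (simp add: k_def)
  finally show ?thesis .
next
  case True
  have fst: "(\<integral>\<^sup>+z. g (fst z) \<partial>std_gaussian2) = (\<integral>\<^sup>+x. g x \<partial>std_gaussian)"
    if [measurable]: "g \<in> borel_measurable borel" for g :: "real \<Rightarrow> ennreal"
    by (subst std_gaussian.nn_integral_fst[symmetric])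
       (simp_all add: std_gaussian.emeasure_space_1[simplified])
  have neg: "(\<integral>\<^sup>+x. g (- x) \<partial>std_gaussian) = (\<integral>\<^sup>+x. g x \<partial>std_gaussian)"
    if [measurable]: "g \<in> borel_measurable borel" for g :: "real \<Rightarrow> ennreal"
    unfolding std_gaussian_def
    by (simp add: nn_integral_density)
       (subst nn_integral_real_affine[of _ "-1" 0], simp_all add: std_normal_density_def)
  from True assms(3) have "\<rho> = 1 \<or> \<rho> = -1" by (simp add: power2_eq_1_iff)
  then show ?thesis
  proof
    assume "\<rho> = -1"
    have "(\<integral>\<^sup>+x. f (x, - x) \<partial>std_gaussian) = (\<integral>\<^sup>+x. f (- x, x) \<partial>std_gaussian)"
      using neg[of "\<lambda>x. f (- x, x)"] by simp
    then show ?thesis using True \<open>\<rho> = -1\<close>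
      using fst[of "\<lambda>x. f (x, - x)"] fst[of "\<lambda>x. f (- x, x)"] by simp
  qed (use True in simp)
qed

text \<open>Comparing the two laws, rather than positive and negative parts of \<open>h\<close>,
  carries the result over to Bochner integrals without a case distinction on integrability.\<close>

lemma integral_gaussian2_swap:
  fixes h :: "real \<times> real \<Rightarrow> real"
  assumes [measurable]: "h \<in> borel_measurable (borel \<Otimes>\<^sub>M borel)" and \<kappa>: "\<kappa> \<ge> 0" "\<rho>\<^sup>2 + \<kappa>\<^sup>2 = 1"
  shows "(\<integral>z. h (fst z, \<rho> * fst z + \<kappa> * snd z) \<partial>std_gaussian2) =
    (\<integral>z. h (\<rho> * fst z + \<kappa> * snd z, fst z) \<partial>std_gaussian2)"
proof -
  let ?B = "borel \<Otimes>\<^sub>M borel :: (real \<times> real) measure"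
  let ?M = "distr std_gaussian2 ?B (\<lambda>z. (fst z, \<rho> * fst z + \<kappa> * snd z))"
  let ?N = "distr std_gaussian2 ?B (\<lambda>z. (\<rho> * fst z + \<kappa> * snd z, fst z))"
  have "?M = ?N"
  proof (rule measure_eqI)
    fix A assume "A \<in> sets ?M"
    then have [measurable]: "A \<in> sets ?B" by simp
    have "emeasure ?M A = (\<integral>\<^sup>+z. indicator A z \<partial>?M)" by simp
    also have "\<dots> = (\<integral>\<^sup>+z. indicator A (fst z, \<rho> * fst z + \<kappa> * snd z) \<partial>std_gaussian2)"
      by (rule nn_integral_distr) measurable
    also have "\<dots> = (\<integral>\<^sup>+z. indicator A (\<rho> * fst z + \<kappa> * snd z, fst z) \<partial>std_gaussian2)"
      by (rule nn_integral_gaussian2_swap[OF _ \<kappa>]) measurable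
    also have "\<dots> = (\<integral>\<^sup>+z. indicator A z \<partial>?N)"
      by (rule nn_integral_distr[symmetric]) measurable
    also have "\<dots> = emeasure ?N A" by simp
    finally show "emeasure ?M A = emeasure ?N A" .
  qed simp
  moreover have "integral\<^sup>L ?M h = (\<integral>z. h (fst z, \<rho> * fst z + \<kappa> * snd z) \<partial>std_gaussian2)"
    by (rule integral_distr) measurable
  moreover have "integral\<^sup>L ?N h = (\<integral>z. h (\<rho> * fst z + \<kappa> * snd z, fst z) \<partial>std_gaussian2)"
    by (rule integral_distr) measurable
  ultimately show ?thesis by simp
qed

text \<open>Exchangeability applied to a function of the second component alone.\<close>

lemma integral_gaussian2_marginal:
  assumes "poly_growth f" "\<kappa> \<ge> 0" "\<rho>\<^sup>2 + \<kappa>\<^sup>2 = 1"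
  shows "(\<integral>z. f (\<rho> * fst z + \<kappa> * snd z) \<partial>std_gaussian2) = (\<integral>e. f e \<partial>std_gaussian)"
proof -
  have [measurable]: "f \<in> borel_measurable borel" using assms by auto
  have "(\<integral>z. f (\<rho> * fst z + \<kappa> * snd z) \<partial>std_gaussian2) = (\<integral>z. f (fst z) \<partial>std_gaussian2)"
    using integral_gaussian2_swap[OF _ assms(2,3), of "\<lambda>z. f (snd z)"] by simp
  also have "\<dots> = (\<integral>e. f e \<partial>std_gaussian)"
    using integrable_gaussian2_linear_comb[OF assms(1) poly_growth_const[of 1], of 1 0]
    by (subst integral_gaussian2_fst) (simp_all add: std_gaussian.prob_space[simplified])
  finally show ?thesis .
qed

text \<open>Splitting off an independent Gaussian of variance \<open>s\<^sup>2\<close> replaces \<open>\<psi>\<close> by a smooth function.\<close>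

lemma gauss2_gauss_conv:
  assumes "poly_growth \<theta>" "poly_growth \<psi>" "s > 0" "s\<^sup>2 \<le> \<tau>"
  shows "gauss2 \<theta> \<psi> m (sqrt \<tau>) = gauss2 \<theta> (gauss_conv \<psi> s 1) m (sqrt (\<tau> - s\<^sup>2))"
proof -
  have "\<tau> > 0" using assms(3,4) by (meson less_le_trans zero_less_power)
  \<comment> \<open>Chosen such that \<open>sqrt \<tau> * (\<rho> * u + \<kappa> * v)\<close> is
    \<open>sqrt (\<tau> - s\<^sup>2) * u + s * v\<close>.\<close>
  define \<rho> where "\<rho> = sqrt (\<tau> - s\<^sup>2) / sqrt \<tau>"
  define \<kappa> where "\<kappa> = s / sqrt \<tau>"
  have "\<rho>\<^sup>2 + \<kappa>\<^sup>2 = ((sqrt (\<tau> - s\<^sup>2))\<^sup>2 + s\<^sup>2) / \<tau>"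
    using \<open>\<tau> > 0\<close> by (simp add: \<rho>_def \<kappa>_def power_divide add_divide_distrib)
  also have "\<dots> = 1" using \<open>\<tau> > 0\<close> assms(4) by simp
  finally have \<rho>\<kappa>: "\<rho>\<^sup>2 + \<kappa>\<^sup>2 = 1" .
  have "(\<integral>e. \<psi> (\<mu> + sqrt \<tau> * e) \<partial>std_gaussian) =
      (\<integral>e. gauss_conv \<psi> s 1 (\<mu> + sqrt (\<tau> - s\<^sup>2) * e) \<partial>std_gaussian)" for \<mu>
  proof -
    have "(\<integral>e. \<psi> (\<mu> + sqrt \<tau> * e) \<partial>std_gaussian) =
        (\<integral>z. \<psi> (\<mu> + sqrt \<tau> * (\<rho> * fst z + \<kappa> * snd z)) \<partial>std_gaussian2)"
      using integral_gaussian2_marginal[OF poly_growth_affine[OF assms(2)] _ \<rho>\<kappa>, of \<mu> "sqrt \<tau>"]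
        assms(3) \<open>\<tau> > 0\<close> by (simp add: \<kappa>_def)
    also have "\<dots> = (\<integral>z. \<psi> (\<mu> + (sqrt (\<tau> - s\<^sup>2) * fst z + s * snd z)) \<partial>std_gaussian2)"
      using \<open>\<tau> > 0\<close> by (simp add: \<rho>_def \<kappa>_def distrib_left)
    also have "\<dots> = (\<integral>e. gauss_conv \<psi> s 1 (\<mu> + sqrt (\<tau> - s\<^sup>2) * e) \<partial>std_gaussian)"
      using integrable_gaussian2_linear_comb[OF poly_growth_affine[OF assms(2), of \<mu> 1] poly_growth_const[of 1],
          of "sqrt (\<tau> - s\<^sup>2)" s]
      by (subst integral_gaussian2_fst) (simp_all add: gauss_conv_def add.assoc)
    finally show ?thesis .
  qed
  moreover have "poly_growth (gauss_conv \<psi> s 1)"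
    using smooth_growth_gauss_conv[OF assms(2), of s] assms(3) smooth_growth_imp_poly_growth by simp
  ultimately show ?thesis using assms(1,2) by (simp add: gauss2_iterated)
qed

lemma smooth_on_gauss2_regular:
  fixes m \<tau> :: "'a::real_normed_vector \<Rightarrow> real"
  assumes S: "open S" and m: "smooth_on S m" and \<tau>: "smooth_on S \<tau>" "\<And>x. x \<in> S \<Longrightarrow> \<tau> x \<ge> 0"
    and pg: "poly_growth \<theta>" "poly_growth \<psi>"
    and reg: "smooth_growth \<psi> \<or> (\<forall>x\<in>S. \<tau> x > 0)"
  shows "smooth_on S (\<lambda>x. gauss2 \<theta> \<psi> (m x) (sqrt (\<tau> x)))"
  using reg
proof
  assume "smooth_growth \<psi>"
  then show ?thesis using assms by (intro smooth_on_gauss2) auto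
next
  assume pos: "\<forall>x\<in>S. \<tau> x > 0"
  show ?thesis
  proof (rule smooth_on_local)
    fix x0 assume x0: "x0 \<in> S"
    \<comment> \<open>The variance moved into \<open>\<psi>\<close> must be constant near
      \<open>x0\<close>. Half of \<open>\<tau> x0\<close> will do, since by continuity the remainder
      stays positive on the neighbourhood \<open>T\<close>.\<close>
    define s where "s = sqrt (\<tau> x0 / 2)"
    have s: "s > 0" "s\<^sup>2 = \<tau> x0 / 2" using pos x0 by (auto simp: s_def)
    define T where "T = \<tau> -` {\<tau> x0 / 2<..} \<inter> S"
    have T: "open T" unfolding T_def
      using smooth_on_imp_continuous_on[OF \<tau>(1)] continuous_on_open_vimage[OF S] open_greaterThan by blast
    have sub: "T \<subseteq> S" by (auto simp: T_def)
    have "smooth_on T (\<lambda>x. gauss2 \<theta> (gauss_conv \<psi> s 1) (m x) (sqrt (\<tau> x - s\<^sup>2)))"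
    proof (rule smooth_on_gauss2[OF T _ _ _ pg(1)])
      show "smooth_on T m" "smooth_on T (\<lambda>x. \<tau> x - s\<^sup>2)"
        using smooth_on_subset[OF m sub] smooth_on_subset[OF \<tau>(1) sub] T by auto
      show "0 \<le> \<tau> x - s\<^sup>2" if "x \<in> T" for x using that s by (auto simp: T_def)
      show "smooth_growth (gauss_conv \<psi> s 1)" using pg(2) s(1) by (intro smooth_growth_gauss_conv) auto
    qed
    then have "smooth_on T (\<lambda>x. gauss2 \<theta> \<psi> (m x) (sqrt (\<tau> x)))"
      by (rule smooth_on_cong[OF T]) (subst gauss2_gauss_conv[OF pg s(1)], auto simp: T_def s(2))
    then show "\<exists>T. open T \<and> x0 \<in> T \<and> smooth_on T (\<lambda>x. gauss2 \<theta> \<psi> (m x) (sqrt (\<tau> x)))"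
      using T x0 pos by (intro exI[of _ T]) (auto simp: T_def)
  qed
qed


subsection \<open>The dual activation\<close>

definition psd :: "real \<Rightarrow> real \<Rightarrow> real \<Rightarrow> bool" where
  "psd a c b \<longleftrightarrow> a \<ge> 0 \<and> b \<ge> 0 \<and> c\<^sup>2 \<le> a * b"

definition gauss_dual :: "(real \<Rightarrow> real) \<Rightarrow> real \<Rightarrow> real \<Rightarrow> real \<Rightarrow> real" where
  "gauss_dual \<psi> a c b = (\<integral>p. \<psi> (fst p) * \<psi> (snd p) \<partial>gaussian_pair a c b)"

lemma dual_kernel_eq: "dual_kernel \<psi> A x y = gauss_dual \<psi> (A x x) (A x y) (A y y)"
  by (simp add: dual_kernel_def gauss_dual_def)

text \<open>In terms of the correlation \<open>\<rho>\<close>, the Cholesky factors for conditioning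
  on the first and on the second variable have the same parameters \<open>\<rho>\<close> and
  \<open>\<kappa>\<close>, so exchangeability can interchange the two.\<close>

lemma psd_correlation:
  assumes "psd a c b"
  obtains \<rho> \<kappa> where "\<kappa> \<ge> 0" "\<rho>\<^sup>2 + \<kappa>\<^sup>2 = 1" "c / sqrt a = sqrt b * \<rho>" "sqrt (b - c\<^sup>2 / a) = sqrt b * \<kappa>"
    "c / sqrt b = sqrt a * \<rho>" "sqrt (a - c\<^sup>2 / b) = sqrt a * \<kappa>" "c\<^sup>2 < a * b \<Longrightarrow> \<kappa> > 0"
proof (cases "a * b = 0")
  case True
  with assms have "c = 0" by (simp add: psd_def)
  \<comment> \<open>\<open>that\<close> takes \<open>\<kappa>\<close> first, so a pair with a
    vanishing variance is given correlation 0 and \<open>\<kappa> = 1\<close>.\<close>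
  then show thesis using True by (intro that[of 1 0]) auto
next
  case False
  with assms have ab: "a > 0" "b > 0" by (auto simp: psd_def less_le)
  define \<rho> where "\<rho> = c / (sqrt a * sqrt b)"
  define \<kappa> where "\<kappa> = sqrt (1 - c\<^sup>2 / (a * b))"
  have le: "c\<^sup>2 / (a * b) \<le> 1" using assms ab by (simp add: psd_def)
  have \<rho>2: "\<rho>\<^sup>2 = c\<^sup>2 / (a * b)" using ab by (simp add: \<rho>_def power_divide power_mult_distrib)
  show thesis
  proof (rule that[of \<kappa> \<rho>])
    show "\<kappa> \<ge> 0" using le by (simp add: \<kappa>_def)
    show "\<rho>\<^sup>2 + \<kappa>\<^sup>2 = 1" using le by (simp add: \<rho>2 \<kappa>_def)
    show "c / sqrt a = sqrt b * \<rho>" "c / sqrt b = sqrt a * \<rho>"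
      using ab by (auto simp: \<rho>_def)
    have "b - c\<^sup>2 / a = b * (1 - c\<^sup>2 / (a * b))" "a - c\<^sup>2 / b = a * (1 - c\<^sup>2 / (a * b))"
      using ab by (auto simp: field_simps)
    then show "sqrt (b - c\<^sup>2 / a) = sqrt b * \<kappa>" "sqrt (a - c\<^sup>2 / b) = sqrt a * \<kappa>"
      by (simp_all only: \<kappa>_def real_sqrt_mult)
    show "\<kappa> > 0" if "c\<^sup>2 < a * b" using that ab by (simp add: \<kappa>_def)
  qed
qed

lemma gauss_dual_eq_integral:
  assumes [measurable]: "\<psi> \<in> borel_measurable borel"
  shows "gauss_dual \<psi> a c b = (\<integral>z. \<psi> (sqrt a * fst z) *
    \<psi> (c / sqrt a * fst z + sqrt (b - c\<^sup>2 / a) * snd z) \<partial>std_gaussian2)"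
proof -
  have [measurable]: "fst \<in> borel_measurable (borel :: (real \<times> real) measure)"
    "snd \<in> borel_measurable (borel :: (real \<times> real) measure)"
    unfolding borel_prod[symmetric] by measurable
  have [measurable]: "(\<lambda>z. (sqrt a * fst z, c / sqrt a * fst z + sqrt (b - c\<^sup>2 / a) * snd z))
      \<in> std_gaussian2 \<rightarrow>\<^sub>M borel"
    unfolding borel_prod[symmetric] by measurable
  show ?thesis
    by (simp add: gauss_dual_def gaussian_pair_def case_prod_unfold integral_distr)
qed

text \<open>Conditioning on the second variable instead of the first one: its variance \<open>b\<close> does not depend
  on the first argument of a kernel.\<close>

lemma gauss_dual_eq_gauss2:
  assumes pg: "poly_growth \<psi>" and "psd a c b"
  shows "gauss_dual \<psi> a c b = gauss2 (\<lambda>e. \<psi> (sqrt b * e)) \<psi> (c / sqrt b) (sqrt (a - c\<^sup>2 / b))"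
proof -
  have [measurable]: "\<psi> \<in> borel_measurable borel" using pg by auto
  obtain \<rho> \<kappa> where \<rho>\<kappa>: "\<kappa> \<ge> 0" "\<rho>\<^sup>2 + \<kappa>\<^sup>2 = 1" "c / sqrt a = sqrt b * \<rho>" "sqrt (b - c\<^sup>2 / a) = sqrt b * \<kappa>"
    "c / sqrt b = sqrt a * \<rho>" "sqrt (a - c\<^sup>2 / b) = sqrt a * \<kappa>"
    by (rule psd_correlation[OF assms(2)]) blast
  show ?thesis
    unfolding gauss_dual_eq_integral[OF poly_growth_measurable[OF pg]] gauss2_def \<rho>\<kappa>(3-6)
    using integral_gaussian2_swap[OF _ \<rho>\<kappa>(1,2), of "\<lambda>z. \<psi> (sqrt a * fst z) * \<psi> (sqrt b * snd z)"]
    by (simp add: distrib_left mult.assoc mult.commute[of "\<psi> (sqrt b * _)"])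
qed

text \<open>On the diagonal both variances move with \<open>x\<close>, so there is no fixed
  \<open>b\<close> to condition on. The second identity instead puts the squared activation into the
  slot that is differentiated, with slope 0 and weight 1.\<close>

lemma gauss_dual_diag:
  assumes pg: "poly_growth \<psi>" and "a \<ge> 0"
  shows "gauss_dual \<psi> a a a = (\<integral>e. (\<psi> (sqrt a * e))\<^sup>2 \<partial>std_gaussian)"
    and "gauss_dual \<psi> a a a = gauss2 (\<lambda>_. 1) (\<lambda>x. \<psi> x * \<psi> x) 0 (sqrt a)"
proof -
  have [measurable]: "\<psi> \<in> borel_measurable borel" using pg by auto
  have "a / sqrt a = sqrt a" using assms(2) by (simp add: real_div_sqrt)
  moreover have "a - a\<^sup>2 / a = 0" by (simp add: power2_eq_square)
  ultimately have "gauss_dual \<psi> a a a = (\<integral>z. (\<psi> (sqrt a * fst z))\<^sup>2 \<partial>std_gaussian2)"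
    by (simp add: gauss_dual_eq_integral power2_eq_square)
  also have "\<dots> = (\<integral>e. (\<psi> (sqrt a * e))\<^sup>2 \<partial>std_gaussian)"
    using integral_gaussian2_marginal[of "\<lambda>e. (\<psi> (0 + sqrt a * e))\<^sup>2" 0 1] pg
    unfolding power2_eq_square
    by (simp add: poly_growth_mult poly_growth_affine[of \<psi> 0, simplified])
  finally show *: "gauss_dual \<psi> a a a = (\<integral>e. (\<psi> (sqrt a * e))\<^sup>2 \<partial>std_gaussian)" .
  show "gauss_dual \<psi> a a a = gauss2 (\<lambda>_. 1) (\<lambda>x. \<psi> x * \<psi> x) 0 (sqrt a)"
    unfolding * gauss2_iterated[OF poly_growth_const poly_growth_mult[OF pg pg]]
    by (simp add: power2_eq_square std_gaussian.prob_space[simplified])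
qed

text \<open>The last alternative in \<open>reg\<close> serves patches inside the padding, where the
  covariance may be singular for a non-smooth activation but does not depend on
  \<open>x\<close>.\<close>

lemma smooth_on_gauss_dual:
  fixes a c :: "'a::real_normed_vector \<Rightarrow> real"
  assumes S: "open S" and a: "smooth_on S a" and c: "smooth_on S c"
    and psd: "\<And>x. x \<in> S \<Longrightarrow> psd (a x) (c x) b" and pg: "poly_growth \<psi>"
    and reg: "smooth_growth \<psi> \<or> (\<forall>x\<in>S. (c x)\<^sup>2 < a x * b) \<or> (\<exists>t u. \<forall>x\<in>S. a x = t \<and> c x = u)"
  shows "smooth_on S (\<lambda>x. gauss_dual \<psi> (a x) (c x) b)"
proof (cases "\<exists>t u. \<forall>x\<in>S. a x = t \<and> c x = u")
  case True
  then obtain t u where "\<And>x. x \<in> S \<Longrightarrow> a x = t" "\<And>x. x \<in> S \<Longrightarrow> c x = u" by auto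
  then show ?thesis
    by (intro smooth_on_cong[OF S smooth_on_const[OF S, of "gauss_dual \<psi> t u b"]]) auto
next
  case False
  let ?\<tau> = "\<lambda>x. a x - (c x)\<^sup>2 / b"
  have "smooth_on S (\<lambda>x. gauss2 (\<lambda>e. \<psi> (sqrt b * e)) \<psi> (c x / sqrt b) (sqrt (?\<tau> x)))"
  proof (rule smooth_on_gauss2_regular[OF S])
    show "smooth_on S (\<lambda>x. c x / sqrt b)" using S c by auto
    show "smooth_on S ?\<tau>" unfolding power2_eq_square
      by (intro smooth_on_diff smooth_on_divide_const smooth_on_mult S a c)
    show "?\<tau> x \<ge> 0" if "x \<in> S" for x
    proof (cases "b = 0")
      case False
      then have "b > 0" using psd[OF that] by (simp add: psd_def)
      then show ?thesis using psd[OF that] by (simp add: psd_def pos_divide_le_eq)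
    qed (use psd[OF that] in \<open>simp add: psd_def\<close>)
    show "poly_growth (\<lambda>e. \<psi> (sqrt b * e))"
      using poly_growth_affine[OF pg, of 0 "sqrt b"] by simp
    have "?\<tau> x > 0" if "x \<in> S" "(c x)\<^sup>2 < a x * b" for x
    proof -
      have "b \<noteq> 0" using that(2) by auto
      then have "b > 0" using psd[OF that(1)] by (simp add: psd_def)
      with that(2) show ?thesis by (simp add: field_simps)
    qed
    then show "smooth_growth \<psi> \<or> (\<forall>x\<in>S. ?\<tau> x > 0)" using reg False by blast
  qed (rule pg)
  then show ?thesis
    by (rule smooth_on_cong[OF S]) (simp add: gauss_dual_eq_gauss2[OF pg psd])
qed

lemma smooth_on_gauss_dual_diag:
  fixes a :: "'a::real_normed_vector \<Rightarrow> real"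
  assumes S: "open S" and a: "smooth_on S a" "\<And>x. x \<in> S \<Longrightarrow> a x \<ge> 0" and pg: "poly_growth \<psi>"
    and reg: "smooth_growth \<psi> \<or> (\<forall>x\<in>S. a x > 0)"
  shows "smooth_on S (\<lambda>x. gauss_dual \<psi> (a x) (a x) (a x))"
proof -
  have "smooth_on S (\<lambda>x. gauss2 (\<lambda>_. 1) (\<lambda>x. \<psi> x * \<psi> x) 0 (sqrt (a x)))"
    by (rule smooth_on_gauss2_regular[OF S smooth_on_const[OF S] a poly_growth_const poly_growth_mult[OF pg pg]])
       (use reg smooth_growth_mult in auto)
  then show ?thesis
    by (rule smooth_on_cong[OF S]) (simp add: gauss_dual_diag(2)[OF pg a(2)])
qed

section \<open>Positive semi-definite matrices of size two\<close>

lemma psd_iff_quadratic_form: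
  "psd a c b \<longleftrightarrow> (\<forall>s t. 0 \<le> a * s\<^sup>2 + 2 * c * s * t + b * t\<^sup>2)"
proof
  assume p: "psd a c b"
  show "\<forall>s t. 0 \<le> a * s\<^sup>2 + 2 * c * s * t + b * t\<^sup>2"
  proof (intro allI)
    fix s t
    show "0 \<le> a * s\<^sup>2 + 2 * c * s * t + b * t\<^sup>2"
    proof (cases "a = 0")
      case False
      with p have "a > 0" by (simp add: psd_def)
      have "0 \<le> (a * s + c * t)\<^sup>2 + (a * b - c\<^sup>2) * t\<^sup>2"
        using p by (intro add_nonneg_nonneg mult_nonneg_nonneg) (auto simp: psd_def)
      also have "\<dots> = a * (a * s\<^sup>2 + 2 * c * s * t + b * t\<^sup>2)"
        by (simp add: power2_eq_square algebra_simps)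
      finally show ?thesis using \<open>a > 0\<close> by (simp add: zero_le_mult_iff)
    qed (use p in \<open>simp add: psd_def\<close>)
  qed
next
  assume q: "\<forall>s t. 0 \<le> a * s\<^sup>2 + 2 * c * s * t + b * t\<^sup>2"
  have ab: "a \<ge> 0" "b \<ge> 0" using q[rule_format, of 1 0] q[rule_format, of 0 1] by auto
  have "c\<^sup>2 \<le> a * b"
  proof (cases "a = 0")
    case True
    \<comment> \<open>For \<open>a = 0\<close> this test vector makes the form equal to
      \<open>- c\<^sup>2\<close>, which forces \<open>c = 0\<close>.\<close>
    have "0 \<le> 2 * c * (- (b + 1) / 2) * c + b * c\<^sup>2" using q[rule_format, of "- (b + 1) / 2" c] True by simp
    also have "\<dots> = - c\<^sup>2" by (simp add: power2_eq_square field_simps)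
    finally show ?thesis using True by simp
  next
    case False
    have "0 \<le> a * (- c)\<^sup>2 + 2 * c * (- c) * a + b * a\<^sup>2" using q by blast
    also have "\<dots> = a * (a * b - c\<^sup>2)" by (simp add: power2_eq_square algebra_simps)
    finally show ?thesis using False ab by (simp add: zero_le_mult_iff)
  qed
  with ab show "psd a c b" by (simp add: psd_def)
qed

text \<open>Immediate from the quadratic form, which is linear in the three entries, in contrast to
  the determinant.\<close>

lemma psd_add: "psd a c b \<Longrightarrow> psd a' c' b' \<Longrightarrow> psd (a + a') (c + c') (b + b')"
  unfolding psd_iff_quadratic_form
proof (intro allI)
  fix s t
  assume "\<forall>s t. 0 \<le> a * s\<^sup>2 + 2 * c * s * t + b * t\<^sup>2" "\<forall>s t. 0 \<le> a' * s\<^sup>2 + 2 * c' * s * t + b' * t\<^sup>2"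
  then have "0 \<le> (a * s\<^sup>2 + 2 * c * s * t + b * t\<^sup>2) + (a' * s\<^sup>2 + 2 * c' * s * t + b' * t\<^sup>2)"
    using add_nonneg_nonneg by blast
  then show "0 \<le> (a + a') * s\<^sup>2 + 2 * (c + c') * s * t + (b + b') * t\<^sup>2"
    by (simp add: algebra_simps)
qed

lemma psd_scale: "psd a c b \<Longrightarrow> r \<ge> 0 \<Longrightarrow> psd (r * a) (r * c) (r * b)"
  unfolding psd_iff_quadratic_form
proof (intro allI)
  fix s t
  assume "\<forall>s t. 0 \<le> a * s\<^sup>2 + 2 * c * s * t + b * t\<^sup>2" "r \<ge> 0"
  then have "0 \<le> r * (a * s\<^sup>2 + 2 * c * s * t + b * t\<^sup>2)" by simp
  then show "0 \<le> r * a * s\<^sup>2 + 2 * (r * c) * s * t + r * b * t\<^sup>2" by (simp add: algebra_simps)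
qed

text \<open>The form at \<open>(1, -1)\<close>, that is, the mean square of the difference.\<close>

lemma psd_gap: "psd a c b \<Longrightarrow> 2 * c \<le> a + b"
  unfolding psd_iff_quadratic_form by (drule spec[of _ 1], drule spec[of _ "-1"]) simp

lemma psd_const: "t \<ge> 0 \<Longrightarrow> psd t t t"
  by (simp add: psd_def power2_eq_square)

section \<open>Null sets and strict inequalities for the dual activation\<close>

lemma AE_std_gaussian_iff: "(AE x in std_gaussian. P x) \<longleftrightarrow> (AE x in lborel. P x)"
  unfolding std_gaussian_def by (subst AE_density) (simp_all add: normal_density_pos)

lemma AE_std_gaussian_affine:
  assumes [measurable]: "Measurable.pred borel P" and "d \<noteq> 0" "AE x in std_gaussian. P (\<mu> + d * x)"
  shows "AE x in lborel. P x"
proof -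
  have "AE x in lborel. P (\<mu> + d * x)" using assms(3) by (simp add: AE_std_gaussian_iff)
  then have "AE x in lborel. P (\<mu> + d * (- \<mu> / d + 1 / d * x))"
    by (rule AE_borel_affine[rotated 2]) (use assms(2) in auto)
  then show ?thesis using assms(2) by (simp add: field_simps)
qed

text \<open>The three values form the Gram matrix of \<open>\<psi> u\<close> and
  \<open>\<psi> v\<close> in the space of square-integrable functions. Without a gap these two would
  agree almost surely; since \<open>v\<close> keeps a non-degenerate conditional law given
  \<open>u\<close>, that would make \<open>\<psi>\<close> almost everywhere constant.\<close>

lemma gauss_dual_psd:
  assumes pg: "poly_growth \<psi>" and "psd a c b"
  shows "psd (gauss_dual \<psi> a a a) (gauss_dual \<psi> a c b) (gauss_dual \<psi> b b b)"
    and "c\<^sup>2 < a * b \<Longrightarrow> \<nexists>k. AE x in lborel. \<psi> x = k \<Longrightarrow>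
      2 * gauss_dual \<psi> a c b < gauss_dual \<psi> a a a + gauss_dual \<psi> b b b"
proof -
  have [measurable]: "\<psi> \<in> borel_measurable borel" using pg by auto
  obtain \<rho> \<kappa> where \<rho>\<kappa>: "\<kappa> \<ge> 0" "\<rho>\<^sup>2 + \<kappa>\<^sup>2 = 1" "c / sqrt a = sqrt b * \<rho>" "sqrt (b - c\<^sup>2 / a) = sqrt b * \<kappa>"
      "c\<^sup>2 < a * b \<Longrightarrow> \<kappa> > 0"
    by (rule psd_correlation[OF assms(2)]) blast
  have ab: "a \<ge> 0" "b \<ge> 0" using assms(2) by (auto simp: psd_def)
  \<comment> \<open>The term \<open>0 * snd z\<close> brings \<open>U\<close> into the form of a
    linear combination, as required for integrability of the products.\<close>
  define U where "U z = \<psi> (sqrt a * fst z + 0 * snd z)" for z :: "real \<times> real"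
  define V where "V z = \<psi> (sqrt b * \<rho> * fst z + sqrt b * \<kappa> * snd z)" for z :: "real \<times> real"
  have int [simp]: "integrable std_gaussian2 (\<lambda>z. U z * U z)" "integrable std_gaussian2 (\<lambda>z. U z * V z)"
    "integrable std_gaussian2 (\<lambda>z. V z * V z)"
    unfolding U_def V_def by (intro integrable_gaussian2_linear_comb pg)+
  have sq: "poly_growth (\<lambda>x. (\<psi> (sqrt a * x))\<^sup>2)" for a
    unfolding power2_eq_square using poly_growth_affine[OF pg, of 0 "sqrt a"]
    by (intro poly_growth_mult) simp_all
  have A: "(\<integral>z. U z * U z \<partial>std_gaussian2) = gauss_dual \<psi> a a a"
    using integral_gaussian2_marginal[OF sq[of a], of 0 1]
    by (simp add: gauss_dual_diag(1)[OF pg ab(1)] U_def power2_eq_square)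
  have B: "(\<integral>z. V z * V z \<partial>std_gaussian2) = gauss_dual \<psi> b b b"
    using integral_gaussian2_marginal[OF sq[of b] \<rho>\<kappa>(1,2)]
    by (simp add: gauss_dual_diag(1)[OF pg ab(2)] V_def power2_eq_square distrib_left mult.assoc)
  have C: "(\<integral>z. U z * V z \<partial>std_gaussian2) = gauss_dual \<psi> a c b"
    unfolding gauss_dual_eq_integral[OF poly_growth_measurable[OF pg]] \<rho>\<kappa>(3,4) U_def V_def by simp
  have form: "(\<integral>z. (s * U z + t * V z)\<^sup>2 \<partial>std_gaussian2) =
      gauss_dual \<psi> a a a * s\<^sup>2 + 2 * gauss_dual \<psi> a c b * s * t + gauss_dual \<psi> b b b * t\<^sup>2"
    and form_int: "integrable std_gaussian2 (\<lambda>z. (s * U z + t * V z)\<^sup>2)" for s t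
  proof -
    have *: "(\<lambda>z. (s * U z + t * V z)\<^sup>2) = (\<lambda>z. s\<^sup>2 * (U z * U z) + ((2 * s * t) * (U z * V z) + t\<^sup>2 * (V z * V z)))"
      by (simp add: fun_eq_iff power2_eq_square algebra_simps)
    show "integrable std_gaussian2 (\<lambda>z. (s * U z + t * V z)\<^sup>2)" unfolding * by simp
    show "(\<integral>z. (s * U z + t * V z)\<^sup>2 \<partial>std_gaussian2) =
      gauss_dual \<psi> a a a * s\<^sup>2 + 2 * gauss_dual \<psi> a c b * s * t + gauss_dual \<psi> b b b * t\<^sup>2"
      unfolding * by (simp add: A B C)
  qed
  show psd: "psd (gauss_dual \<psi> a a a) (gauss_dual \<psi> a c b) (gauss_dual \<psi> b b b)"
    unfolding psd_iff_quadratic_form form[symmetric] by simp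
  assume "c\<^sup>2 < a * b" and nc: "\<nexists>k. AE x in lborel. \<psi> x = k"
  show "2 * gauss_dual \<psi> a c b < gauss_dual \<psi> a a a + gauss_dual \<psi> b b b"
  proof (rule ccontr)
    assume "\<not> ?thesis"
    with psd_gap[OF psd] have "(\<integral>z. (1 * U z + (-1) * V z)\<^sup>2 \<partial>std_gaussian2) = 0"
      by (subst form) simp
    then have "AE z in std_gaussian2. (1 * U z + (-1) * V z)\<^sup>2 = 0"
      by (subst (asm) integral_nonneg_eq_0_iff_AE[OF form_int]) simp_all
    \<comment> \<open>For a fixed \<open>e\<close> the value of \<open>U\<close> is a constant,
      while the argument of \<open>\<psi>\<close> in \<open>V\<close> is affine in \<open>e'\<close>
      with non-zero slope.\<close>
    then have "AE e in std_gaussian. AE e' in std_gaussian. (1 * U (e, e') + (-1) * V (e, e'))\<^sup>2 = 0"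
      by (rule std_gaussian2.AE_pair)
    then obtain e where "AE e' in std_gaussian. (1 * U (e, e') + (-1) * V (e, e'))\<^sup>2 = 0"
      using eventually_happens'[OF std_gaussian.ae_filter_bot] by blast
    then have "AE e' in std_gaussian. \<psi> (sqrt b * \<rho> * e + sqrt b * \<kappa> * e') = \<psi> (sqrt a * e)"
      by eventually_elim (simp add: U_def V_def)
    moreover have "b \<noteq> 0" using \<open>c\<^sup>2 < a * b\<close> by auto
    ultimately have "AE x in lborel. \<psi> x = \<psi> (sqrt a * e)"
      using \<rho>\<kappa>(5)[OF \<open>c\<^sup>2 < a * b\<close>] by (intro AE_std_gaussian_affine[of "\<lambda>x. \<psi> x = _" "sqrt b * \<kappa>" "sqrt b * \<rho> * e"]) auto
    with nc show False by blast
  qed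
qed

lemma gauss_dual_diag_pos:
  assumes pg: "poly_growth \<psi>" and "a > 0" and nc: "\<nexists>k. AE x in lborel. \<psi> x = k"
  shows "gauss_dual \<psi> a a a > 0"
proof -
  have [measurable]: "\<psi> \<in> borel_measurable borel" using pg by auto
  have "gauss_dual \<psi> a a a \<noteq> 0"
  proof
    assume "gauss_dual \<psi> a a a = 0"
    then have 0: "(\<integral>e. (\<psi> (0 + sqrt a * e))\<^sup>2 \<partial>std_gaussian) = 0"
      using assms(2) by (simp add: gauss_dual_diag(1)[OF pg])
    have "integrable std_gaussian (\<lambda>e. (\<psi> (0 + sqrt a * e))\<^sup>2)"
      unfolding power2_eq_square by (intro integrable_poly_growth poly_growth_mult poly_growth_affine pg)
    from 0 have "AE e in std_gaussian. (\<psi> (0 + sqrt a * e))\<^sup>2 = 0"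
      by (subst (asm) integral_nonneg_eq_0_iff_AE[OF \<open>integrable _ _\<close>]) simp_all
    then have "AE e in std_gaussian. \<psi> (0 + sqrt a * e) = 0" by simp
    then have "AE x in lborel. \<psi> x = 0"
      using assms(2) by (intro AE_std_gaussian_affine[of "\<lambda>x. \<psi> x = 0" "sqrt a" 0]) auto
    with nc show False by blast
  qed
  moreover have "gauss_dual \<psi> a a a \<ge> 0" using assms(2) by (simp add: gauss_dual_diag(1)[OF pg])
  ultimately show ?thesis by simp
qed


subsection \<open>Propagation through the layers\<close>

text \<open>Here \<open>a\<close>, \<open>c\<close> and \<open>b\<close> are the values of a covariance at \<open>(x, x)\<close>, \<open>(x, y)\<close> and \<open>(y, y)\<close>; the flag \<open>sm\<close>
  stands for a smooth activation. In the other case the two arguments are either different in mean square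
  everywhere on \<open>S\<close>, or indistinguishable everywhere on \<open>S\<close>. The latter occurs for patches of a
  convolution that lie in the padding.\<close>

definition gram_gap :: "bool \<Rightarrow> 'a::real_normed_vector set \<Rightarrow> ('a \<Rightarrow> real) \<Rightarrow> ('a \<Rightarrow> real) \<Rightarrow> real \<Rightarrow> bool" where
  "gram_gap sm S a c b \<longleftrightarrow> smooth_on S a \<and> smooth_on S c \<and> 0 \<le> b \<and> (\<forall>x\<in>S. psd (a x) (c x) b) \<and>
     (sm \<or> (\<forall>x\<in>S. 2 * c x < a x + b) \<or> (\<forall>x\<in>S. a x = b \<and> c x = b))"

text \<open>The form needed in front of an activation. Both variances are positive also when the two
  arguments coincide: a non-smooth activation needs this for smoothness on the diagonal, and for a
  gap against a position in the padding.\<close>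

definition gram_strict :: "bool \<Rightarrow> 'a::real_normed_vector set \<Rightarrow> ('a \<Rightarrow> real) \<Rightarrow> ('a \<Rightarrow> real) \<Rightarrow> real \<Rightarrow> bool" where
  "gram_strict sm S a c b \<longleftrightarrow> smooth_on S a \<and> smooth_on S c \<and> 0 \<le> b \<and> (\<forall>x\<in>S. psd (a x) (c x) b) \<and>
     (sm \<or> (\<forall>x\<in>S. 0 < a x) \<and> 0 < b \<and>
       ((\<forall>x\<in>S. (c x)\<^sup>2 < a x * b) \<or> (\<forall>x\<in>S. a x = b \<and> c x = b)))"

text \<open>One strict summand is enough, since the other one satisfies the weak inequality by
  semi-definiteness. If neither is strict, both coincide, and so does the sum.\<close>

lemma gram_gap_add:
  assumes "open S" "gram_gap sm S a c b" "gram_gap sm S a' c' b'"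
  shows "gram_gap sm S (\<lambda>x. a x + a' x) (\<lambda>x. c x + c' x) (b + b')"
proof -
  have "2 * c x \<le> a x + b" "2 * c' x \<le> a' x + b'" if "x \<in> S" for x
    using assms(2,3) that psd_gap unfolding gram_gap_def by blast+
  then have "sm \<or> (\<forall>x\<in>S. 2 * (c x + c' x) < (a x + a' x) + (b + b')) \<or>
      (\<forall>x\<in>S. a x + a' x = b + b' \<and> c x + c' x = b + b')"
    using assms(2,3) unfolding gram_gap_def by (smt (verit, best))
  with assms show ?thesis unfolding gram_gap_def by (auto intro: psd_add)
qed

lemma gram_gap_const: "open S \<Longrightarrow> t \<ge> 0 \<Longrightarrow> gram_gap sm S (\<lambda>x. t) (\<lambda>x. t) t"
  by (auto simp: gram_gap_def psd_const)

lemma gram_gap_scale: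
  assumes "open S" "gram_gap sm S a c b" "r \<ge> 0"
  shows "gram_gap sm S (\<lambda>x. r * a x) (\<lambda>x. r * c x) (r * b)"
proof (cases "r = 0")
  case True
  then show ?thesis using gram_gap_const[OF assms(1), of 0] by simp
next
  case False
  then have "r > 0" using assms(3) by simp
  have "2 * (r * c x) < r * a x + r * b \<longleftrightarrow> 2 * c x < a x + b" for x
  proof -
    have "2 * (r * c x) < r * a x + r * b \<longleftrightarrow> r * (2 * c x) < r * (a x + b)" by (simp add: algebra_simps)
    then show ?thesis using \<open>r > 0\<close> by simp
  qed
  with assms show ?thesis unfolding gram_gap_def by (auto intro!: psd_scale)
qed

lemma gram_gap_sum:
  assumes "open S" "\<And>r. r \<in> N \<Longrightarrow> gram_gap sm S (a r) (c r) (b r)"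
  shows "gram_gap sm S (\<lambda>x. \<Sum>r\<in>N. a r x) (\<lambda>x. \<Sum>r\<in>N. c r x) (\<Sum>r\<in>N. b r)"
  using assms(2)
  by (induction N rule: infinite_finite_induct)
     (auto intro!: gram_gap_add gram_gap_const[of S 0, simplified] assms(1))

text \<open>By the inequality of arithmetic and geometric means,
  \<open>(2 * c x)\<^sup>2 < 4 * a x * b \<le> (a x + b)\<^sup>2\<close>.\<close>

lemma gram_strict_imp_gap: "gram_strict sm S a c b \<Longrightarrow> gram_gap sm S a c b"
proof -
  assume g: "gram_strict sm S a c b"
  have "2 * c x < a x + b" if "(c x)\<^sup>2 < a x * b" "psd (a x) (c x) b" for x
  proof (rule ccontr)
    assume "\<not> 2 * c x < a x + b"
    then have "(a x + b)\<^sup>2 \<le> (2 * c x)\<^sup>2" using that(2) by (intro power_mono) (auto simp: psd_def)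
    moreover have "0 \<le> (a x - b)\<^sup>2" by simp
    ultimately show False using that(1) by (simp add: power2_eq_square algebra_simps)
  qed
  with g show ?thesis unfolding gram_strict_def gram_gap_def by blast
qed

text \<open>Adding \<open>\<beta>\<^sup>2\<close> to all entries raises the determinant by exactly
  \<open>\<beta>\<^sup>2\<close> times the gap \<open>a x + b - 2 * c x\<close>.\<close>

lemma gram_gap_bias:
  assumes "open S" "gram_gap sm S a c b" "sm \<or> \<beta> > 0"
  shows "gram_strict sm S (\<lambda>x. a x + \<beta>\<^sup>2) (\<lambda>x. c x + \<beta>\<^sup>2) (b + \<beta>\<^sup>2)"
proof -
  have "gram_gap sm S (\<lambda>x. a x + \<beta>\<^sup>2) (\<lambda>x. c x + \<beta>\<^sup>2) (b + \<beta>\<^sup>2)"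
    by (intro gram_gap_add gram_gap_const assms) simp
  moreover have "(c x + \<beta>\<^sup>2)\<^sup>2 < (a x + \<beta>\<^sup>2) * (b + \<beta>\<^sup>2)"
    if "x \<in> S" "2 * c x < a x + b" "\<beta> > 0" for x
  proof -
    have "(c x)\<^sup>2 \<le> a x * b" using assms(2) that(1) by (simp add: gram_gap_def psd_def)
    moreover have "0 < \<beta>\<^sup>2 * (a x + b - 2 * c x)" using that by simp
    ultimately show ?thesis by (simp add: power2_eq_square algebra_simps)
  qed
  moreover have "0 < b + \<beta>\<^sup>2" if "\<beta> > 0"
    using assms(2) that by (simp add: gram_gap_def add_nonneg_pos)
  moreover have "0 < a x + \<beta>\<^sup>2" if "\<beta> > 0" "x \<in> S" for x
    using assms(2) that by (simp add: gram_gap_def psd_def add_nonneg_pos)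
  ultimately show ?thesis using assms(2,3) unfolding gram_gap_def gram_strict_def by (smt (verit, best))
qed

text \<open>Both claims of the theorem go through the same induction: \<open>sm\<close> true for
  smooth activations with any bias, \<open>sm\<close> false for a positive bias and an activation
  that is not almost everywhere constant.\<close>

locale activation =
  fixes \<phi> d\<phi> :: "real \<Rightarrow> real" and \<beta> :: real and sm :: bool and S :: "'a::real_normed_vector set"
  assumes poly_growth_\<phi>: "poly_growth \<phi>" and poly_growth_d\<phi>: "poly_growth d\<phi>"
    and smooth_growth_\<phi>: "sm \<Longrightarrow> smooth_growth \<phi>" and smooth_growth_d\<phi>: "sm \<Longrightarrow> smooth_growth d\<phi>"
    and not_const: "\<not> sm \<Longrightarrow> \<nexists>k. AE x in lborel. \<phi> x = k"
    and bias: "sm \<or> \<beta> > 0"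
    and open_S: "open S"
begin

lemma gram_gap_dual:
  assumes g: "gram_strict sm S a c b"
  shows "gram_gap sm S (\<lambda>x. gauss_dual \<phi> (a x) (a x) (a x)) (\<lambda>x. gauss_dual \<phi> (a x) (c x) b) (gauss_dual \<phi> b b b)"
proof -
  have "smooth_on S (\<lambda>x. gauss_dual \<phi> (a x) (a x) (a x))"
    using g smooth_growth_\<phi>
    by (intro smooth_on_gauss_dual_diag open_S poly_growth_\<phi>) (auto simp: gram_strict_def psd_def)
  moreover have "smooth_on S (\<lambda>x. gauss_dual \<phi> (a x) (c x) b)"
    using g smooth_growth_\<phi>
    by (intro smooth_on_gauss_dual open_S poly_growth_\<phi>) (auto simp: gram_strict_def)
  moreover have "0 \<le> gauss_dual \<phi> b b b"
    using gauss_dual_psd(1)[OF poly_growth_\<phi> psd_const[of b]] g by (simp add: psd_def gram_strict_def)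
  moreover have "psd (gauss_dual \<phi> (a x) (a x) (a x)) (gauss_dual \<phi> (a x) (c x) b) (gauss_dual \<phi> b b b)" if "x \<in> S" for x
    using g that by (intro gauss_dual_psd(1) poly_growth_\<phi>) (auto simp: gram_strict_def)
  moreover have "sm \<or> (\<forall>x\<in>S. 2 * gauss_dual \<phi> (a x) (c x) b < gauss_dual \<phi> (a x) (a x) (a x) + gauss_dual \<phi> b b b) \<or>
      (\<forall>x\<in>S. gauss_dual \<phi> (a x) (a x) (a x) = gauss_dual \<phi> b b b \<and> gauss_dual \<phi> (a x) (c x) b = gauss_dual \<phi> b b b)"
  proof (cases "sm \<or> (\<forall>x\<in>S. a x = b \<and> c x = b)")
    case False
    then have "(c x)\<^sup>2 < a x * b" "psd (a x) (c x) b" if "x \<in> S" for x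
      using g that unfolding gram_strict_def by blast+
    then show ?thesis using gauss_dual_psd(2)[OF poly_growth_\<phi>] not_const False by blast
  qed auto
  ultimately show ?thesis unfolding gram_gap_def by blast
qed

text \<open>For a shift that puts only the position of \<open>y\<close> outside \<open>P\<close>:
  the terms involving \<open>y\<close> vanish and the gap becomes the second moment of the
  activation at \<open>x\<close>.\<close>

lemma gram_gap_dual_fst:
  assumes g: "gram_strict sm S a c b"
  shows "gram_gap sm S (\<lambda>x. gauss_dual \<phi> (a x) (a x) (a x)) (\<lambda>x. 0) 0"
  using gram_gap_dual[OF g] g gauss_dual_diag_pos[OF poly_growth_\<phi> _ not_const] open_S
  by (auto simp: gram_gap_def gram_strict_def psd_def)

text \<open>The opposite case, with only the position of \<open>x\<close> in the padding.\<close>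

lemma gram_gap_dual_snd:
  assumes g: "gram_strict sm S a c b"
  shows "gram_gap sm S (\<lambda>x. 0) (\<lambda>x. 0) (gauss_dual \<phi> b b b)"
  using gram_gap_dual[OF g] g gauss_dual_diag_pos[OF poly_growth_\<phi> _ not_const] open_S
  by (auto simp: gram_gap_def gram_strict_def psd_def)

lemma smooth_on_dual_d\<phi>:
  assumes "gram_strict sm S a c b"
  shows "smooth_on S (\<lambda>x. gauss_dual d\<phi> (a x) (c x) b)"
  using assms smooth_growth_d\<phi>
  by (intro smooth_on_gauss_dual open_S poly_growth_d\<phi>) (auto simp: gram_strict_def)

lemma smooth_on_dual_\<phi>:
  assumes "gram_strict sm S a c b"
  shows "smooth_on S (\<lambda>x. gauss_dual \<phi> (a x) (c x) b)"
  using gram_gap_dual[OF assms] by (simp add: gram_gap_def)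

lemma gram_strict_bias: "gram_gap sm S a c b \<Longrightarrow>
    gram_strict sm S (\<lambda>x. a x + \<beta>\<^sup>2) (\<lambda>x. c x + \<beta>\<^sup>2) (b + \<beta>\<^sup>2)"
  by (rule gram_gap_bias[OF open_S _ bias])

end

text \<open>The gap is the squared distance of \<open>X x\<close> and \<open>Y\<close>.\<close>

lemma gram_gap_inner:
  fixes X :: "'a::real_normed_vector \<Rightarrow> real ^ 'k"
  assumes S: "open S" and X: "\<And>i. smooth_on S (\<lambda>x. X x $ i)"
    and "sm \<or> (\<forall>x\<in>S. X x \<noteq> Y) \<or> (\<forall>x\<in>S. X x = Y)"
  shows "gram_gap sm S (\<lambda>x. X x \<bullet> X x) (\<lambda>x. X x \<bullet> Y) (Y \<bullet> Y)"
proof -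
  have "smooth_on S (\<lambda>x. X x \<bullet> X x)" "smooth_on S (\<lambda>x. X x \<bullet> Y)"
    unfolding inner_vec_def inner_real_def
    by (intro smooth_on_sum smooth_on_mult S X smooth_on_const)+
  moreover have "psd (X x \<bullet> X x) (X x \<bullet> Y) (Y \<bullet> Y)" for x
    by (simp add: psd_def Cauchy_Schwarz_ineq)
  moreover have "2 * (X x \<bullet> Y) < X x \<bullet> X x + Y \<bullet> Y" if "X x \<noteq> Y" for x
  proof -
    have "0 < (X x - Y) \<bullet> (X x - Y)" using that by simp
    then show ?thesis by (simp add: inner_diff_left inner_diff_right inner_commute)
  qed
  ultimately show ?thesis using assms(3) unfolding gram_gap_def by auto
qed

section \<open>Input kernels, fully connected and residual networks\<close>

lemma smooth_on_vec_nth: "open S \<Longrightarrow> smooth_on S (\<lambda>x :: real ^ 'n. x $ i)"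
  by (rule smooth_on_bounded_linear) (auto intro: bounded_linear_vec_nth)

text \<open>All pairs of coordinates occur in \<open>sep\<close> because patches at different
  positions are compared with each other, and 0 is excluded because a pixel of \<open>x\<close> may
  meet the padding of \<open>y\<close>.\<close>

locale ntk_point = activation \<phi> d\<phi> \<beta> sm S
  for \<phi> d\<phi> \<beta> sm and S :: "(real ^ 'n) set" +
  fixes y :: "real ^ 'n"
  assumes sep: "\<And>x j j'. \<not> sm \<Longrightarrow> x \<in> S \<Longrightarrow> x $ j \<noteq> 0 \<and> x $ j \<noteq> y $ j'"
begin

lemma gram_gap_input:
  "gram_gap sm S (\<lambda>x. (x \<bullet> x) / real CARD('n)) (\<lambda>x. (x \<bullet> y) / real CARD('n)) ((y \<bullet> y) / real CARD('n))"
proof -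
  have "gram_gap sm S (\<lambda>x. x \<bullet> x) (\<lambda>x. x \<bullet> y) (y \<bullet> y)"
  proof (rule gram_gap_inner[OF open_S smooth_on_vec_nth[OF open_S]])
    show "sm \<or> (\<forall>x\<in>S. x \<noteq> y) \<or> (\<forall>x\<in>S. x = y)" using sep by blast
  qed
  from gram_gap_scale[OF open_S this, of "1 / real CARD('n)"] show ?thesis by simp
qed

lemma gram_strict_input:
  "gram_strict sm S (\<lambda>x. input_kernel \<beta> x x) (\<lambda>x. input_kernel \<beta> x y) (input_kernel \<beta> y y)"
  unfolding input_kernel_def by (rule gram_strict_bias[OF gram_gap_input])

lemma smooth_on_input: "smooth_on S (\<lambda>x. input_kernel \<beta> x y)"
  using gram_strict_input by (simp add: gram_strict_def)

lemma gram_strict_fc_cov: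
  "gram_strict sm S (\<lambda>x. fc_cov \<phi> \<beta> l x x) (\<lambda>x. fc_cov \<phi> \<beta> l x y) (fc_cov \<phi> \<beta> l y y)"
proof (induction l)
  case (Suc l)
  from gram_strict_bias[OF gram_gap_dual[OF Suc]] show ?case by (simp add: dual_kernel_eq)
qed (simp add: gram_strict_input)

lemma smooth_on_fc_ntk: "smooth_on S (\<lambda>x. fc_ntk \<phi> d\<phi> \<beta> l x y)"
proof (induction l)
  case (Suc l)
  have "smooth_on S (\<lambda>x. fc_cov \<phi> \<beta> (Suc l) x y)"
    using gram_strict_fc_cov[of "Suc l"] by (simp only: gram_strict_def)
  with Suc show ?case
    by (simp add: dual_kernel_eq smooth_on_add smooth_on_mult open_S smooth_on_dual_d\<phi>[OF gram_strict_fc_cov]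
        del: fc_cov.simps)
qed (simp add: smooth_on_input)

text \<open>The gap is the right invariant here: a block adds a bias in front of the activation,
  which restores strictness inside the block, and the skip connection only adds a matrix that
  already has a gap or coincides.\<close>

lemma gram_gap_res_cov:
  "gram_gap sm S (\<lambda>x. res_cov \<phi> \<beta> s l x x) (\<lambda>x. res_cov \<phi> \<beta> s l x y) (res_cov \<phi> \<beta> s l y y)"
proof (induction l)
  case (Suc l)
  from gram_strict_imp_gap[OF gram_strict_bias[OF gram_gap_dual[OF gram_strict_bias[OF Suc]]]]
  show ?case
    by (simp add: dual_kernel_eq gram_gap_add[OF open_S Suc] gram_gap_scale[OF open_S])
qed (simp add: gram_strict_imp_gap[OF gram_strict_input])

lemma smooth_on_res_tan: "smooth_on S (\<lambda>x. res_tan \<phi> d\<phi> \<beta> s l x y)"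
proof (induction l)
  case (Suc l)
  note g = gram_strict_bias[OF gram_gap_res_cov[of s l]]
  have "smooth_on S (\<lambda>x. res_cov \<phi> \<beta> s l x y)"
    using gram_gap_res_cov[of s l] by (simp add: gram_gap_def)
  with Suc show ?case unfolding res_tan.simps Let_def dual_kernel_eq
    by (intro smooth_on_add smooth_on_mult smooth_on_const open_S smooth_on_dual_d\<phi>[OF g] smooth_on_dual_\<phi>[OF g])
qed (simp add: smooth_on_input)

lemma smooth_on_res_ntk: "smooth_on S (\<lambda>x. res_ntk \<phi> d\<phi> \<beta> s L x y)"
  unfolding res_ntk_def
  using gram_gap_res_cov[of s L]
  by (intro smooth_on_add smooth_on_const open_S smooth_on_res_tan) (simp add: gram_gap_def)

end

section \<open>Convolutional networks\<close>

context ntk_point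
begin

text \<open>Inside \<open>P\<close> a single channel separates the pixels. Outside \<open>P\<close>
  the pixel of \<open>x\<close> is 0, so whether it equals the pixel of \<open>y\<close> does not
  depend on \<open>x\<close>, and one alternative holds on all of \<open>S\<close>.\<close>

lemma gram_gap_pixel:
  fixes P :: "(int ^ 'm) set" and ix :: "(int ^ 'm) \<times> 'c::finite \<Rightarrow> 'n"
  shows "gram_gap sm S (\<lambda>x. pixel P ix x p \<bullet> pixel P ix x p) (\<lambda>x. pixel P ix x p \<bullet> pixel P ix y q)
    (pixel P ix y q \<bullet> pixel P ix y q)"
proof (rule gram_gap_inner[OF open_S])
  show "smooth_on S (\<lambda>x. pixel P ix x p $ i)" for i
    by (cases "p \<in> P") (simp_all add: pixel_def smooth_on_vec_nth smooth_on_const open_S)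
  have "pixel P ix x p \<noteq> pixel P ix y q" if "p \<in> P" "\<not> sm" "x \<in> S" for x
  proof
    assume "pixel P ix x p = pixel P ix y q"
    \<comment> \<open>Any channel does; \<open>undefined\<close> names one.\<close>
    then have "pixel P ix x p $ undefined = pixel P ix y q $ undefined" by simp
    then show False using that sep by (auto simp: pixel_def split: if_splits)
  qed
  then show "sm \<or> (\<forall>x\<in>S. pixel P ix x p \<noteq> pixel P ix y q) \<or> (\<forall>x\<in>S. pixel P ix x p = pixel P ix y q)"
    by (cases "p \<in> P") (auto simp: pixel_def)
qed

text \<open>The positions are arbitrary in the induction because a patch average at
  \<open>(p, q)\<close> involves the shifted pairs \<open>(p + r, q + r)\<close>.\<close>

lemma gram_strict_conv_cov:
  fixes P N :: "(int ^ 'm) set" and ix :: "(int ^ 'm) \<times> 'c::finite \<Rightarrow> 'n"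
  shows "gram_strict sm S (\<lambda>x. conv_cov \<phi> \<beta> P N ix l (p, x) (p, x))
    (\<lambda>x. conv_cov \<phi> \<beta> P N ix l (p, x) (q, y)) (conv_cov \<phi> \<beta> P N ix l (q, y) (q, y))"
proof (induction l arbitrary: p q)
  case 0
  have "gram_gap sm S
      (\<lambda>x. 1 / (real CARD('c) * real (card N)) * (\<Sum>r\<in>N. pixel P ix x (p + r) \<bullet> pixel P ix x (p + r)))
      (\<lambda>x. 1 / (real CARD('c) * real (card N)) * (\<Sum>r\<in>N. pixel P ix x (p + r) \<bullet> pixel P ix y (q + r)))
      (1 / (real CARD('c) * real (card N)) * (\<Sum>r\<in>N. pixel P ix y (q + r) \<bullet> pixel P ix y (q + r)))"
    by (intro gram_gap_scale gram_gap_sum gram_gap_pixel open_S) simp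
  from gram_strict_bias[OF this] show ?case by (simp add: conv_input_kernel_def)
next
  case (Suc l)
  let ?A = "conv_cov \<phi> \<beta> P N ix l"
  let ?t = "\<lambda>p x q y. if p \<in> P \<and> q \<in> P then dual_kernel \<phi> ?A (p, x) (q, y) else 0"
  \<comment> \<open>Four cases: both positions in \<open>P\<close>, exactly one of them, or none,
    where all entries are 0 and the arguments coincide.\<close>
  have gap: "gram_gap sm S (\<lambda>x. ?t p x p x) (\<lambda>x. ?t p x q y) (?t q y q y)" for p q
    using gram_gap_dual[OF Suc[of p q]] gram_gap_dual_fst[OF Suc[of p q]] gram_gap_dual_snd[OF Suc[of p q]]
      gram_gap_const[OF open_S, of 0]
    by (cases "p \<in> P"; cases "q \<in> P") (simp_all add: dual_kernel_eq)
  have "gram_gap sm S (\<lambda>x. 1 / real (card N) * (\<Sum>r\<in>N. ?t (p + r) x (p + r) x))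
      (\<lambda>x. 1 / real (card N) * (\<Sum>r\<in>N. ?t (p + r) x (q + r) y))
      (1 / real (card N) * (\<Sum>r\<in>N. ?t (q + r) y (q + r) y))"
    by (intro gram_gap_scale gram_gap_sum gap open_S) simp
  from gram_strict_bias[OF this] show ?case by (simp add: patch_mean_def)
qed

lemma smooth_on_conv_cov:
  fixes P N :: "(int ^ 'm) set" and ix :: "(int ^ 'm) \<times> 'c::finite \<Rightarrow> 'n"
  shows "smooth_on S (\<lambda>x. conv_cov \<phi> \<beta> P N ix l (p, x) (q, y))"
  using gram_strict_conv_cov[of P N ix l p q] by (simp add: gram_strict_def)

lemma smooth_on_conv_tan:
  fixes P N :: "(int ^ 'm) set" and ix :: "(int ^ 'm) \<times> 'c::finite \<Rightarrow> 'n"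
  shows "smooth_on S (\<lambda>x. conv_tan \<phi> d\<phi> \<beta> P N ix l (p, x) (q, y))"
proof (induction l arbitrary: p q)
  case 0
  then show ?case using smooth_on_conv_cov[of P N ix 0 p q] by simp
next
  case (Suc l)
  let ?t = "\<lambda>p x q y. if p \<in> P \<and> q \<in> P then dual_kernel d\<phi> (conv_cov \<phi> \<beta> P N ix l) (p, x) (q, y) *
    conv_tan \<phi> d\<phi> \<beta> P N ix l (p, x) (q, y) else 0"
  have "smooth_on S (\<lambda>x. ?t p x q y)" for p q
    using smooth_on_mult[OF open_S smooth_on_dual_d\<phi>[OF gram_strict_conv_cov[of P N ix l p q]] Suc[of p q]]
    by (cases "p \<in> P"; cases "q \<in> P") (simp_all add: dual_kernel_eq smooth_on_const open_S)
  then have "smooth_on S (\<lambda>x. conv_cov \<phi> \<beta> P N ix (Suc l) (p, x) (q, y) +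
      (\<Sum>r\<in>N. ?t (p + r) x (q + r) y) / real (card N))"
    by (intro smooth_on_add smooth_on_divide_const smooth_on_sum open_S smooth_on_conv_cov)
  then show ?case by (simp add: patch_mean_def)
qed

lemma smooth_on_conv_last:
  fixes P N :: "(int ^ 'm) set" and ix :: "(int ^ 'm) \<times> 'c::finite \<Rightarrow> 'n"
  shows "smooth_on S (\<lambda>x. conv_last \<phi> d\<phi> \<beta> P N ix L (p, x) (q, y))"
  unfolding conv_last_def dual_kernel_eq
  by (intro smooth_on_add smooth_on_mult open_S smooth_on_conv_tan
      smooth_on_dual_\<phi>[OF gram_strict_conv_cov] smooth_on_dual_d\<phi>[OF gram_strict_conv_cov])

lemma smooth_on_ntk:
  fixes P N :: "(int ^ 'm) set" and ix :: "(int ^ 'm) \<times> 'c::finite \<Rightarrow> 'n"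
  assumes "k = fc_ntk \<phi> d\<phi> \<beta> L \<or> k = res_ntk \<phi> d\<phi> \<beta> s L \<or>
    k = conv_flat_ntk \<phi> d\<phi> \<beta> P N ix L \<or> k = conv_gap_ntk \<phi> d\<phi> \<beta> P N ix L"
  shows "smooth_on S (\<lambda>x. k x y)"
proof -
  have "smooth_on S (\<lambda>x. conv_flat_ntk \<phi> d\<phi> \<beta> P N ix L x y)" "smooth_on S (\<lambda>x. conv_gap_ntk \<phi> d\<phi> \<beta> P N ix L x y)"
    unfolding conv_flat_ntk_def conv_gap_ntk_def
    by (intro smooth_on_add smooth_on_divide_const smooth_on_sum smooth_on_const open_S smooth_on_conv_last)+
  with assms smooth_on_fc_ntk smooth_on_res_ntk show ?thesis by blast
qed

end


subsection \<open>Activations with finitely many singularities\<close>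

lemma smooth_on_deriv:
  fixes f :: "real \<Rightarrow> real"
  assumes "open S" "smooth_on S f"
  shows "smooth_on S (deriv f)"
proof (rule smooth_on_cong[OF assms(1) smooth_on_frechet_derivative[OF assms(2), of 1]])
  fix x assume "x \<in> S"
  then have "f differentiable (at x)"
    using smooth_on_has_derivative[OF assms(2)] by (auto simp: differentiable_def)
  then show "frechet_derivative f (at x) 1 = deriv f x"
    by (metis DERIV_deriv_iff_real_differentiable frechet_derivative_at has_field_derivative_def mult.right_neutral)
qed

text \<open>Continuity off a countable set gives measurability, and the finitely many arbitrary
  values on \<open>D\<close> are absorbed into the constant \<open>M\<close>.\<close>

lemma poly_growth_off_finite:
  assumes "finite D" "smooth_on (- D) f" "\<And>x. x \<notin> D \<Longrightarrow> \<bar>f x\<bar> \<le> l1 * \<bar>x\<bar> + l2"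
  shows "poly_growth f"
proof (rule poly_growthI)
  show "f \<in> borel_measurable borel"
    using assms(1) smooth_on_imp_continuous_on[OF assms(2)]
    by (intro borel_measurable_continuous_countable_exceptions[of D]) (simp_all add: countable_finite)
  define M where "M = \<bar>l1\<bar> + \<bar>l2\<bar> + (\<Sum>x\<in>D. \<bar>f x\<bar>)"
  fix x
  have "\<bar>f x\<bar> \<le> M * (1 + \<bar>x\<bar>)"
  proof (cases "x \<in> D")
    case True
    then have "\<bar>f x\<bar> \<le> M" unfolding M_def
      using member_le_sum[OF True _ assms(1), of "\<lambda>x. \<bar>f x\<bar>"] by simp
    also have "\<dots> * 1 \<le> M * (1 + \<bar>x\<bar>)" by (intro mult_left_mono) (auto simp: M_def intro!: sum_nonneg add_nonneg_nonneg)
    finally show ?thesis by simp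
  next
    case False
    have "0 \<le> (\<Sum>x\<in>D. \<bar>f x\<bar>)" by (intro sum_nonneg) simp
    then have "l1 \<le> M" "l2 \<le> M" unfolding M_def by linarith+
    have "\<bar>f x\<bar> \<le> l1 * \<bar>x\<bar> + l2" by (rule assms(3)[OF False])
    also have "\<dots> \<le> M * \<bar>x\<bar> + M"
      by (intro add_mono mult_right_mono \<open>l1 \<le> M\<close> \<open>l2 \<le> M\<close>) simp
    finally show ?thesis by (simp add: algebra_simps)
  qed
  then show "\<bar>f x\<bar> \<le> M * (1 + \<bar>x\<bar>) ^ 1" by simp
qed

lemma smooth_growth_of_deriv_bounds:
  assumes "smooth_on UNIV f" "\<And>j. \<exists>l1 l2. \<forall>x. \<bar>(deriv ^^ j) f x\<bar> \<le> l1 * \<bar>x\<bar> + l2"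
  shows "smooth_growth f"
proof -
  have sm: "smooth_on UNIV ((deriv ^^ j) f)" for j
    by (induction j) (auto intro: assms(1) smooth_on_deriv)
  have pg: "poly_growth ((deriv ^^ j) f)" for j
    using assms(2)[of j] sm[of j] poly_growth_off_finite[of "{}" "(deriv ^^ j) f"] by auto
  have D: "((deriv ^^ j) f has_real_derivative (deriv ^^ Suc j) f x) (at x)" for j x
    using smooth_on_has_derivative[OF sm[of j], of x]
    by (auto simp: DERIV_deriv_iff_real_differentiable differentiable_def)
  have "times_diff_growth n ((deriv ^^ j) f)" for n j
  proof (induction n arbitrary: j)
    case (Suc n)
    then show ?case using pg[of j] D[of j] by (auto simp del: funpow.simps)
  qed (simp add: pg)
  from this[of _ 0] show ?thesis by (simp add: smooth_growth_def)
qed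

text \<open>The complement is a finite union of coordinate hyperplanes, each of them closed and
  negligible.\<close>

lemma conull_open_generic:
  fixes y :: "real ^ 'n"
  defines "U \<equiv> {x :: real ^ 'n. \<forall>j. x $ j \<noteq> 0 \<and> (\<forall>j'. x $ j \<noteq> y $ j')}"
  shows "open U" "- U \<in> null_sets lebesgue"
proof -
  have eq: "- U = (\<Union>j. \<Union>t\<in>insert 0 (range (\<lambda>j'. y $ j')). {x. x $ j = t})"
    unfolding U_def by auto
  have c: "closed {x :: real ^ 'n. x $ j = t}" for j t
    by (intro closed_Collect_eq continuous_intros)
  then have "closed (- U)" unfolding eq by (intro closed_UN ballI c) simp_all
  then show "open U" by (simp add: closed_open)
  have n: "negligible {x :: real ^ 'n. x $ j = t}" for j t
    using negligible_standard_hyperplane[of "axis j (1::real)" t] by (simp add: inner_axis inner_real_def)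
  have "negligible (\<Union>t\<in>insert 0 (range (\<lambda>j'. y $ j')). {x :: real ^ 'n. x $ j = t})" for j
    by (rule negligible_Union) (simp, elim imageE, simp only: n)
  then have "negligible (- U)"
    unfolding eq by (intro negligible_Union) (simp, elim imageE, simp only:)
  then show "- U \<in> null_sets lebesgue" by (simp add: negligible_iff_null_sets)
qed

theorem proposition2:
  fixes \<phi> d\<phi> :: "real \<Rightarrow> real"
    and D :: "real set"
    and \<beta> s :: real
    and L :: nat
    and P N :: "(int ^ 'm) set"
    and ix :: "(int ^ 'm) \<times> 'c::finite \<Rightarrow> 'n::finite"
    and k :: "real ^ 'n \<Rightarrow> real ^ 'n \<Rightarrow> real"
    and y :: "real ^ 'n"
  assumes "finite D"
    and "smooth_on (- D) \<phi>"
    and "\<And>j. \<exists>l1 l2. \<forall>x. x \<notin> D \<longrightarrow> \<bar>(deriv ^^ j) \<phi> x\<bar> \<le> l1 * \<bar>x\<bar> + l2"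
    and "\<And>x. x \<notin> D \<Longrightarrow> d\<phi> x = deriv \<phi> x"
    and "\<beta> \<ge> 0"
    and "k = fc_ntk \<phi> d\<phi> \<beta> L \<or>
         s > 0 \<and> k = res_ntk \<phi> d\<phi> \<beta> s L \<or>
         conv_shape P N ix \<and> L \<ge> 1 \<and>
           (k = conv_flat_ntk \<phi> d\<phi> \<beta> P N ix L \<or> k = conv_gap_ntk \<phi> d\<phi> \<beta> P N ix L)"
  shows "(D = {} \<longrightarrow> smooth_on UNIV (\<lambda>x. k x y)) \<and>
    (\<beta> > 0 \<and>
       (\<forall>x x'. x \<ge> 0 \<longrightarrow> x' \<ge> 0 \<longrightarrow> x \<noteq> x' \<longrightarrow>
          (\<integral>\<epsilon>. (\<phi> (x * \<epsilon>))\<^sup>2 \<partial>std_gaussian) \<noteq> (\<integral>\<epsilon>. (\<phi> (x' * \<epsilon>))\<^sup>2 \<partial>std_gaussian)) \<longrightarrow>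
     (\<exists>U. open U \<and> - U \<in> null_sets lebesgue \<and> smooth_on U (\<lambda>x. k x y)))"
proof (intro conjI impI)
  have k: "k = fc_ntk \<phi> d\<phi> \<beta> L \<or> k = res_ntk \<phi> d\<phi> \<beta> s L \<or>
    k = conv_flat_ntk \<phi> d\<phi> \<beta> P N ix L \<or> k = conv_gap_ntk \<phi> d\<phi> \<beta> P N ix L"
    using assms(6) by blast
  have oD: "open (- D)" using assms(1) by (simp add: finite_imp_closed open_Compl)
  obtain l1 l2 where "\<And>x. x \<notin> D \<Longrightarrow> \<bar>\<phi> x\<bar> \<le> l1 * \<bar>x\<bar> + l2"
    using assms(3)[of 0] by auto
  then have pg: "poly_growth \<phi>" by (rule poly_growth_off_finite[OF assms(1,2)])
  obtain l1' l2' where "\<And>x. x \<notin> D \<Longrightarrow> \<bar>deriv \<phi> x\<bar> \<le> l1' * \<bar>x\<bar> + l2'"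
    using assms(3)[of 1] by auto
  then have "\<bar>d\<phi> x\<bar> \<le> l1' * \<bar>x\<bar> + l2'" if "x \<notin> D" for x
    using assms(4)[OF that] that by simp
  moreover have "smooth_on (- D) d\<phi>"
    by (rule smooth_on_cong[OF oD smooth_on_deriv[OF oD assms(2)]]) (simp add: assms(4))
  ultimately have pg': "poly_growth d\<phi>" by (intro poly_growth_off_finite[OF assms(1)])
  {
    assume D: "D = {}"
    have sg: "smooth_growth \<phi>"
      using assms(2,3) D by (intro smooth_growth_of_deriv_bounds) auto
    have "d\<phi> = deriv \<phi>" using assms(4) D by auto
    then have "smooth_growth d\<phi>" using smooth_growth_deriv(2)[OF sg] by simp
    \<comment> \<open>With \<open>sm\<close> true the condition \<open>sep\<close> is vacuous, so
      the whole space is allowed.\<close>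
    then interpret ntk_point \<phi> d\<phi> \<beta> True UNIV y
      by unfold_locales (use pg pg' sg in auto)
    show "smooth_on UNIV (\<lambda>x. k x y)" by (rule smooth_on_ntk[OF k])
  next
    assume inj: "\<beta> > 0 \<and> (\<forall>x x'. x \<ge> 0 \<longrightarrow> x' \<ge> 0 \<longrightarrow> x \<noteq> x' \<longrightarrow>
          (\<integral>\<epsilon>. (\<phi> (x * \<epsilon>))\<^sup>2 \<partial>std_gaussian) \<noteq> (\<integral>\<epsilon>. (\<phi> (x' * \<epsilon>))\<^sup>2 \<partial>std_gaussian))"
    \<comment> \<open>A function that is almost everywhere equal to \<open>c\<close> has second
      moment \<open>c\<^sup>2\<close> at every non-zero scale, because scaling preserves null sets;
      the scales 1 and 2 then contradict the hypothesis.\<close>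
    have nc: "\<nexists>c. AE x in lborel. \<phi> x = c"
    proof
      assume "\<exists>c. AE x in lborel. \<phi> x = c"
      then obtain c where c: "AE x in lborel. \<phi> x = c" by blast
      have [measurable]: "\<phi> \<in> borel_measurable borel" using pg by auto
      have "(\<integral>\<epsilon>. (\<phi> (x * \<epsilon>))\<^sup>2 \<partial>std_gaussian) = (\<integral>\<epsilon>. c\<^sup>2 \<partial>std_gaussian)" if "x \<noteq> 0" for x
      proof (rule integral_cong_AE)
        have "AE \<epsilon> in lborel. \<phi> (0 + x * \<epsilon>) = c"
          by (rule AE_borel_affine[OF that _ c]) measurable
        then have "AE \<epsilon> in std_gaussian. \<phi> (x * \<epsilon>) = c" by (simp add: AE_std_gaussian_iff)
        then show "AE \<epsilon> in std_gaussian. (\<phi> (x * \<epsilon>))\<^sup>2 = c\<^sup>2" by eventually_elim simp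
      qed measurable
      from this[of 1] this[of 2]
      have "(\<integral>\<epsilon>. (\<phi> (1 * \<epsilon>))\<^sup>2 \<partial>std_gaussian) = (\<integral>\<epsilon>. (\<phi> (2 * \<epsilon>))\<^sup>2 \<partial>std_gaussian)"
        by (metis one_neq_zero zero_neq_numeral)
      moreover have "(0::real) \<le> 1" "(0::real) \<le> 2" "(1::real) \<noteq> 2" by simp_all
      ultimately show False using inj by blast
    qed
    define U where "U = {x :: real ^ 'n. \<forall>j. x $ j \<noteq> 0 \<and> (\<forall>j'. x $ j \<noteq> y $ j')}"
    interpret ntk_point \<phi> d\<phi> \<beta> False U y
      by unfold_locales (use pg pg' nc inj conull_open_generic[of y] in \<open>auto simp: U_def\<close>)
    show "\<exists>U. open U \<and> - U \<in> null_sets lebesgue \<and> smooth_on U (\<lambda>x. k x y)"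
      using conull_open_generic[of y] smooth_on_ntk[OF k] by (auto simp: U_def)
  }
qed

end
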